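(* Let $\mathcal{A}$ be an abelian category with enough injectives, let $\mathcal{B}$ be an abelian category, and let $F:\mathcal{A}\to\mathcal{B}$ be an additive left-exact functor. Let $M$ be an object of $\mathcal{A}$ and let $0\to M\to J^{\bullet}$ be an $F$-acyclic resolution of $M$. For $n\ge 1$ let $c^n: H^n(FJ^{\bullet})\to R^nF M$ be the canonical isomorphism and let $d^n: H^n(FJ^{\bullet})\to R^nF M$ be the dimension shifting isomorphism (both defined in the context). Then for all $n\ge 1$, $$d^n = (-1)^{(n^2+n)/2}\, c^n .$$
   Context: Derived functors. For each object $M$ of $\mathcal{A}$ an injective resolution $0\to M\to I^{\bullet}$ is chosen, and $R^iF M := H^i(FI^{\bullet})$; $R^0F$ is identified with $F$. For a short exact sequence $\mathcal{E}=(0\to A\to C\to B\to 0)$ in $\mathcal{A}$, $\partial^p_{\mathcal{E}}: R^pF B\to R^{p+1}F A$ denotes the usual connecting homomorphism of derived functors, that is, the (snake lemma) connecting homomorphism, with no extra sign, obtained by applying $F$ to a short exact sequence of injective resolutions of $A$, $C$, $B$ compatible with $\mathcal{E}$. $F$-acyclic resolution. A resolution $0\to M\to J^{\bullet}$ (with $J^{\bullet}=(J^0\to J^1\to\cdots)$) is $F$-acyclic if $R^iF J^k=0$ for all $i\ge 1$ and $k\ge 0$. Canonical isomorphism. Let $0\to M\to I^{\bullet}$ be the chosen injective resolution of $M$. There is a homomorphism of complexes $f^{\bullet}: J^{\bullet}\to I^{\bullet}$, unique up to homotopy, which is compatible with the identity on $M$. Since $J^{\bullet}$ is $F$-acyclic,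 for each $n\ge 1$ the induced map $c^n := H^n(Ff^{\bullet}): H^n(FJ^{\bullet})\to H^n(FI^{\bullet})=R^nF M$ is an isomorphism, called the canonical isomorphism. Dimension shifting isomorphism. Put $Z^0=M$, and for $q\ge 1$ let $Z^q=\ker(J^q\to J^{q+1})=\operatorname{im}(J^{q-1}\to J^q)$. The resolution breaks up into short exact sequences $$\mathcal{E}_q=(0\to Z^{q-1}\to J^{q-1}\to Z^q\to 0),\qquad q\ge 1,$$ where $Z^{q-1}\to J^{q-1}$ is the inclusion (for $q=1$, the augmentation $M\to J^0$) and $J^{q-1}\to Z^q$ is the map induced by the differential. As the $J^i$ are $F$-acyclic, the connecting homomorphisms $\partial^p_{\mathcal{E}_q}: R^pF Z^q\to R^{p+1}F Z^{q-1}$ are isomorphisms for $p\ge 1$, $q\ge 1$, while $\partial^0_{\mathcal{E}_q}: FZ^q\to R^1F Z^{q-1}$ is epic and induces an isomorphism $\overline{\partial}^0_{\mathcal{E}_q}: FZ^q/\operatorname{im} FJ^{q-1}\to R^1F Z^{q-1}$. By left-exactness of $F$, $H^n(FJ^{\bullet})=FZ^n/\operatorname{im} FJ^{n-1}$ for $n\ge 1$. The dimension shifting isomorphism $d^n: H^n(FJ^{\bullet})\to R^nF M$ is the composite $$H^n(FJ^{\bullet})=\frac{FZ^n}{\operatorname{im} FJ^{n-1}}\xrightarrow{\ \overline{\partial}^0_{\mathcal{E}_n}\ }R^1F Z^{n-1}\xrightarrow{\ \partial^1_{\mathcal{E}_{n-1}}\ }R^2F Z^{n-2}\to\cdots\xrightarrow{\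 \partial^{n-1}_{\mathcal{E}_1}\ }R^nF Z^0=R^nF M .$$ *)

theory Defs
  imports "HOL-Algebra.Group"
begin

section \<open>Preadditive and abelian categories\<close>

text \<open>
  Objects and arrows are taken from two types, cut down to the carriers \<open>Obj\<close> and \<open>Arr\<close>.
  Composition is in applicative order: \<open>g \<cdot> f\<close> is \<open>f\<close> followed by \<open>g\<close>. \<open>Zero a b\<close> is the zero
  arrow from \<open>a\<close> to \<open>b\<close>. No condition is imposed on \<open>Comp\<close> or \<open>Add\<close> outside composable,
  respectively parallel, arrows.
\<close>

record ('o, 'm) precategory =
  Obj :: "'o set"
  Arr :: "'m set"
  Dom :: "'m \<Rightarrow> 'o"
  Cod :: "'m \<Rightarrow> 'o"
  Id :: "'o \<Rightarrow> 'm"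
  Comp :: "'m \<Rightarrow> 'm \<Rightarrow> 'm"  (infixl \<open>\<cdot>\<index>\<close> 70)
  Add :: "'m \<Rightarrow> 'm \<Rightarrow> 'm"
  Zero :: "'o \<Rightarrow> 'o \<Rightarrow> 'm"

definition Hom :: "('o, 'm) precategory \<Rightarrow> 'o \<Rightarrow> 'o \<Rightarrow> 'm set" where
  "Hom C a b = {f \<in> Arr C. Dom C f = a \<and> Cod C f = b}"

text \<open>The abelian group of arrows from \<open>a\<close> to \<open>b\<close>, in the (multiplicative) notation of HOL-Algebra;
  the integer multiple \<open>k f\<close> of an arrow \<open>f\<close> is therefore written as a power \<open>f [^] k\<close>.\<close>

definition hom_group :: "('o, 'm) precategory \<Rightarrow> 'o \<Rightarrow> 'o \<Rightarrow> 'm monoid" where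
  "hom_group C a b = \<lparr>carrier = Hom C a b, mult = Add C, one = Zero C a b\<rparr>"

definition is_mono :: "('o, 'm) precategory \<Rightarrow> 'm \<Rightarrow> bool" where
  "is_mono C m \<longleftrightarrow> m \<in> Arr C \<and>
     (\<forall>f\<in>Arr C. \<forall>g\<in>Arr C. Dom C f = Dom C g \<and> Cod C f = Dom C m \<and> Cod C g = Dom C m \<and>
        m \<cdot>\<^bsub>C\<^esub> f = m \<cdot>\<^bsub>C\<^esub> g \<longrightarrow> f = g)"

definition is_epi :: "('o, 'm) precategory \<Rightarrow> 'm \<Rightarrow> bool" where
  "is_epi C e \<longleftrightarrow> e \<in> Arr C \<and>
     (\<forall>f\<in>Arr C. \<forall>g\<in>Arr C. Cod C f = Cod C g \<and> Dom C f = Cod C e \<and> Dom C g = Cod C e \<and>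
        f \<cdot>\<^bsub>C\<^esub> e = g \<cdot>\<^bsub>C\<^esub> e \<longrightarrow> f = g)"

definition is_zero_object :: "('o, 'm) precategory \<Rightarrow> 'o \<Rightarrow> bool" where
  "is_zero_object C z \<longleftrightarrow> z \<in> Obj C \<and>
     (\<forall>a\<in>Obj C. (\<exists>!f. f \<in> Hom C a z) \<and> (\<exists>!f. f \<in> Hom C z a))"

definition is_kernel :: "('o, 'm) precategory \<Rightarrow> 'm \<Rightarrow> 'm \<Rightarrow> bool" where
  "is_kernel C k f \<longleftrightarrow> f \<in> Arr C \<and> k \<in> Arr C \<and> Cod C k = Dom C f \<and>
     f \<cdot>\<^bsub>C\<^esub> k = Zero C (Dom C k) (Cod C f) \<and>
     (\<forall>h\<in>Arr C. Cod C h = Dom C f \<and> f \<cdot>\<^bsub>C\<^esub> h = Zero C (Dom C h) (Cod C f) \<longrightarrow>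
        (\<exists>!g. g \<in> Hom C (Dom C h) (Dom C k) \<and> k \<cdot>\<^bsub>C\<^esub> g = h))"

definition is_cokernel :: "('o, 'm) precategory \<Rightarrow> 'm \<Rightarrow> 'm \<Rightarrow> bool" where
  "is_cokernel C q f \<longleftrightarrow> f \<in> Arr C \<and> q \<in> Arr C \<and> Dom C q = Cod C f \<and>
     q \<cdot>\<^bsub>C\<^esub> f = Zero C (Dom C f) (Cod C q) \<and>
     (\<forall>h\<in>Arr C. Dom C h = Cod C f \<and> h \<cdot>\<^bsub>C\<^esub> f = Zero C (Dom C f) (Cod C h) \<longrightarrow>
        (\<exists>!g. g \<in> Hom C (Cod C q) (Cod C h) \<and> g \<cdot>\<^bsub>C\<^esub> q = h))"

definition is_image :: "('o, 'm) precategory \<Rightarrow> 'm \<Rightarrow> 'm \<Rightarrow> bool" where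
  "is_image C i f \<longleftrightarrow> (\<exists>q. is_cokernel C q f \<and> is_kernel C i q)"

definition is_biproduct ::
    "('o, 'm) precategory \<Rightarrow> 'o \<Rightarrow> 'o \<Rightarrow> 'o \<Rightarrow> 'm \<Rightarrow> 'm \<Rightarrow> 'm \<Rightarrow> 'm \<Rightarrow> bool" where
  "is_biproduct C a b s i1 i2 p1 p2 \<longleftrightarrow> s \<in> Obj C \<and>
     i1 \<in> Hom C a s \<and> i2 \<in> Hom C b s \<and> p1 \<in> Hom C s a \<and> p2 \<in> Hom C s b \<and>
     p1 \<cdot>\<^bsub>C\<^esub> i1 = Id C a \<and> p2 \<cdot>\<^bsub>C\<^esub> i2 = Id C b \<and>
     p1 \<cdot>\<^bsub>C\<^esub> i2 = Zero C b a \<and> p2 \<cdot>\<^bsub>C\<^esub> i1 = Zero C a b \<and>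
     Add C (i1 \<cdot>\<^bsub>C\<^esub> p1) (i2 \<cdot>\<^bsub>C\<^esub> p2) = Id C s"

locale preadditive_category =
  fixes C :: "('o, 'm) precategory" (structure)
  assumes Dom_in_Obj: "f \<in> Arr C \<Longrightarrow> Dom C f \<in> Obj C"
    and Cod_in_Obj: "f \<in> Arr C \<Longrightarrow> Cod C f \<in> Obj C"
    and Id_in_Hom: "a \<in> Obj C \<Longrightarrow> Id C a \<in> Hom C a a"
    and Comp_in_Hom: "\<lbrakk>f \<in> Hom C a b; g \<in> Hom C b c\<rbrakk> \<Longrightarrow> g \<cdot> f \<in> Hom C a c"
    and Comp_assoc: "\<lbrakk>f \<in> Hom C a b; g \<in> Hom C b c; h \<in> Hom C c d\<rbrakk> \<Longrightarrow> (h \<cdot> g) \<cdot> f = h \<cdot> (g \<cdot> f)"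
    and Comp_Id_right: "f \<in> Hom C a b \<Longrightarrow> f \<cdot> Id C a = f"
    and Comp_Id_left: "f \<in> Hom C a b \<Longrightarrow> Id C b \<cdot> f = f"
    and comm_group_Hom: "\<lbrakk>a \<in> Obj C; b \<in> Obj C\<rbrakk> \<Longrightarrow> comm_group (hom_group C a b)"
    and Comp_Add_right: "\<lbrakk>f \<in> Hom C a b; f' \<in> Hom C a b; g \<in> Hom C b c\<rbrakk>
          \<Longrightarrow> g \<cdot> Add C f f' = Add C (g \<cdot> f) (g \<cdot> f')"
    and Comp_Add_left: "\<lbrakk>f \<in> Hom C a b; g \<in> Hom C b c; g' \<in> Hom C b c\<rbrakk>
          \<Longrightarrow> Add C g g' \<cdot> f = Add C (g \<cdot> f) (g' \<cdot> f)"

locale abelian_category = preadditive_category +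
  assumes ex_zero_object: "\<exists>z. is_zero_object C z"
    and ex_biproduct: "\<lbrakk>a \<in> Obj C; b \<in> Obj C\<rbrakk> \<Longrightarrow> \<exists>s i1 i2 p1 p2. is_biproduct C a b s i1 i2 p1 p2"
    and ex_kernel: "f \<in> Arr C \<Longrightarrow> \<exists>k. is_kernel C k f"
    and ex_cokernel: "f \<in> Arr C \<Longrightarrow> \<exists>q. is_cokernel C q f"
    and mono_is_kernel: "is_mono C m \<Longrightarrow> \<exists>f. is_kernel C m f"
    and epi_is_cokernel: "is_epi C e \<Longrightarrow> \<exists>f. is_cokernel C e f"


section \<open>Exactness, injectives, functors\<close>

text \<open>Exactness of \<open>a \<rightarrow> b \<rightarrow> c\<close> at \<open>b\<close>: image and kernel agree as subobjects of \<open>b\<close>.\<close>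

definition exact_at :: "('o, 'm) precategory \<Rightarrow> 'm \<Rightarrow> 'm \<Rightarrow> bool" where
  "exact_at C f g \<longleftrightarrow> (\<exists>i. is_image C i f \<and> is_kernel C i g)"

definition short_exact :: "('o, 'm) precategory \<Rightarrow> 'm \<Rightarrow> 'm \<Rightarrow> bool" where
  "short_exact C f g \<longleftrightarrow> is_mono C f \<and> exact_at C f g \<and> is_epi C g"

definition injective_object :: "('o, 'm) precategory \<Rightarrow> 'o \<Rightarrow> bool" where
  "injective_object C I \<longleftrightarrow> I \<in> Obj C \<and>
     (\<forall>m f. is_mono C m \<and> f \<in> Hom C (Dom C m) I \<longrightarrow>
        (\<exists>g \<in> Hom C (Cod C m) I. g \<cdot>\<^bsub>C\<^esub> m = f))"

definition enough_injectives :: "('o, 'm) precategory \<Rightarrow> bool" where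
  "enough_injectives C \<longleftrightarrow>
     (\<forall>a\<in>Obj C. \<exists>m. is_mono C m \<and> Dom C m = a \<and> injective_object C (Cod C m))"

record ('o, 'm, 'p, 'n) cat_functor =
  FObj :: "'o \<Rightarrow> 'p"
  FArr :: "'m \<Rightarrow> 'n"

definition additive_functor ::
    "('o, 'm) precategory \<Rightarrow> ('p, 'n) precategory \<Rightarrow> ('o, 'm, 'p, 'n) cat_functor \<Rightarrow> bool" where
  "additive_functor A B F \<longleftrightarrow>
     (\<forall>a\<in>Obj A. FObj F a \<in> Obj B \<and> FArr F (Id A a) = Id B (FObj F a)) \<and>
     (\<forall>a b. \<forall>f\<in>Hom A a b. FArr F f \<in> Hom B (FObj F a) (FObj F b)) \<and>
     (\<forall>a b c. \<forall>f\<in>Hom A a b. \<forall>g\<in>Hom A b c. FArr F (g \<cdot>\<^bsub>A\<^esub> f) = FArr F g \<cdot>\<^bsub>B\<^esub> FArr F f) \<and>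
     (\<forall>a b. \<forall>f\<in>Hom A a b. \<forall>g\<in>Hom A a b. FArr F (Add A f g) = Add B (FArr F f) (FArr F g))"

definition left_exact ::
    "('o, 'm) precategory \<Rightarrow> ('p, 'n) precategory \<Rightarrow> ('o, 'm, 'p, 'n) cat_functor \<Rightarrow> bool" where
  "left_exact A B F \<longleftrightarrow>
     (\<forall>f g. short_exact A f g \<longrightarrow> is_mono B (FArr F f) \<and> exact_at B (FArr F f) (FArr F g))"


section \<open>Cochain complexes and cohomology\<close>

text \<open>
  A cochain complex \<open>X\<^sup>0 \<rightarrow> X\<^sup>1 \<rightarrow> \<dots>\<close> is the sequence \<open>X :: nat \<Rightarrow> 'm\<close> of its differentials; its
  object in degree \<open>n\<close> is \<open>Dom C (X n)\<close>.
\<close>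

definition cochain_complex :: "('o, 'm) precategory \<Rightarrow> (nat \<Rightarrow> 'm) \<Rightarrow> bool" where
  "cochain_complex C X \<longleftrightarrow>
     (\<forall>n. X n \<in> Arr C \<and> Cod C (X n) = Dom C (X (Suc n)) \<and>
          X (Suc n) \<cdot>\<^bsub>C\<^esub> X n = Zero C (Dom C (X n)) (Cod C (X (Suc n))))"

definition chain_map :: "('o, 'm) precategory \<Rightarrow> (nat \<Rightarrow> 'm) \<Rightarrow> (nat \<Rightarrow> 'm) \<Rightarrow> (nat \<Rightarrow> 'm) \<Rightarrow> bool" where
  "chain_map C X Y f \<longleftrightarrow>
     (\<forall>n. f n \<in> Hom C (Dom C (X n)) (Dom C (Y n)) \<and> Y n \<cdot>\<^bsub>C\<^esub> f n = f (Suc n) \<cdot>\<^bsub>C\<^esub> X n)"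

text \<open>Factorisation of \<open>g\<close> through a monomorphism \<open>k\<close>.\<close>

definition factor_through :: "('o, 'm) precategory \<Rightarrow> 'm \<Rightarrow> 'm \<Rightarrow> 'm" where
  "factor_through C k g = (THE h. h \<in> Hom C (Dom C g) (Dom C k) \<and> k \<cdot>\<^bsub>C\<^esub> h = g)"

definition ker_arr :: "('o, 'm) precategory \<Rightarrow> 'm \<Rightarrow> 'm" where
  "ker_arr C f = (SOME k. is_kernel C k f)"

definition coker_arr :: "('o, 'm) precategory \<Rightarrow> 'm \<Rightarrow> 'm" where
  "coker_arr C f = (SOME q. is_cokernel C q f)"

definition zero_object :: "('o, 'm) precategory \<Rightarrow> 'o" where
  "zero_object C = (SOME z. is_zero_object C z)"

text \<open>The differential into degree \<open>n\<close>, with the convention \<open>X\<^sup>-\<^sup>1 = 0\<close>.\<close>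

fun incoming :: "('o, 'm) precategory \<Rightarrow> (nat \<Rightarrow> 'm) \<Rightarrow> nat \<Rightarrow> 'm" where
  "incoming C X 0 = Zero C (zero_object C) (Dom C (X 0))"
| "incoming C X (Suc n) = X n"

text \<open>\<open>H\<^sup>n(X)\<close> is the cokernel of \<open>X\<^sup>n\<^sup>-\<^sup>1 \<rightarrow> ker (X\<^sup>n \<rightarrow> X\<^sup>n\<^sup>+\<^sup>1)\<close>.\<close>

definition coh_proj :: "('o, 'm) precategory \<Rightarrow> (nat \<Rightarrow> 'm) \<Rightarrow> nat \<Rightarrow> 'm" where
  "coh_proj C X n = coker_arr C (factor_through C (ker_arr C (X n)) (incoming C X n))"

definition coh :: "('o, 'm) precategory \<Rightarrow> (nat \<Rightarrow> 'm) \<Rightarrow> nat \<Rightarrow> 'o" where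
  "coh C X n = Cod C (coh_proj C X n)"

text \<open>For \<open>z : T \<rightarrow> X\<^sup>n\<close> killed by the differential (a cocycle with values in \<open>T\<close>),
  the induced arrow \<open>[z] : T \<rightarrow> H\<^sup>n(X)\<close>.\<close>

definition coh_class :: "('o, 'm) precategory \<Rightarrow> (nat \<Rightarrow> 'm) \<Rightarrow> nat \<Rightarrow> 'm \<Rightarrow> 'm" where
  "coh_class C X n z = coh_proj C X n \<cdot>\<^bsub>C\<^esub> factor_through C (ker_arr C (X n)) z"

definition coh_map ::
    "('o, 'm) precategory \<Rightarrow> (nat \<Rightarrow> 'm) \<Rightarrow> (nat \<Rightarrow> 'm) \<Rightarrow> (nat \<Rightarrow> 'm) \<Rightarrow> nat \<Rightarrow> 'm" where
  "coh_map C X Y f n =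
     (THE h. h \<in> Hom C (coh C X n) (coh C Y n) \<and>
        h \<cdot>\<^bsub>C\<^esub> coh_proj C X n = coh_class C Y n (f n \<cdot>\<^bsub>C\<^esub> ker_arr C (X n)))"

definition short_exact_complexes ::
    "('o, 'm) precategory \<Rightarrow> (nat \<Rightarrow> 'm) \<Rightarrow> (nat \<Rightarrow> 'm) \<Rightarrow> (nat \<Rightarrow> 'm) \<Rightarrow> (nat \<Rightarrow> 'm) \<Rightarrow> (nat \<Rightarrow> 'm) \<Rightarrow> bool"
  where
  "short_exact_complexes C X Y Z u v \<longleftrightarrow>
     cochain_complex C X \<and> cochain_complex C Y \<and> cochain_complex C Z \<and>
     chain_map C X Y u \<and> chain_map C Y Z v \<and> (\<forall>n. short_exact C (u n) (v n))"

text \<open>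
  The connecting homomorphism \<open>H\<^sup>p(Z) \<rightarrow> H\<^sup>p\<^sup>+\<^sup>1(X)\<close> of \<open>0 \<rightarrow> X \<rightarrow> Y \<rightarrow> Z \<rightarrow> 0\<close>, by the snake-lemma recipe
  on generalised elements: it sends the class of \<open>v y\<close> to the class of \<open>x\<close> whenever \<open>u x = d y\<close>.
  Taking for \<open>y\<close> the projection to \<open>Y\<^sup>p\<close> of the pullback of \<open>v\<^sup>p\<close> along \<open>ker (Z\<^sup>p \<rightarrow> Z\<^sup>p\<^sup>+\<^sup>1) \<rightarrow> Z\<^sup>p\<close>
  shows that this determines it.
\<close>

definition snake ::
    "('o, 'm) precategory \<Rightarrow> (nat \<Rightarrow> 'm) \<Rightarrow> (nat \<Rightarrow> 'm) \<Rightarrow> (nat \<Rightarrow> 'm) \<Rightarrow> (nat \<Rightarrow> 'm) \<Rightarrow> (nat \<Rightarrow> 'm) \<Rightarrow> nat \<Rightarrow> 'm"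
  where
  "snake C X Y Z u v p =
     (THE \<delta>. \<delta> \<in> Hom C (coh C Z p) (coh C X (Suc p)) \<and>
        (\<forall>T. \<forall>y \<in> Hom C T (Dom C (Y p)). \<forall>x \<in> Hom C T (Dom C (X (Suc p))).
           u (Suc p) \<cdot>\<^bsub>C\<^esub> x = Y p \<cdot>\<^bsub>C\<^esub> y \<longrightarrow>
           \<delta> \<cdot>\<^bsub>C\<^esub> coh_class C Z p (v p \<cdot>\<^bsub>C\<^esub> y) = coh_class C X (Suc p) x))"

abbreviation fmap :: "('o, 'm, 'p, 'n) cat_functor \<Rightarrow> (nat \<Rightarrow> 'm) \<Rightarrow> nat \<Rightarrow> 'n" where
  "fmap F X \<equiv> (\<lambda>n. FArr F (X n))"


section \<open>Resolutions and derived functors\<close>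

record 'm augmented =
  aug :: 'm
  diff :: "nat \<Rightarrow> 'm"

definition resolution :: "('o, 'm) precategory \<Rightarrow> 'o \<Rightarrow> 'm augmented \<Rightarrow> bool" where
  "resolution C M R \<longleftrightarrow> cochain_complex C (diff R) \<and>
     aug R \<in> Hom C M (Dom C (diff R 0)) \<and> is_mono C (aug R) \<and>
     exact_at C (aug R) (diff R 0) \<and> (\<forall>n. exact_at C (diff R n) (diff R (Suc n)))"

definition injective_resolution :: "('o, 'm) precategory \<Rightarrow> 'o \<Rightarrow> 'm augmented \<Rightarrow> bool" where
  "injective_resolution C M R \<longleftrightarrow> resolution C M R \<and> (\<forall>n. injective_object C (Dom C (diff R n)))"

text \<open>In the following, \<open>res\<close> is the choice of an injective resolution for each object of the source
  category.\<close>

definition right_derived ::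
    "('p, 'n) precategory \<Rightarrow> ('o, 'm, 'p, 'n) cat_functor \<Rightarrow> ('o \<Rightarrow> 'm augmented) \<Rightarrow> nat \<Rightarrow> 'o \<Rightarrow> 'p" where
  "right_derived B F res i M = coh B (fmap F (diff (res M))) i"

definition acyclic_resolution ::
    "('o, 'm) precategory \<Rightarrow> ('p, 'n) precategory \<Rightarrow> ('o, 'm, 'p, 'n) cat_functor \<Rightarrow>
     ('o \<Rightarrow> 'm augmented) \<Rightarrow> 'o \<Rightarrow> 'm augmented \<Rightarrow> bool" where
  "acyclic_resolution A B F res M J \<longleftrightarrow> resolution A M J \<and>
     (\<forall>i\<ge>1. \<forall>k. is_zero_object B (right_derived B F res i (Dom A (diff J k))))"

text \<open>The identification \<open>F M \<rightarrow> R\<^sup>0F M\<close>, induced by the augmentation.\<close>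

definition derived0_iso ::
    "('p, 'n) precategory \<Rightarrow> ('o, 'm, 'p, 'n) cat_functor \<Rightarrow> ('o \<Rightarrow> 'm augmented) \<Rightarrow> 'o \<Rightarrow> 'n" where
  "derived0_iso B F res M = coh_class B (fmap F (diff (res M))) 0 (FArr F (aug (res M)))"

text \<open>
  \<open>(K, u, v)\<close> is a short exact sequence of injective resolutions compatible with the short exact
  sequence \<open>(a, b)\<close>. The outer two resolutions are the chosen ones, since the connecting homomorphism
  is to run between the cohomology of these; the middle one is any injective resolution.
\<close>

definition resolution_sequence ::
    "('o, 'm) precategory \<Rightarrow> ('o \<Rightarrow> 'm augmented) \<Rightarrow> 'm \<Rightarrow> 'm \<Rightarrow>
     'm augmented \<times> (nat \<Rightarrow> 'm) \<times> (nat \<Rightarrow> 'm) \<Rightarrow> bool" where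
  "resolution_sequence A res a b = (\<lambda>(K, u, v).
     injective_resolution A (Cod A a) K \<and>
     short_exact_complexes A (diff (res (Dom A a))) (diff K) (diff (res (Cod A b))) u v \<and>
     u 0 \<cdot>\<^bsub>A\<^esub> aug (res (Dom A a)) = aug K \<cdot>\<^bsub>A\<^esub> a \<and>
     v 0 \<cdot>\<^bsub>A\<^esub> aug K = aug (res (Cod A b)) \<cdot>\<^bsub>A\<^esub> b)"

text \<open>The connecting homomorphism \<open>R\<^sup>pF (Cod b) \<rightarrow> R\<^sup>p\<^sup>+\<^sup>1F (Dom a)\<close> of the short exact sequence
  \<open>(a, b)\<close>; it does not depend on which sequence of resolutions is taken.\<close>

definition connecting ::
    "('o, 'm) precategory \<Rightarrow> ('p, 'n) precategory \<Rightarrow> ('o, 'm, 'p, 'n) cat_functor \<Rightarrow>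
     ('o \<Rightarrow> 'm augmented) \<Rightarrow> 'm \<Rightarrow> 'm \<Rightarrow> nat \<Rightarrow> 'n" where
  "connecting A B F res a b p =
     (case (SOME S. resolution_sequence A res a b S) of (K, u, v) \<Rightarrow>
        snake B (fmap F (diff (res (Dom A a)))) (fmap F (diff K)) (fmap F (diff (res (Cod A b))))
          (fmap F u) (fmap F v) p)"


section \<open>The two comparison isomorphisms\<close>

definition canonical_iso ::
    "('o, 'm) precategory \<Rightarrow> ('p, 'n) precategory \<Rightarrow> ('o, 'm, 'p, 'n) cat_functor \<Rightarrow>
     ('o \<Rightarrow> 'm augmented) \<Rightarrow> 'o \<Rightarrow> 'm augmented \<Rightarrow> nat \<Rightarrow> 'n" where
  "canonical_iso A B F res M J n =
     (let f = (SOME f. chain_map A (diff J) (diff (res M)) f \<and> f 0 \<cdot>\<^bsub>A\<^esub> aug J = aug (res M))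
      in coh_map B (fmap F (diff J)) (fmap F (diff (res M))) (fmap F f) n)"

text \<open>The arrow \<open>Z\<^sup>q \<rightarrow> J\<^sup>q\<close>: the augmentation for \<open>q = 0\<close>, the inclusion of the kernel otherwise.\<close>

fun syzygy_inc :: "('o, 'm) precategory \<Rightarrow> 'm augmented \<Rightarrow> nat \<Rightarrow> 'm" where
  "syzygy_inc A J 0 = aug J"
| "syzygy_inc A J (Suc q) = ker_arr A (diff J (Suc q))"

definition syzygy :: "('o, 'm) precategory \<Rightarrow> 'm augmented \<Rightarrow> nat \<Rightarrow> 'o" where
  "syzygy A J q = Dom A (syzygy_inc A J q)"

text \<open>The arrow \<open>J\<^sup>q\<^sup>-\<^sup>1 \<rightarrow> Z\<^sup>q\<close> induced by the differential, for \<open>q \<ge> 1\<close>.\<close>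

definition syzygy_proj :: "('o, 'm) precategory \<Rightarrow> 'm augmented \<Rightarrow> nat \<Rightarrow> 'm" where
  "syzygy_proj A J q = factor_through A (syzygy_inc A J q) (diff J (q - 1))"

text \<open>The connecting homomorphism \<open>R\<^sup>pF Z\<^sup>q \<rightarrow> R\<^sup>p\<^sup>+\<^sup>1F Z\<^sup>q\<^sup>-\<^sup>1\<close> of
  \<open>0 \<rightarrow> Z\<^sup>q\<^sup>-\<^sup>1 \<rightarrow> J\<^sup>q\<^sup>-\<^sup>1 \<rightarrow> Z\<^sup>q \<rightarrow> 0\<close>, for \<open>q \<ge> 1\<close>.\<close>

definition syzygy_connecting ::
    "('o, 'm) precategory \<Rightarrow> ('p, 'n) precategory \<Rightarrow> ('o, 'm, 'p, 'n) cat_functor \<Rightarrow>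
     ('o \<Rightarrow> 'm augmented) \<Rightarrow> 'm augmented \<Rightarrow> nat \<Rightarrow> nat \<Rightarrow> 'n" where
  "syzygy_connecting A B F res J q p =
     connecting A B F res (syzygy_inc A J (q - 1)) (syzygy_proj A J q) p"

text \<open>
  The arrow \<open>H\<^sup>n(FJ) \<rightarrow> R\<^sup>1F Z\<^sup>n\<^sup>-\<^sup>1\<close> through which \<open>FZ\<^sup>n = R\<^sup>0F Z\<^sup>n \<rightarrow> R\<^sup>1F Z\<^sup>n\<^sup>-\<^sup>1\<close> factors. The quotient
  arrow \<open>FZ\<^sup>n \<rightarrow> FZ\<^sup>n / im FJ\<^sup>n\<^sup>-\<^sup>1 = H\<^sup>n(FJ)\<close> is the class of the cocycle \<open>FZ\<^sup>n \<rightarrow> FJ\<^sup>n\<close>.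
\<close>

definition connecting0_bar ::
    "('o, 'm) precategory \<Rightarrow> ('p, 'n) precategory \<Rightarrow> ('o, 'm, 'p, 'n) cat_functor \<Rightarrow>
     ('o \<Rightarrow> 'm augmented) \<Rightarrow> 'm augmented \<Rightarrow> nat \<Rightarrow> 'n" where
  "connecting0_bar A B F res J n =
     (THE \<beta>. \<beta> \<in> Hom B (coh B (fmap F (diff J)) n) (right_derived B F res 1 (syzygy A J (n - 1))) \<and>
        \<beta> \<cdot>\<^bsub>B\<^esub> coh_class B (fmap F (diff J)) n (FArr F (syzygy_inc A J n)) =
        syzygy_connecting A B F res J n 0 \<cdot>\<^bsub>B\<^esub> derived0_iso B F res (syzygy A J n))"

text \<open>\<open>shift_partial A B F res J n k\<close> is the composite of the first \<open>k + 1\<close> arrows,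
  \<open>H\<^sup>n(FJ) \<rightarrow> R\<^sup>k\<^sup>+\<^sup>1F Z\<^sup>n\<^sup>-\<^sup>k\<^sup>-\<^sup>1\<close>, for \<open>k < n\<close>.\<close>

fun shift_partial ::
    "('o, 'm) precategory \<Rightarrow> ('p, 'n) precategory \<Rightarrow> ('o, 'm, 'p, 'n) cat_functor \<Rightarrow>
     ('o \<Rightarrow> 'm augmented) \<Rightarrow> 'm augmented \<Rightarrow> nat \<Rightarrow> nat \<Rightarrow> 'n" where
  "shift_partial A B F res J n 0 = connecting0_bar A B F res J n"
| "shift_partial A B F res J n (Suc k) =
     syzygy_connecting A B F res J (n - Suc k) (Suc k) \<cdot>\<^bsub>B\<^esub> shift_partial A B F res J n k"

definition dimension_shift_iso ::
    "('o, 'm) precategory \<Rightarrow> ('p, 'n) precategory \<Rightarrow> ('o, 'm, 'p, 'n) cat_functor \<Rightarrow>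
     ('o \<Rightarrow> 'm augmented) \<Rightarrow> 'm augmented \<Rightarrow> nat \<Rightarrow> 'n" where
  "dimension_shift_iso A B F res J n = shift_partial A B F res J n (n - 1)"

end

theory Submission
  imports Defs
begin

text \<open>
  Let \<open>0 \<rightarrow> X \<rightarrow> K \<rightarrow> Z \<rightarrow> 0\<close> be injective resolutions of a short exact sequence. It splits in each degree;
  with retractions \<open>r\<close> and sections \<open>s\<close>, the arrows \<open>\<tau> = r d s : Z\<^sup>p \<rightarrow> X\<^sup>p\<^sup>+\<^sup>1\<close> satisfy \<open>\<tau> d = - d \<tau>\<close>, and
  \<open>F \<tau>\<close> induces the connecting homomorphism.

  For \<open>0 \<rightarrow> Z\<^sup>q \<rightarrow> J\<^sup>q \<rightarrow> Z\<^sup>q\<^sup>+\<^sup>1 \<rightarrow> 0\<close> regard the truncations of \<open>J\<close> as resolutions of \<open>Z\<^sup>q\<close> and \<open>Z\<^sup>q\<^sup>+\<^sup>1\<close>.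
  If \<open>g\<close> compares the second truncation with \<open>Z\<close>, then \<open>f\<^sup>0 = r \<circ> aug K\<close> and
  \<open>f\<^sup>p\<^sup>+\<^sup>1 = (-1)\<^sup>p\<^sup>+\<^sup>1 \<tau> g\<^sup>p\<close> compare the first one with \<open>X\<close>: the sign makes the anticommuting \<open>\<tau>\<close> into a
  chain map. As comparison maps are unique up to homotopy, \<open>\<partial>\<^sup>p\<close> carries the canonical map in degree \<open>p\<close> to
  \<open>(-1)\<^sup>p\<^sup>+\<^sup>1\<close> times the canonical map in degree \<open>p + 1\<close>. The composite for \<open>p = 0, \<dots>, n - 1\<close> has
  sign exponent \<open>1 + \<dots> + n\<close>.
\<close>

section \<open>Arithmetic of arrows\<close>

text \<open>\<open>F\<close> need not preserve short exact sequences, so a sequence of resolutions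
  is carried to \<open>B\<close> through its splittings: biproduct equations survive every additive
  functor. Elements are replaced by arrows \<open>z\<close> from an arbitrary object into the object
  of degree \<open>n\<close> that are killed by the differential; arrows out of cohomology are
  compared on the classes of such \<open>z\<close>.

  The first arrow of the composite starts at \<open>H^n(FJ)\<close>, a quotient of
  \<open>F Z^n\<close>, and not at \<open>R^0F Z^n\<close>. The formula for a connecting step is
  therefore stated for cocycles of \<open>FJ\<close>, which can be read in every truncation; so it
  covers \<open>p = 0\<close> together with the higher degrees.

  The first sign comes from \<open>0 = r d (aug K) = d r (aug K) + \<tau> v (aug K)\<close>: it
  forces \<open>r (aug K)\<close> to be continued by \<open>- \<tau> g^0\<close>. Each further
  degree costs one more sign, so the sign of a step depends on \<open>p\<close> alone and not on the
  syzygy.\<close>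

definition Neg :: "('o, 'm) precategory \<Rightarrow> 'm \<Rightarrow> 'm" where
  "Neg C f = inv\<^bsub>hom_group C (Dom C f) (Cod C f)\<^esub> f"

lemma Hom_iff: "f \<in> Hom C a b \<longleftrightarrow> f \<in> Arr C \<and> Dom C f = a \<and> Cod C f = b"
  by (simp add: Hom_def)

context preadditive_category
begin

abbreviation add (infixl \<open>\<oplus>\<close> 65) where "f \<oplus> g \<equiv> Add C f g"

declare Dom_in_Obj [simp] Cod_in_Obj [simp]

lemma Arr_Comp [simp]: "\<lbrakk>f \<in> Arr C; g \<in> Arr C; Cod C f = Dom C g\<rbrakk> \<Longrightarrow> g \<cdot> f \<in> Arr C"
  and Dom_Comp [simp]: "\<lbrakk>f \<in> Arr C; g \<in> Arr C; Cod C f = Dom C g\<rbrakk> \<Longrightarrow> Dom C (g \<cdot> f) = Dom C f"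
  and Cod_Comp [simp]: "\<lbrakk>f \<in> Arr C; g \<in> Arr C; Cod C f = Dom C g\<rbrakk> \<Longrightarrow> Cod C (g \<cdot> f) = Cod C g"
  using Comp_in_Hom[of f "Dom C f" "Cod C f" g "Cod C g"] by (auto simp: Hom_iff)

lemma Arr_Id [simp]: "a \<in> Obj C \<Longrightarrow> Id C a \<in> Arr C"
  and Dom_Id [simp]: "a \<in> Obj C \<Longrightarrow> Dom C (Id C a) = a"
  and Cod_Id [simp]: "a \<in> Obj C \<Longrightarrow> Cod C (Id C a) = a"
  using Id_in_Hom by (auto simp: Hom_iff)

lemma Comp_assoc' [simp]:
  "\<lbrakk>f \<in> Arr C; g \<in> Arr C; h \<in> Arr C; Cod C f = Dom C g; Cod C g = Dom C h\<rbrakk>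
    \<Longrightarrow> (h \<cdot> g) \<cdot> f = h \<cdot> (g \<cdot> f)"
  using Comp_assoc by (simp add: Hom_iff)

text \<open>Composites are normalised by associating to the right, which hides a known product
  \<open>g \<cdot> f\<close> inside \<open>g \<cdot> (f \<cdot> x)\<close>; this rule makes its
  equation usable there.\<close>

lemma Comp_extend:
  "\<lbrakk>g \<cdot> f = k; f \<in> Arr C; g \<in> Arr C; Cod C f = Dom C g; x \<in> Arr C; Cod C x = Dom C f\<rbrakk>
    \<Longrightarrow> g \<cdot> (f \<cdot> x) = k \<cdot> x"
  by (metis Comp_assoc')

lemma Comp_Id [simp]:
  "\<lbrakk>f \<in> Arr C; Dom C f = a\<rbrakk> \<Longrightarrow> f \<cdot> Id C a = f"
  "\<lbrakk>f \<in> Arr C; Cod C f = b\<rbrakk> \<Longrightarrow> Id C b \<cdot> f = f"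
  using Comp_Id_right Comp_Id_left by (auto simp: Hom_iff)

lemma Arr_Zero [simp]: "\<lbrakk>a \<in> Obj C; b \<in> Obj C\<rbrakk> \<Longrightarrow> Zero C a b \<in> Arr C"
  and Dom_Zero [simp]: "\<lbrakk>a \<in> Obj C; b \<in> Obj C\<rbrakk> \<Longrightarrow> Dom C (Zero C a b) = a"
  and Cod_Zero [simp]: "\<lbrakk>a \<in> Obj C; b \<in> Obj C\<rbrakk> \<Longrightarrow> Cod C (Zero C a b) = b"
  using monoid.one_closed[OF group.is_monoid[OF comm_group.axioms(2)[OF comm_group_Hom]], of a b]
  by (auto simp: hom_group_def Hom_iff)

lemma Arr_Add [simp]:
    "\<lbrakk>f \<in> Arr C; g \<in> Arr C; Dom C f = Dom C g; Cod C f = Cod C g\<rbrakk> \<Longrightarrow> f \<oplus> g \<in> Arr C"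
  and Dom_Add [simp]:
    "\<lbrakk>f \<in> Arr C; g \<in> Arr C; Dom C f = Dom C g; Cod C f = Cod C g\<rbrakk> \<Longrightarrow> Dom C (f \<oplus> g) = Dom C g"
  and Cod_Add [simp]:
    "\<lbrakk>f \<in> Arr C; g \<in> Arr C; Dom C f = Dom C g; Cod C f = Cod C g\<rbrakk> \<Longrightarrow> Cod C (f \<oplus> g) = Cod C g"
  using monoid.m_closed[OF group.is_monoid[OF comm_group.axioms(2)[OF comm_group_Hom]],
      of "Dom C g" "Cod C g" f g]
  by (auto simp: hom_group_def Hom_iff)

lemma Arr_Neg [simp]: "f \<in> Arr C \<Longrightarrow> Neg C f \<in> Arr C"
  and Dom_Neg [simp]: "f \<in> Arr C \<Longrightarrow> Dom C (Neg C f) = Dom C f"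
  and Cod_Neg [simp]: "f \<in> Arr C \<Longrightarrow> Cod C (Neg C f) = Cod C f"
  using group.inv_closed[OF comm_group.axioms(2)[OF comm_group_Hom], of "Dom C f" "Cod C f" f]
  by (auto simp: hom_group_def Hom_iff Neg_def)

lemma Add_assoc:
  "\<lbrakk>f \<in> Arr C; g \<in> Arr C; h \<in> Arr C; Dom C f = Dom C g; Cod C f = Cod C g;
    Dom C g = Dom C h; Cod C g = Cod C h\<rbrakk> \<Longrightarrow> (f \<oplus> g) \<oplus> h = f \<oplus> (g \<oplus> h)"
  using monoid.m_assoc[OF group.is_monoid[OF comm_group.axioms(2)[OF comm_group_Hom]],
      of "Dom C h" "Cod C h" f g h]
  by (auto simp: hom_group_def Hom_iff)

lemma Add_commute:
  "\<lbrakk>f \<in> Arr C; g \<in> Arr C; Dom C f = Dom C g; Cod C f = Cod C g\<rbrakk> \<Longrightarrow> f \<oplus> g = g \<oplus> f"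
  using comm_monoid.m_comm[OF comm_group.axioms(1)[OF comm_group_Hom],
      of "Dom C g" "Cod C g" f g]
  by (auto simp: hom_group_def Hom_iff)

lemma Add_left_commute:
  "\<lbrakk>f \<in> Arr C; g \<in> Arr C; h \<in> Arr C; Dom C f = Dom C g; Cod C f = Cod C g;
    Dom C g = Dom C h; Cod C g = Cod C h\<rbrakk> \<Longrightarrow> f \<oplus> (g \<oplus> h) = g \<oplus> (f \<oplus> h)"
  by (metis Add_assoc Add_commute)

lemmas Add_ac = Add_assoc Add_commute Add_left_commute

lemma Add_Zero [simp]:
  "\<lbrakk>f \<in> Arr C; Dom C f = a; Cod C f = b\<rbrakk> \<Longrightarrow> f \<oplus> Zero C a b = f"
  "\<lbrakk>f \<in> Arr C; Dom C f = a; Cod C f = b\<rbrakk> \<Longrightarrow> Zero C a b \<oplus> f = f"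
  using monoid.r_one[OF group.is_monoid[OF comm_group.axioms(2)[OF comm_group_Hom]], of a b f]
    monoid.l_one[OF group.is_monoid[OF comm_group.axioms(2)[OF comm_group_Hom]], of a b f]
  by (auto simp: hom_group_def Hom_iff)

lemma Add_Neg [simp]:
  "f \<in> Arr C \<Longrightarrow> f \<oplus> Neg C f = Zero C (Dom C f) (Cod C f)"
  "f \<in> Arr C \<Longrightarrow> Neg C f \<oplus> f = Zero C (Dom C f) (Cod C f)"
  using group.r_inv[OF comm_group.axioms(2)[OF comm_group_Hom], of "Dom C f" "Cod C f" f]
    group.l_inv[OF comm_group.axioms(2)[OF comm_group_Hom], of "Dom C f" "Cod C f" f]
  by (auto simp: hom_group_def Hom_iff Neg_def)

lemma Add_Neg_cancel [simp]:
  "\<lbrakk>f \<in> Arr C; g \<in> Arr C; Dom C f = Dom C g; Cod C f = Cod C g\<rbrakk> \<Longrightarrow> f \<oplus> (Neg C f \<oplus> g) = g"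
  "\<lbrakk>f \<in> Arr C; g \<in> Arr C; Dom C f = Dom C g; Cod C f = Cod C g\<rbrakk> \<Longrightarrow> Neg C f \<oplus> (f \<oplus> g) = g"
  by (simp_all add: Add_assoc[symmetric])

text \<open>Sorting by \<open>Add_ac\<close> can separate an arrow from its negative, out of reach
  of the adjacent cancellation rules. Such sums arise in the horseshoe construction.\<close>

lemma Add_Neg_cancel_far:
  assumes "f \<in> Arr C" "g \<in> Arr C" "h \<in> Arr C" "Dom C f = Dom C g" "Cod C f = Cod C g"
    "Dom C g = Dom C h" "Cod C g = Cod C h"
  shows "f \<oplus> (g \<oplus> (h \<oplus> Neg C f)) = g \<oplus> h"
proof -
  have "f \<oplus> (g \<oplus> (h \<oplus> Neg C f)) = f \<oplus> (Neg C f \<oplus> (g \<oplus> h))"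
    using assms by (simp only: Add_ac Arr_Neg Dom_Neg Cod_Neg Arr_Add Dom_Add Cod_Add)
  then show ?thesis using assms by simp
qed

lemma Neg_unique:
  assumes "f \<in> Arr C" "g \<in> Arr C" "f \<oplus> g = Zero C (Dom C f) (Cod C f)"
    and "Dom C f = Dom C g" "Cod C f = Cod C g"
  shows "g = Neg C f"
proof -
  have "Neg C f \<oplus> (f \<oplus> g) = g"
    using assms by (intro Add_Neg_cancel) auto
  then show ?thesis using assms by simp
qed

lemma Add_Neg_eq_Zero:
  assumes "f \<in> Arr C" "g \<in> Arr C" "Dom C f = Dom C g" "Cod C f = Cod C g"
    and "f \<oplus> Neg C g = Zero C (Dom C g) (Cod C g)"
  shows "f = g"
proof -
  have "f = (f \<oplus> Neg C g) \<oplus> g" using assms(1-4) by (simp add: Add_assoc)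
  then show ?thesis using assms by simp
qed

text \<open>Additivity sends a zero arrow to an idempotent of a group; this is how composition and
  \<open>F\<close> are seen to preserve zero arrows.\<close>

lemma Add_idem_Zero:
  assumes "f \<in> Arr C" "f \<oplus> f = f"
  shows "f = Zero C (Dom C f) (Cod C f)"
proof -
  have "Neg C f \<oplus> (f \<oplus> f) = f" using assms(1) by (intro Add_Neg_cancel) auto
  then show ?thesis using assms by simp
qed

lemma Neg_Neg [simp]: "f \<in> Arr C \<Longrightarrow> Neg C (Neg C f) = f"
  by (rule Neg_unique[symmetric]) auto

lemma Neg_Zero [simp]: "\<lbrakk>a \<in> Obj C; b \<in> Obj C\<rbrakk> \<Longrightarrow> Neg C (Zero C a b) = Zero C a b"
  by (rule Neg_unique[symmetric]) auto

lemma Comp_distrib [simp]: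
  "\<lbrakk>f \<in> Arr C; f' \<in> Arr C; g \<in> Arr C; Dom C f = Dom C f'; Cod C f = Cod C f'; Cod C f' = Dom C g\<rbrakk>
    \<Longrightarrow> g \<cdot> (f \<oplus> f') = g \<cdot> f \<oplus> g \<cdot> f'"
  "\<lbrakk>f \<in> Arr C; g \<in> Arr C; g' \<in> Arr C; Dom C g = Dom C g'; Cod C g = Cod C g'; Cod C f = Dom C g'\<rbrakk>
    \<Longrightarrow> (g \<oplus> g') \<cdot> f = g \<cdot> f \<oplus> g' \<cdot> f"
  using Comp_Add_right Comp_Add_left by (simp_all add: Hom_iff)

lemma Comp_Zero [simp]:
  assumes "f \<in> Arr C" "a \<in> Obj C"
  shows "Dom C f = b \<Longrightarrow> f \<cdot> Zero C a b = Zero C a (Cod C f)"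
    and "Cod C f = b \<Longrightarrow> Zero C b a \<cdot> f = Zero C (Dom C f) a"
proof -
  assume b: "Dom C f = b"
  have "f \<cdot> (Zero C a b \<oplus> Zero C a b) = f \<cdot> Zero C a b \<oplus> f \<cdot> Zero C a b"
    using assms b by (intro Comp_distrib) auto
  with assms b show "f \<cdot> Zero C a b = Zero C a (Cod C f)"
    using Add_idem_Zero[of "f \<cdot> Zero C a b"] by auto
next
  assume b: "Cod C f = b"
  have "(Zero C b a \<oplus> Zero C b a) \<cdot> f = Zero C b a \<cdot> f \<oplus> Zero C b a \<cdot> f"
    using assms b by (intro Comp_distrib) auto
  with assms b show "Zero C b a \<cdot> f = Zero C (Dom C f) a"
    using Add_idem_Zero[of "Zero C b a \<cdot> f"] by auto
qed

lemma Comp_Neg [simp]: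
  assumes "f \<in> Arr C" "g \<in> Arr C" "Cod C f = Dom C g"
  shows "g \<cdot> Neg C f = Neg C (g \<cdot> f)" "Neg C g \<cdot> f = Neg C (g \<cdot> f)"
proof -
  have "g \<cdot> f \<oplus> g \<cdot> Neg C f = g \<cdot> (f \<oplus> Neg C f)" using assms by (intro Comp_distrib[symmetric]) auto
  then show "g \<cdot> Neg C f = Neg C (g \<cdot> f)" using assms by (intro Neg_unique) auto
  have "g \<cdot> f \<oplus> Neg C g \<cdot> f = (g \<oplus> Neg C g) \<cdot> f" using assms by (intro Comp_distrib[symmetric]) auto
  then show "Neg C g \<cdot> f = Neg C (g \<cdot> f)" using assms by (intro Neg_unique) auto
qed

lemma Neg_Add [simp]:
  assumes "f \<in> Arr C" "g \<in> Arr C" "Dom C f = Dom C g" "Cod C f = Cod C g"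
  shows "Neg C (f \<oplus> g) = Neg C f \<oplus> Neg C g"
proof -
  have "(f \<oplus> g) \<oplus> (Neg C f \<oplus> Neg C g) = f \<oplus> (Neg C f \<oplus> (g \<oplus> Neg C g))"
    using assms by (simp only: Add_ac Arr_Neg Dom_Neg Cod_Neg Arr_Add Dom_Add Cod_Add)
  then show ?thesis using assms by (intro Neg_unique[symmetric]) auto
qed

end

section \<open>Kernels, cokernels and exactness\<close>

context preadditive_category
begin

lemma mono_Arr: "is_mono C m \<Longrightarrow> m \<in> Arr C"
  and epi_Arr: "is_epi C e \<Longrightarrow> e \<in> Arr C"
  by (simp_all add: is_mono_def is_epi_def)

lemma mono_cancel:
  "\<lbrakk>is_mono C m; m \<cdot> f = m \<cdot> g; f \<in> Arr C; g \<in> Arr C; Dom C f = Dom C g; Cod C f = Dom C m;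
    Cod C g = Dom C m\<rbrakk> \<Longrightarrow> f = g"
  by (auto simp: is_mono_def)

lemma epi_cancel:
  "\<lbrakk>is_epi C e; f \<cdot> e = g \<cdot> e; f \<in> Arr C; g \<in> Arr C; Cod C f = Cod C g; Dom C f = Cod C e;
    Dom C g = Cod C e\<rbrakk> \<Longrightarrow> f = g"
  by (auto simp: is_epi_def)

lemma mono_cancel_Zero:
  assumes "is_mono C m" "m \<cdot> f = Zero C (Dom C f) (Cod C m)" "f \<in> Arr C" "Cod C f = Dom C m"
  shows "f = Zero C (Dom C f) (Dom C m)"
  by (rule mono_cancel[OF assms(1)]) (use assms mono_Arr[OF assms(1)] in auto)

lemma epi_cancel_Zero:
  assumes "is_epi C e" "f \<cdot> e = Zero C (Dom C e) (Cod C f)" "f \<in> Arr C" "Dom C f = Cod C e"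
  shows "f = Zero C (Cod C e) (Cod C f)"
  by (rule epi_cancel[OF assms(1)]) (use assms epi_Arr[OF assms(1)] in auto)

text \<open>Subtracting the two arrows reduces cancellation to the case where one of them is
  zero.\<close>

lemma is_monoI:
  assumes m: "m \<in> Arr C"
    and "\<And>f. \<lbrakk>f \<in> Arr C; Cod C f = Dom C m; m \<cdot> f = Zero C (Dom C f) (Cod C m)\<rbrakk>
          \<Longrightarrow> f = Zero C (Dom C f) (Dom C m)"
  shows "is_mono C m"
  unfolding is_mono_def
proof (intro conjI ballI impI m, elim conjE)
  fix f g
  assume fg: "f \<in> Arr C" "g \<in> Arr C" "Dom C f = Dom C g" "Cod C f = Dom C m" "Cod C g = Dom C m"
    "m \<cdot> f = m \<cdot> g"
  then have "f \<oplus> Neg C g = Zero C (Dom C g) (Cod C g)"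
    using m assms(2)[of "f \<oplus> Neg C g"] by simp
  with fg show "f = g" by - (rule Add_Neg_eq_Zero, auto)
qed

lemma is_epiI:
  assumes e: "e \<in> Arr C"
    and "\<And>f. \<lbrakk>f \<in> Arr C; Dom C f = Cod C e; f \<cdot> e = Zero C (Dom C e) (Cod C f)\<rbrakk>
          \<Longrightarrow> f = Zero C (Cod C e) (Cod C f)"
  shows "is_epi C e"
  unfolding is_epi_def
proof (intro conjI ballI impI e, elim conjE)
  fix f g
  assume fg: "f \<in> Arr C" "g \<in> Arr C" "Cod C f = Cod C g" "Dom C f = Cod C e" "Dom C g = Cod C e"
    "f \<cdot> e = g \<cdot> e"
  then have "f \<oplus> Neg C g = Zero C (Dom C g) (Cod C g)"
    using e assms(2)[of "f \<oplus> Neg C g"] by simp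
  with fg show "f = g" by - (rule Add_Neg_eq_Zero, auto)
qed

lemma split_mono: "\<lbrakk>m \<in> Arr C; r \<in> Arr C; Dom C r = Cod C m; r \<cdot> m = Id C (Dom C m)\<rbrakk> \<Longrightarrow> is_mono C m"
  unfolding is_mono_def by (metis Comp_assoc' Comp_Id(2))

lemma split_epi: "\<lbrakk>e \<in> Arr C; s \<in> Arr C; Cod C s = Dom C e; e \<cdot> s = Id C (Cod C e)\<rbrakk> \<Longrightarrow> is_epi C e"
  unfolding is_epi_def by (metis Comp_assoc' Comp_Id(1))

lemma mono_of_comp_mono:
  assumes "is_mono C (m \<cdot> f)" "m \<in> Arr C" "f \<in> Arr C" "Cod C f = Dom C m"
  shows "is_mono C f"
proof (rule is_monoI[OF assms(3)])
  fix x assume "x \<in> Arr C" "Cod C x = Dom C f" "f \<cdot> x = Zero C (Dom C x) (Cod C f)"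
  with assms(2-) show "x = Zero C (Dom C x) (Dom C f)"
    using mono_cancel_Zero[OF assms(1), of x] by simp
qed

lemma kernel_simps:
  "is_kernel C k f \<Longrightarrow> f \<in> Arr C" "is_kernel C k f \<Longrightarrow> k \<in> Arr C"
  "is_kernel C k f \<Longrightarrow> Cod C k = Dom C f" "is_kernel C k f \<Longrightarrow> f \<cdot> k = Zero C (Dom C k) (Cod C f)"
  by (auto simp: is_kernel_def)

lemma cokernel_simps:
  "is_cokernel C q f \<Longrightarrow> f \<in> Arr C" "is_cokernel C q f \<Longrightarrow> q \<in> Arr C"
  "is_cokernel C q f \<Longrightarrow> Dom C q = Cod C f" "is_cokernel C q f \<Longrightarrow> q \<cdot> f = Zero C (Dom C f) (Cod C q)"
  by (auto simp: is_cokernel_def)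

lemma kernel_factor:
  assumes "is_kernel C k f" "h \<in> Arr C" "Cod C h = Dom C f" "f \<cdot> h = Zero C (Dom C h) (Cod C f)"
  obtains g where "g \<in> Arr C" "Dom C g = Dom C h" "Cod C g = Dom C k" "k \<cdot> g = h"
  using assms unfolding is_kernel_def Hom_iff by blast

lemma cokernel_factor:
  assumes "is_cokernel C q f" "h \<in> Arr C" "Dom C h = Cod C f" "h \<cdot> f = Zero C (Dom C f) (Cod C h)"
  obtains g where "g \<in> Arr C" "Dom C g = Cod C q" "Cod C g = Cod C h" "g \<cdot> q = h"
  using assms unfolding is_cokernel_def Hom_iff by blast

lemma kernel_mono:
  assumes k: "is_kernel C k f"
  shows "is_mono C k"
proof (rule is_monoI)
  note [simp] = kernel_simps[OF k]
  fix x assume x [simp]: "x \<in> Arr C" "Cod C x = Dom C k" and "k \<cdot> x = Zero C (Dom C x) (Cod C k)"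
  \<comment> \<open>Uniqueness of the factorisation is applied to the zero arrow, which both
    \<open>x\<close> and zero lift.\<close>
  moreover have "\<exists>!g. g \<in> Hom C (Dom C x) (Dom C k) \<and> k \<cdot> g = Zero C (Dom C x) (Dom C f)"
    using k unfolding is_kernel_def
    by (elim conjE ballE[of _ _ "Zero C (Dom C x) (Dom C f)"]) simp_all
  ultimately show "x = Zero C (Dom C x) (Dom C k)"
    by (elim ex1E) (metis Hom_iff x kernel_simps[OF k] Arr_Zero Dom_Zero Cod_Zero Comp_Zero(1)
        Dom_in_Obj Cod_in_Obj)
qed (rule kernel_simps[OF k])

lemma cokernel_epi:
  assumes q: "is_cokernel C q f"
  shows "is_epi C q"
proof (rule is_epiI)
  note [simp] = cokernel_simps[OF q]
  fix x assume x [simp]: "x \<in> Arr C" "Dom C x = Cod C q" and "x \<cdot> q = Zero C (Dom C q) (Cod C x)"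
  moreover have "\<exists>!g. g \<in> Hom C (Cod C q) (Cod C x) \<and> g \<cdot> q = Zero C (Cod C f) (Cod C x)"
    using q unfolding is_cokernel_def
    by (elim conjE ballE[of _ _ "Zero C (Cod C f) (Cod C x)"]) simp_all
  ultimately show "x = Zero C (Cod C q) (Cod C x)"
    by (elim ex1E) (metis Hom_iff x cokernel_simps[OF q] Arr_Zero Dom_Zero Cod_Zero Comp_Zero(2)
        Dom_in_Obj Cod_in_Obj)
qed (rule cokernel_simps[OF q])

lemma is_kernelI:
  assumes "f \<in> Arr C" "Cod C k = Dom C f" "is_mono C k" "f \<cdot> k = Zero C (Dom C k) (Cod C f)"
    and "\<And>h. \<lbrakk>h \<in> Arr C; Cod C h = Dom C f; f \<cdot> h = Zero C (Dom C h) (Cod C f)\<rbrakk>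
      \<Longrightarrow> \<exists>g. g \<in> Hom C (Dom C h) (Dom C k) \<and> k \<cdot> g = h"
  shows "is_kernel C k f"
  unfolding is_kernel_def
proof (intro conjI ballI impI ex_ex1I; (elim conjE)?)
  fix h g g' assume "g \<in> Hom C (Dom C h) (Dom C k)" "g' \<in> Hom C (Dom C h) (Dom C k)" "k \<cdot> g = h" "k \<cdot> g' = h"
  then show "g = g'" using mono_cancel[OF assms(3), of g g'] by (auto simp: Hom_iff)
qed (use assms mono_Arr in auto)

lemma is_cokernelI:
  assumes "f \<in> Arr C" "Dom C q = Cod C f" "is_epi C q" "q \<cdot> f = Zero C (Dom C f) (Cod C q)"
    and "\<And>h. \<lbrakk>h \<in> Arr C; Dom C h = Cod C f; h \<cdot> f = Zero C (Dom C f) (Cod C h)\<rbrakk>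
      \<Longrightarrow> \<exists>g. g \<in> Hom C (Cod C q) (Cod C h) \<and> g \<cdot> q = h"
  shows "is_cokernel C q f"
  unfolding is_cokernel_def
proof (intro conjI ballI impI ex_ex1I; (elim conjE)?)
  fix h g g' assume "g \<in> Hom C (Cod C q) (Cod C h)" "g' \<in> Hom C (Cod C q) (Cod C h)" "g \<cdot> q = h" "g' \<cdot> q = h"
  then show "g = g'" using epi_cancel[OF assms(3), of g g'] by (auto simp: Hom_iff)
qed (use assms epi_Arr in auto)

text \<open>A kernel of \<open>f\<close> depends only on which arrows \<open>f\<close> kills.
  Composing with a monomorphism does not change these.\<close>

lemma kernel_cong:
  assumes k: "is_kernel C k f" and g: "g \<in> Arr C" "Dom C g = Dom C f"
    and iff: "\<And>h. \<lbrakk>h \<in> Arr C; Cod C h = Dom C f\<rbrakk> \<Longrightarrow>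
      f \<cdot> h = Zero C (Dom C h) (Cod C f) \<longleftrightarrow> g \<cdot> h = Zero C (Dom C h) (Cod C g)"
  shows "is_kernel C k g"
proof (rule is_kernelI)
  note [simp] = kernel_simps[OF k]
  show "g \<cdot> k = Zero C (Dom C k) (Cod C g)" using iff[of k] by simp
  fix h assume h: "h \<in> Arr C" "Cod C h = Dom C g" "g \<cdot> h = Zero C (Dom C h) (Cod C g)"
  then show "\<exists>g. g \<in> Hom C (Dom C h) (Dom C k) \<and> k \<cdot> g = h"
    using kernel_factor[OF k, of h] g iff[of h] by (metis Hom_iff)
qed (use g kernel_simps[OF k] kernel_mono[OF k] in auto)

lemma kernel_comp_mono:
  assumes k: "is_kernel C k f" and m: "is_mono C m" "Dom C m = Cod C f"
  shows "is_kernel C k (m \<cdot> f)"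
  using mono_cancel_Zero[OF m(1)] m mono_Arr[OF m(1)] kernel_simps[OF k]
  by (intro kernel_cong[OF k]) (auto, metis Arr_Comp Cod_Comp Dom_Comp)

lemma kernel_of_comp_mono:
  assumes k: "is_kernel C k (m \<cdot> f)" and m: "is_mono C m" "Dom C m = Cod C f" "f \<in> Arr C"
  shows "is_kernel C k f"
  using mono_cancel_Zero[OF m(1)] m mono_Arr[OF m(1)] kernel_simps[OF k]
  by (intro kernel_cong[OF k]) (auto, metis Arr_Comp Cod_Comp Dom_Comp)

text \<open>\<open>f\<close> factors through the cokernel \<open>q\<close> of \<open>k\<close>, so
  whatever \<open>q\<close> kills is killed by \<open>f\<close> and lifts to
  \<open>k\<close>.\<close>

lemma kernel_of_cokernel:
  assumes k: "is_kernel C k f" and q: "is_cokernel C q k"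
  shows "is_kernel C k q"
proof (rule is_kernelI)
  note [simp] = kernel_simps[OF k] cokernel_simps[OF q]
  fix h assume h: "h \<in> Arr C" "Cod C h = Dom C q" "q \<cdot> h = Zero C (Dom C h) (Cod C q)"
  obtain y where y: "y \<in> Arr C" "Dom C y = Cod C q" "Cod C y = Cod C f" "y \<cdot> q = f"
    by (rule cokernel_factor[OF q, of f]) auto
  then have "f \<cdot> h = Zero C (Dom C h) (Cod C f)" using h Comp_extend[OF y(4), of h] by simp
  then show "\<exists>g. g \<in> Hom C (Dom C h) (Dom C k) \<and> k \<cdot> g = h"
    using kernel_factor[OF k, of h] h by (metis Hom_iff cokernel_simps(3)[OF q] kernel_simps(3)[OF k])
qed (use kernel_simps[OF k] kernel_mono[OF k] cokernel_simps[OF q] in auto)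

lemma cokernel_of_kernel:
  assumes q: "is_cokernel C q f" and k: "is_kernel C k q"
  shows "is_cokernel C q k"
proof (rule is_cokernelI)
  note [simp] = kernel_simps[OF k] cokernel_simps[OF q]
  fix h assume h: "h \<in> Arr C" "Dom C h = Cod C k" "h \<cdot> k = Zero C (Dom C k) (Cod C h)"
  obtain y where y: "y \<in> Arr C" "Dom C y = Dom C f" "Cod C y = Dom C k" "k \<cdot> y = f"
    by (rule kernel_factor[OF k, of f]) auto
  then have "h \<cdot> f = Zero C (Dom C f) (Cod C h)" using Comp_extend[OF h(3), of y] h by simp
  then show "\<exists>g. g \<in> Hom C (Cod C q) (Cod C h) \<and> g \<cdot> q = h"
    using cokernel_factor[OF q, of h] h by (metis Hom_iff cokernel_simps(3)[OF q] kernel_simps(3)[OF k])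
qed (use kernel_simps[OF k] cokernel_epi[OF q] cokernel_simps[OF q] in auto)

lemma short_exactI:
  "\<lbrakk>is_kernel C f g; is_cokernel C g f\<rbrakk> \<Longrightarrow> short_exact C f g"
  unfolding short_exact_def exact_at_def is_image_def using kernel_mono cokernel_epi by blast

lemma exact_at_Arr:
  assumes "exact_at C f g"
  shows "f \<in> Arr C" "g \<in> Arr C" "Cod C f = Dom C g"
  using assms kernel_simps cokernel_simps unfolding exact_at_def is_image_def by metis+

end

section \<open>Exactness through kernels and cokernels in an abelian category\<close>

context abelian_category
begin

lemma kernel_ker_arr: "f \<in> Arr C \<Longrightarrow> is_kernel C (ker_arr C f) f"
  unfolding ker_arr_def by (rule someI_ex) (rule ex_kernel)

lemma cokernel_coker_arr: "f \<in> Arr C \<Longrightarrow> is_cokernel C (coker_arr C f) f"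
  unfolding coker_arr_def by (rule someI_ex) (rule ex_cokernel)

lemma mono_kernel_of_cokernel: "\<lbrakk>is_mono C m; is_cokernel C q m\<rbrakk> \<Longrightarrow> is_kernel C m q"
  using mono_is_kernel kernel_of_cokernel by blast

lemma epi_cokernel_of_kernel: "\<lbrakk>is_epi C e; is_kernel C k e\<rbrakk> \<Longrightarrow> is_cokernel C e k"
  using epi_is_cokernel cokernel_of_kernel by blast

lemma exact_at_if_kernel:
  assumes "is_kernel C f g"
  shows "exact_at C f g"
proof -
  have "is_cokernel C (coker_arr C f) f" by (rule cokernel_coker_arr) (rule kernel_simps[OF assms])
  then show ?thesis
    unfolding exact_at_def is_image_def using kernel_of_cokernel[OF assms] assms by blast
qed

text \<open>A monomorphism is the kernel of its cokernel \<open>q\<close>, and the image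
  \<open>i\<close> is a kernel of both \<open>q\<close> and \<open>g\<close>; hence \<open>q\<close>
  and \<open>g\<close> kill the same arrows.\<close>

lemma kernel_if_exact_mono:
  assumes e: "exact_at C f g" and m: "is_mono C f"
  shows "is_kernel C f g"
proof -
  obtain i q where i: "is_kernel C i g" and q: "is_cokernel C q f" and iq: "is_kernel C i q"
    using e unfolding exact_at_def is_image_def by blast
  note [simp] = kernel_simps[OF i] kernel_simps(4)[OF iq] cokernel_simps[OF q] exact_at_Arr[OF e]
  have f: "is_kernel C f q" by (rule mono_kernel_of_cokernel[OF m q])
  obtain x where x [simp]: "x \<in> Arr C" "Dom C x = Dom C f" "Cod C x = Dom C i" and fx: "i \<cdot> x = f"
    by (rule kernel_factor[OF iq, of f]) auto
  show ?thesis
  proof (rule is_kernelI[OF _ _ m])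
    show "g \<cdot> f = Zero C (Dom C f) (Cod C g)"
      using Comp_extend[OF kernel_simps(4)[OF i], of x] by (simp add: fx)
    fix h assume h [simp]: "h \<in> Arr C" "Cod C h = Dom C g" "g \<cdot> h = Zero C (Dom C h) (Cod C g)"
    obtain y where y [simp]: "y \<in> Arr C" "Dom C y = Dom C h" "Cod C y = Dom C i" and hy: "i \<cdot> y = h"
      by (rule kernel_factor[OF i, of h]) auto
    have "q \<cdot> h = Zero C (Dom C h) (Cod C q)"
      using Comp_extend[OF kernel_simps(4)[OF iq], of y] by (simp add: hy)
    then show "\<exists>w. w \<in> Hom C (Dom C h) (Dom C f) \<and> f \<cdot> w = h"
      using kernel_factor[OF f, of h] by (metis Hom_iff h(1,2) exact_at_Arr(3)[OF e] cokernel_simps(3)[OF q])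
  qed auto
qed

lemma short_exact_kernel: "short_exact C f g \<Longrightarrow> is_kernel C f g"
  by (simp add: short_exact_def kernel_if_exact_mono)

lemma short_exact_cokernel: "short_exact C f g \<Longrightarrow> is_cokernel C g f"
  by (rule epi_cokernel_of_kernel[OF _ short_exact_kernel]) (simp_all add: short_exact_def)

text \<open>The coimage of \<open>g\<close> embeds into its codomain; for \<open>exact_at C f g\<close> the coimage is the cokernel
  of \<open>f\<close>.\<close>

lemma exact_at_factor:
  assumes e: "exact_at C f g"
  obtains q m where "is_cokernel C q f" "is_mono C m" "Dom C m = Cod C q" "m \<cdot> q = g"
proof -
  obtain i q where i: "is_kernel C i g" and q: "is_cokernel C q f" and iq: "is_kernel C i q"
    using e unfolding exact_at_def is_image_def by blast
  note [simp] = kernel_simps[OF i] kernel_simps(4)[OF iq] cokernel_simps[OF q] exact_at_Arr[OF e]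
  have qi: "is_cokernel C q i" by (rule cokernel_of_kernel[OF q iq])
  obtain m where m [simp]: "m \<in> Arr C" "Dom C m = Cod C q" "Cod C m = Cod C g" and mq: "m \<cdot> q = g"
    by (rule cokernel_factor[OF qi, of g]) auto
  have "is_mono C m"
  proof (rule is_monoI[OF m(1)])
    fix x assume x [simp]: "x \<in> Arr C" "Cod C x = Dom C m" "m \<cdot> x = Zero C (Dom C x) (Cod C m)"
    define c where "c = coker_arr C x"
    have c: "is_cokernel C c x" unfolding c_def by (rule cokernel_coker_arr) simp
    note [simp] = cokernel_simps[OF c]
    obtain m' where m' [simp]: "m' \<in> Arr C" "Dom C m' = Cod C c" "Cod C m' = Cod C m" and mc: "m' \<cdot> c = m"
      by (rule cokernel_factor[OF c, of m]) auto
    \<comment> \<open>Being epi, \<open>c \<cdot> q\<close> is the cokernel of some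
      \<open>y\<close>. As \<open>g\<close> factors through it, \<open>g\<close> kills
      \<open>y\<close>; so \<open>y\<close> lifts to \<open>i\<close>, and \<open>q\<close> kills
      \<open>y\<close>. Thus \<open>q\<close> factors through \<open>c \<cdot> q\<close>, which
      gives \<open>c\<close> a left inverse, and \<open>c \<cdot> x = 0\<close> forces
      \<open>x = 0\<close>.\<close>
    have "is_epi C (c \<cdot> q)"
    proof (rule is_epiI)
      fix f assume [simp]: "f \<in> Arr C" "Dom C f = Cod C (c \<cdot> q)"
        and f: "f \<cdot> (c \<cdot> q) = Zero C (Dom C (c \<cdot> q)) (Cod C f)"
      then have "f \<cdot> c = Zero C (Cod C q) (Cod C f)"
        using epi_cancel_Zero[OF cokernel_epi[OF q], of "f \<cdot> c"] by simp
      then show "f = Zero C (Cod C (c \<cdot> q)) (Cod C f)"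
        using epi_cancel_Zero[OF cokernel_epi[OF c], of f] by simp
    qed simp
    then obtain y where y: "is_cokernel C (c \<cdot> q) y" using epi_is_cokernel by blast
    note [simp] = cokernel_simps(1)[OF y]
    have [simp]: "Cod C y = Dom C g" using cokernel_simps(3)[OF y] by simp
    have "g \<cdot> y = Zero C (Dom C y) (Cod C g)"
      using Comp_extend[OF mq, of y] Comp_extend[OF mc, of "q \<cdot> y"] cokernel_simps(4)[OF y] by simp
    then obtain y' where [simp]: "y' \<in> Arr C" "Dom C y' = Dom C y" "Cod C y' = Dom C i" and y': "i \<cdot> y' = y"
      by (rule kernel_factor[OF i, rotated 2]) auto
    have "q \<cdot> y = Zero C (Dom C y) (Cod C q)"
      using Comp_extend[OF kernel_simps(4)[OF iq], of y'] by (simp add: y')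
    then obtain w where [simp]: "w \<in> Arr C" "Dom C w = Cod C c" "Cod C w = Cod C q"
      and w: "w \<cdot> (c \<cdot> q) = q"
      by (rule cokernel_factor[OF y, rotated 2]) auto
    have "(w \<cdot> c) \<cdot> q = Id C (Cod C q) \<cdot> q" using w by simp
    then have wc: "w \<cdot> c = Id C (Cod C q)" by (rule epi_cancel[OF cokernel_epi[OF q]]) auto
    have "x = (w \<cdot> c) \<cdot> x" by (simp add: wc)
    also have "\<dots> = w \<cdot> (c \<cdot> x)" by simp
    also have "\<dots> = Zero C (Dom C x) (Dom C m)" by simp
    finally show "x = Zero C (Dom C x) (Dom C m)" .
  qed
  with q m mq show thesis using that by blast
qed

lemma exact_at_Comp_Zero:
  assumes "exact_at C f g"
  shows "g \<cdot> f = Zero C (Dom C f) (Cod C g)"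
proof -
  obtain q m where q: "is_cokernel C q f" and m: "is_mono C m" "Dom C m = Cod C q" "m \<cdot> q = g"
    using assms by (rule exact_at_factor)
  then show ?thesis
    using Comp_extend[OF m(3), of f] cokernel_simps[OF q] mono_Arr[OF m(1)] by auto
qed

text \<open>Dual to the argument for the coimage. Let \<open>x \<cdot> h = 0\<close> and let
  \<open>l\<close> be a kernel of \<open>x\<close>. Then \<open>k \<cdot> l\<close> is mono, hence
  the kernel of some \<open>y\<close>. This \<open>y\<close> kills \<open>f\<close>, therefore also
  \<open>k\<close>, and lifting \<open>k\<close> along \<open>k \<cdot> l\<close> gives
  \<open>l\<close> a right inverse, so \<open>x = 0\<close>.\<close>

lemma exact_at_factor_epi:
  assumes e: "exact_at C f g" and k: "is_kernel C k g" and h: "h \<in> Arr C" "Cod C h = Dom C k" "k \<cdot> h = f"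
  shows "is_epi C h"
proof (rule is_epiI[OF h(1)])
  obtain i q where i: "is_kernel C i g" and q: "is_cokernel C q f" and iq: "is_kernel C i q"
    using e unfolding exact_at_def is_image_def by blast
  note [simp] = kernel_simps[OF k] kernel_simps[OF i] kernel_simps(4)[OF iq] cokernel_simps[OF q]
    exact_at_Arr[OF e] h(1,2)
  have [simp]: "Dom C h = Dom C f" by (simp flip: h(3))
  obtain j where j [simp]: "j \<in> Arr C" "Dom C j = Dom C k" "Cod C j = Dom C i" and jk: "i \<cdot> j = k"
    by (rule kernel_factor[OF i, of k]) auto
  fix x assume [simp]: "x \<in> Arr C" "Dom C x = Cod C h" "x \<cdot> h = Zero C (Dom C h) (Cod C x)"
  define l where "l = ker_arr C x"
  have l: "is_kernel C l x" unfolding l_def by (rule kernel_ker_arr) simp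
  note [simp] = kernel_simps[OF l]
  obtain h' where [simp]: "h' \<in> Arr C" "Dom C h' = Dom C h" "Cod C h' = Dom C l" and h': "l \<cdot> h' = h"
    by (rule kernel_factor[OF l, of h]) auto
  have "is_mono C (k \<cdot> l)"
  proof (rule is_monoI)
    fix f assume [simp]: "f \<in> Arr C" "Cod C f = Dom C (k \<cdot> l)"
      and f: "k \<cdot> l \<cdot> f = Zero C (Dom C f) (Cod C (k \<cdot> l))"
    then have "l \<cdot> f = Zero C (Dom C f) (Dom C k)"
      using mono_cancel_Zero[OF kernel_mono[OF k], of "l \<cdot> f"] by simp
    then show "f = Zero C (Dom C f) (Dom C (k \<cdot> l))"
      using mono_cancel_Zero[OF kernel_mono[OF l], of f] by simp
  qed simp
  then obtain y where y: "is_kernel C (k \<cdot> l) y" using mono_is_kernel by blast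
  note [simp] = kernel_simps(1)[OF y]
  have [simp]: "Dom C y = Dom C g" using kernel_simps(3)[OF y] by simp
  have yf: "y \<cdot> f = Zero C (Dom C f) (Cod C y)"
    using Comp_extend[OF kernel_simps(4)[OF y], of h'] by (simp add: h' h(3))
  obtain y' where [simp]: "y' \<in> Arr C" "Dom C y' = Cod C q" "Cod C y' = Cod C y" and y': "y' \<cdot> q = y"
    by (rule cokernel_factor[OF q, of y]) (use yf in auto)
  have "y \<cdot> k = Zero C (Dom C k) (Cod C y)"
    using Comp_extend[OF y', of k] Comp_extend[OF kernel_simps(4)[OF iq], of j] by (simp add: jk)
  then obtain w where [simp]: "w \<in> Arr C" "Dom C w = Dom C k" "Cod C w = Dom C l"
    and w: "(k \<cdot> l) \<cdot> w = k"
    by (rule kernel_factor[OF y, rotated 2]) auto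
  have "k \<cdot> (l \<cdot> w) = k \<cdot> Id C (Dom C k)" using w by simp
  then have lw: "l \<cdot> w = Id C (Dom C k)" by (rule mono_cancel[OF kernel_mono[OF k]]) auto
  show "x = Zero C (Cod C h) (Cod C x)"
    using Comp_extend[OF kernel_simps(4)[OF l], of w] by (simp add: lw)
qed

end

section \<open>Injective objects and resolutions\<close>

text \<open>Unlike \<open>incoming\<close>, which is a zero arrow in degree 0, this has the
  augmentation there, so exactness of a resolution becomes one family over all degrees.\<close>

definition aug_incoming :: "'m augmented \<Rightarrow> nat \<Rightarrow> 'm" where
  "aug_incoming R n = (case n of 0 \<Rightarrow> aug R | Suc m \<Rightarrow> diff R m)"

definition comparison ::
    "('o, 'm) precategory \<Rightarrow> 'm augmented \<Rightarrow> 'm augmented \<Rightarrow> (nat \<Rightarrow> 'm) \<Rightarrow> bool" where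
  "comparison C R S f \<longleftrightarrow> chain_map C (diff R) (diff S) f \<and> f 0 \<cdot>\<^bsub>C\<^esub> aug R = aug S"

context preadditive_category
begin

lemma cochain_complex_simps:
  assumes "cochain_complex C X"
  shows "X n \<in> Arr C" "Cod C (X n) = Dom C (X (Suc n))"
    "X (Suc n) \<cdot> X n = Zero C (Dom C (X n)) (Dom C (X (Suc (Suc n))))"
    "\<lbrakk>x \<in> Arr C; Cod C x = Dom C (X n)\<rbrakk>
      \<Longrightarrow> X (Suc n) \<cdot> (X n \<cdot> x) = Zero C (Dom C x) (Dom C (X (Suc (Suc n))))"
proof -
  show 1: "X n \<in> Arr C" "Cod C (X n) = Dom C (X (Suc n))" for n
    using assms by (auto simp: cochain_complex_def)
  show 2: "X (Suc n) \<cdot> X n = Zero C (Dom C (X n)) (Dom C (X (Suc (Suc n))))"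
    using assms by (auto simp: cochain_complex_def)
  assume "x \<in> Arr C" "Cod C x = Dom C (X n)"
  then show "X (Suc n) \<cdot> (X n \<cdot> x) = Zero C (Dom C x) (Dom C (X (Suc (Suc n))))"
    using Comp_extend[OF 2, of x] 1 by simp
qed

lemma chain_map_simps:
  assumes "chain_map C X Y f"
  shows "f n \<in> Arr C" "Dom C (f n) = Dom C (X n)" "Cod C (f n) = Dom C (Y n)"
    "f (Suc n) \<cdot> X n = Y n \<cdot> f n"
  using assms by (auto simp: chain_map_def Hom_iff)

lemma injective_extend_mono:
  assumes "injective_object C I" "is_mono C m" "f \<in> Arr C" "Dom C f = Dom C m" "Cod C f = I"
  obtains g where "g \<in> Arr C" "Dom C g = Cod C m" "Cod C g = I" "g \<cdot> m = f"
  using assms unfolding injective_object_def Hom_def by blast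

lemma injective_biproduct:
  assumes s: "is_biproduct C a b s i1 i2 p1 p2" and a: "injective_object C a" and b: "injective_object C b"
  shows "injective_object C s"
  unfolding injective_object_def
proof (intro conjI allI impI; (elim conjE)?)
  note [simp] = s[unfolded is_biproduct_def Hom_iff]
  show "s \<in> Obj C" by simp
  fix m f assume m: "is_mono C m" and "f \<in> Hom C (Dom C m) s"
  then have [simp]: "f \<in> Arr C" "Dom C f = Dom C m" "Cod C f = s" by (auto simp: Hom_iff)
  note [simp] = mono_Arr[OF m]
  obtain g1 where g1: "g1 \<in> Arr C" "Dom C g1 = Cod C m" "Cod C g1 = a" "g1 \<cdot> m = p1 \<cdot> f"
    by (rule injective_extend_mono[OF a m, of "p1 \<cdot> f"]) auto
  obtain g2 where g2: "g2 \<in> Arr C" "Dom C g2 = Cod C m" "Cod C g2 = b" "g2 \<cdot> m = p2 \<cdot> f"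
    by (rule injective_extend_mono[OF b m, of "p2 \<cdot> f"]) auto
  have "(i1 \<cdot> p1 \<oplus> i2 \<cdot> p2) \<cdot> f = i1 \<cdot> p1 \<cdot> f \<oplus> i2 \<cdot> p2 \<cdot> f"
    by (rule Comp_distrib) simp_all
  then show "\<exists>g\<in>Hom C (Cod C m) s. g \<cdot> m = f"
    using g1 g2 by (intro bexI[of _ "i1 \<cdot> g1 \<oplus> i2 \<cdot> g2"]) (simp_all add: Hom_iff)
qed

lemma biproduct_short_exact:
  assumes s: "is_biproduct C a b s i1 i2 p1 p2"
  shows "short_exact C i1 p2"
proof (rule short_exactI)
  note [simp] = s[unfolded is_biproduct_def Hom_iff]
  have [simp]: "a \<in> Obj C" "b \<in> Obj C"
    using Dom_in_Obj[of i1] Dom_in_Obj[of i2] by simp_all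
  show "is_kernel C i1 p2"
  proof (rule is_kernelI)
    fix h assume [simp]: "h \<in> Arr C" "Cod C h = Dom C p2" and h: "p2 \<cdot> h = Zero C (Dom C h) (Cod C p2)"
    have "h = (i1 \<cdot> p1 \<oplus> i2 \<cdot> p2) \<cdot> h" by simp
    also have "\<dots> = i1 \<cdot> p1 \<cdot> h \<oplus> i2 \<cdot> (p2 \<cdot> h)" by (subst Comp_distrib) simp_all
    finally have "i1 \<cdot> (p1 \<cdot> h) = h" using h by simp
    then show "\<exists>g. g \<in> Hom C (Dom C h) (Dom C i1) \<and> i1 \<cdot> g = h"
      by (intro exI[of _ "p1 \<cdot> h"]) (simp add: Hom_iff)
  qed (simp_all add: split_mono[of _ p1])
  show "is_cokernel C p2 i1"
  proof (rule is_cokernelI)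
    fix h assume [simp]: "h \<in> Arr C" "Dom C h = Cod C i1" and h: "h \<cdot> i1 = Zero C (Dom C i1) (Cod C h)"
    have "h = h \<cdot> (i1 \<cdot> p1 \<oplus> i2 \<cdot> p2)" by simp
    also have "\<dots> = h \<cdot> i1 \<cdot> p1 \<oplus> h \<cdot> (i2 \<cdot> p2)" by (subst Comp_distrib) simp_all
    finally have "(h \<cdot> i2) \<cdot> p2 = h" using Comp_extend[OF h, of p1] by simp
    then show "\<exists>g. g \<in> Hom C (Cod C p2) (Cod C h) \<and> g \<cdot> p2 = h"
      by (intro exI[of _ "h \<cdot> i2"]) (simp add: Hom_iff)
  qed (simp_all add: split_epi[of _ i2])
qed

end

section \<open>Extension into injectives, exactness tests, comparison maps\<close>

context abelian_category
begin

text \<open>An arrow that kills \<open>f\<close> descends to the cokernel of \<open>f\<close>, which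
  by exactness embeds into the codomain of \<open>g\<close>; from there injectivity extends
  it.\<close>

lemma injective_extend:
  assumes e: "exact_at C f g" and I: "injective_object C I"
    and h: "h \<in> Arr C" "Dom C h = Dom C g" "Cod C h = I" "h \<cdot> f = Zero C (Dom C f) I"
  obtains h' where "h' \<in> Arr C" "Dom C h' = Cod C g" "Cod C h' = I" "h' \<cdot> g = h"
proof -
  obtain q m where q: "is_cokernel C q f" and m: "is_mono C m" "Dom C m = Cod C q" "m \<cdot> q = g"
    using e by (rule exact_at_factor)
  note [simp] = cokernel_simps[OF q] mono_Arr[OF m(1)] m(2) exact_at_Arr[OF e] h
  have [simp]: "Cod C m = Cod C g" by (simp flip: m(3))
  obtain k where k: "k \<in> Arr C" "Dom C k = Cod C q" "Cod C k = Cod C h" "k \<cdot> q = h"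
    by (rule cokernel_factor[OF q, of h]) auto
  obtain h' where h': "h' \<in> Arr C" "Dom C h' = Cod C m" "Cod C h' = I" "h' \<cdot> m = k"
    by (rule injective_extend_mono[OF I m(1), of k]) (use k in auto)
  have "h' \<cdot> g = h" using Comp_extend[OF h'(4), of q] k h' m(3) by simp
  then show thesis using h' that[of h'] by simp
qed

text \<open>A monomorphism \<open>j\<close> from the domain of \<open>m\<close> into an injective
  extends along \<open>m\<close>; since \<open>h' \<cdot> m = j\<close> is mono, so is
  \<open>m\<close>.\<close>

lemma is_monoI_injective:
  assumes "enough_injectives C" and m: "m \<in> Arr C"
    and ext: "\<And>h. \<lbrakk>h \<in> Arr C; Dom C h = Dom C m; injective_object C (Cod C h)\<rbrakk>
      \<Longrightarrow> \<exists>h' \<in> Arr C. Dom C h' = Cod C m \<and> h' \<cdot> m = h"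
  shows "is_mono C m"
proof -
  obtain j where j: "is_mono C j" "Dom C j = Dom C m" "injective_object C (Cod C j)"
    using assms(1) m unfolding enough_injectives_def by (metis Dom_in_Obj)
  then obtain h' where "h' \<in> Arr C" "Dom C h' = Cod C m" "h' \<cdot> m = j"
    using ext mono_Arr by metis
  then show ?thesis using j m mono_of_comp_mono[of h' m] by simp
qed

text \<open>\<open>g\<close> factors as \<open>g1 \<cdot> q\<close> through the cokernel
  \<open>q\<close> of \<open>f\<close>. If \<open>j\<close> embeds the codomain of \<open>q\<close>
  into an injective, extending \<open>j \<cdot> q\<close> along \<open>g\<close> gives
  \<open>h' \<cdot> g1 = j\<close>. So \<open>g1\<close> is mono, and \<open>g\<close> has the same
  kernel as \<open>q\<close>.\<close>

lemma exact_atI_injective: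
  assumes "enough_injectives C" and fg [simp]: "f \<in> Arr C" "g \<in> Arr C" "Cod C f = Dom C g"
    and gf: "g \<cdot> f = Zero C (Dom C f) (Cod C g)"
    and ext: "\<And>h. \<lbrakk>h \<in> Arr C; Dom C h = Dom C g; injective_object C (Cod C h);
        h \<cdot> f = Zero C (Dom C f) (Cod C h)\<rbrakk> \<Longrightarrow> \<exists>h' \<in> Arr C. Dom C h' = Cod C g \<and> h' \<cdot> g = h"
  shows "exact_at C f g"
proof -
  define q where "q = coker_arr C f"
  have q: "is_cokernel C q f" unfolding q_def by (rule cokernel_coker_arr) simp
  note [simp] = cokernel_simps[OF q]
  obtain g1 where g1 [simp]: "g1 \<in> Arr C" "Dom C g1 = Cod C q" "Cod C g1 = Cod C g" and g1q: "g1 \<cdot> q = g"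
    by (rule cokernel_factor[OF q, of g]) (use gf in auto)
  obtain j where j: "is_mono C j" "Dom C j = Cod C q" "injective_object C (Cod C j)"
    using assms(1) unfolding enough_injectives_def by (metis Cod_in_Obj cokernel_simps(2)[OF q])
  note [simp] = mono_Arr[OF j(1)] j(2)
  obtain h' where h' [simp]: "h' \<in> Arr C" "Dom C h' = Cod C g" and "h' \<cdot> g = j \<cdot> q"
    using ext[of "j \<cdot> q"] j(3) by auto
  then have "(h' \<cdot> g1) \<cdot> q = j \<cdot> q" by (simp add: g1q)
  then have hg: "h' \<cdot> g1 = j"
  proof (rule epi_cancel[OF cokernel_epi[OF q]])
    have "Cod C (h' \<cdot> g) = Cod C (j \<cdot> q)" using \<open>h' \<cdot> g = j \<cdot> q\<close> by simp
    then show "Cod C (h' \<cdot> g1) = Cod C j" by simp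
  qed auto
  have m: "is_mono C g1" by (rule mono_of_comp_mono[of h']) (simp_all add: hg j(1))
  have "is_kernel C (ker_arr C q) q" by (rule kernel_ker_arr) simp
  moreover from kernel_comp_mono[OF this m] have "is_kernel C (ker_arr C q) g" by (simp add: g1q)
  ultimately show ?thesis unfolding exact_at_def is_image_def using q by blast
qed

lemma resolution_simps:
  assumes "resolution C M R"
  shows "cochain_complex C (diff R)" "aug R \<in> Arr C" "Dom C (aug R) = M"
    "Cod C (aug R) = Dom C (diff R 0)" "is_mono C (aug R)"
    "diff R 0 \<cdot> aug R = Zero C M (Dom C (diff R (Suc 0)))"
    "exact_at C (aug_incoming R n) (diff R n)"
    "\<lbrakk>x \<in> Arr C; Cod C x = M\<rbrakk> \<Longrightarrow> diff R 0 \<cdot> (aug R \<cdot> x) = Zero C (Dom C x) (Dom C (diff R (Suc 0)))"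
proof -
  show 1: "cochain_complex C (diff R)" "aug R \<in> Arr C" "Dom C (aug R) = M"
    "Cod C (aug R) = Dom C (diff R 0)" "is_mono C (aug R)"
    "exact_at C (aug_incoming R n) (diff R n)" for n
    using assms by (auto simp: resolution_def Hom_iff aug_incoming_def split: nat.split)
  show 2: "diff R 0 \<cdot> aug R = Zero C M (Dom C (diff R (Suc 0)))"
    using exact_at_Comp_Zero[OF 1(6)[of 0]] 1 cochain_complex_simps(1,2)[OF 1(1), of 0]
    by (simp add: aug_incoming_def)
  assume "x \<in> Arr C" "Cod C x = M"
  then show "diff R 0 \<cdot> (aug R \<cdot> x) = Zero C (Dom C x) (Dom C (diff R (Suc 0)))"
    using Comp_extend[OF 2, of x] 1 cochain_complex_simps(1,2)[OF 1(1)] Dom_in_Obj[OF 1(2)] by simp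
qed

lemma comparison_exists:
  assumes R: "resolution C M R" and S: "injective_resolution C M S"
  shows "\<exists>f. comparison C R S f"
proof -
  have S': "resolution C M S" and inj: "injective_object C (Dom C (diff S n))" for n
    using S by (auto simp: injective_resolution_def)
  note [simp] = resolution_simps(2-4,6,8)[OF R] resolution_simps(2-4,6,8)[OF S']
    cochain_complex_simps[OF resolution_simps(1)[OF R]] cochain_complex_simps[OF resolution_simps(1)[OF S']]
  have [simp]: "aug_incoming R n \<in> Arr C" "Cod C (aug_incoming R n) = Dom C (diff R n)" for n
    by (auto simp: aug_incoming_def split: nat.split)
  \<comment> \<open>The invariant records that \<open>diff S n \<cdot> f n\<close> vanishes on the
    previous arrow of \<open>R\<close>, which is what lets it extend along \<open>diff R n\<close>.
    The guarded equation keeps the augmentation condition inside the same recursion.\<close>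
  have "\<exists>f. \<forall>n. (f n \<in> Arr C \<and> Dom C (f n) = Dom C (diff R n) \<and> Cod C (f n) = Dom C (diff S n) \<and>
      (n = 0 \<longrightarrow> f n \<cdot> aug R = aug S) \<and>
      diff S n \<cdot> (f n \<cdot> aug_incoming R n) = Zero C (Dom C (aug_incoming R n)) (Dom C (diff S (Suc n)))) \<and>
      f (Suc n) \<cdot> diff R n = diff S n \<cdot> f n"
  proof (rule dependent_nat_choice)
    obtain f0 where "f0 \<in> Arr C" "Dom C f0 = Dom C (diff R 0)" "Cod C f0 = Dom C (diff S 0)" "f0 \<cdot> aug R = aug S"
      by (rule injective_extend_mono[OF inj resolution_simps(5)[OF R], of "aug S" 0]) auto
    then show "\<exists>f. f \<in> Arr C \<and> Dom C f = Dom C (diff R 0) \<and> Cod C f = Dom C (diff S 0) \<and>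
        ((0::nat) = 0 \<longrightarrow> f \<cdot> aug R = aug S) \<and>
        diff S 0 \<cdot> (f \<cdot> aug_incoming R 0) = Zero C (Dom C (aug_incoming R 0)) (Dom C (diff S (Suc 0)))"
      by (auto simp: aug_incoming_def intro!: exI[of _ f0])
  next
    fix f n
    assume *: "f \<in> Arr C \<and> Dom C f = Dom C (diff R n) \<and> Cod C f = Dom C (diff S n) \<and>
        (n = 0 \<longrightarrow> f \<cdot> aug R = aug S) \<and>
        diff S n \<cdot> (f \<cdot> aug_incoming R n) = Zero C (Dom C (aug_incoming R n)) (Dom C (diff S (Suc n)))"
    obtain f' where f': "f' \<in> Arr C" "Dom C f' = Cod C (diff R n)" "Cod C f' = Dom C (diff S (Suc n))"
      "f' \<cdot> diff R n = diff S n \<cdot> f"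
      by (rule injective_extend[OF resolution_simps(7)[OF R, of n] inj[of "Suc n"], of "diff S n \<cdot> f"])
        (use * in auto)
    moreover have "diff S (Suc n) \<cdot> (f' \<cdot> diff R n) = Zero C (Dom C (diff R n)) (Dom C (diff S (Suc (Suc n))))"
      using f' * by simp
    ultimately show "\<exists>y. (y \<in> Arr C \<and> Dom C y = Dom C (diff R (Suc n)) \<and> Cod C y = Dom C (diff S (Suc n)) \<and>
        (Suc n = 0 \<longrightarrow> y \<cdot> aug R = aug S) \<and>
        diff S (Suc n) \<cdot> (y \<cdot> aug_incoming R (Suc n)) =
          Zero C (Dom C (aug_incoming R (Suc n))) (Dom C (diff S (Suc (Suc n))))) \<and>
        y \<cdot> diff R n = diff S n \<cdot> f"
      by (intro exI[of _ f']) (simp add: aug_incoming_def)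
  qed
  then show ?thesis
    unfolding comparison_def chain_map_def Hom_iff by (elim exE) (intro exI, auto)
qed

text \<open>The homotopy is recorded in the degrees \<open>Suc n\<close>: classes are compared in
  these degrees, and both terms of the homotopy are present there.\<close>

lemma comparison_homotopy:
  assumes R: "resolution C M R" and S: "injective_resolution C M S"
    and f: "comparison C R S f" and g: "comparison C R S g"
  obtains h where
    "\<And>n. h n \<in> Arr C" "\<And>n. Dom C (h n) = Dom C (diff R (Suc n))" "\<And>n. Cod C (h n) = Dom C (diff S n)"
    "\<And>n. f (Suc n) = g (Suc n) \<oplus> (diff S n \<cdot> h n \<oplus> h (Suc n) \<cdot> diff R (Suc n))"
proof -
  have S': "resolution C M S" and inj: "injective_object C (Dom C (diff S n))" for n
    using S by (auto simp: injective_resolution_def)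
  have fg: "chain_map C (diff R) (diff S) f" "f 0 \<cdot> aug R = aug S"
    "chain_map C (diff R) (diff S) g" "g 0 \<cdot> aug R = aug S"
    using f g by (auto simp: comparison_def)
  note [simp] = resolution_simps(2-4,6,8)[OF R] resolution_simps(2-4,6,8)[OF S']
    cochain_complex_simps[OF resolution_simps(1)[OF R]] cochain_complex_simps[OF resolution_simps(1)[OF S']]
    chain_map_simps[OF fg(1)] chain_map_simps[OF fg(3)] fg(2,4)
  define e where "e n = f n \<oplus> Neg C (g n)" for n
  have [simp]: "e n \<in> Arr C" "Dom C (e n) = Dom C (diff R n)" "Cod C (e n) = Dom C (diff S n)"
    "e (Suc n) \<cdot> diff R n = diff S n \<cdot> e n" for n
    by (simp_all add: e_def)
  have e0: "e 0 \<cdot> aug R = Zero C M (Dom C (diff S 0))" by (simp add: e_def)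
  \<comment> \<open>The component \<open>h n\<close> goes from degree \<open>n + 1\<close> to degree
    \<open>n\<close>. By the invariant, the part of \<open>e (Suc n)\<close> left over after
    subtracting \<open>diff S n \<cdot> h n\<close> vanishes on the previous differential, so it
    extends to the next component.\<close>
  have "\<exists>h. \<forall>n. (h n \<in> Arr C \<and> Dom C (h n) = Dom C (diff R (Suc n)) \<and> Cod C (h n) = Dom C (diff S n) \<and>
      (e (Suc n) \<oplus> Neg C (diff S n \<cdot> h n)) \<cdot> diff R n = Zero C (Dom C (diff R n)) (Dom C (diff S (Suc n)))) \<and>
      e (Suc n) \<oplus> Neg C (diff S n \<cdot> h n) = h (Suc n) \<cdot> diff R (Suc n)"
  proof (rule dependent_nat_choice)
    obtain h where "h \<in> Arr C" "Dom C h = Cod C (diff R 0)" "Cod C h = Dom C (diff S 0)" "h \<cdot> diff R 0 = e 0"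
      by (rule injective_extend[OF resolution_simps(7)[OF R, of 0] inj[of 0], of "e 0"])
        (use e0 in \<open>auto simp: aug_incoming_def\<close>)
    then show "\<exists>h. h \<in> Arr C \<and> Dom C h = Dom C (diff R (Suc 0)) \<and> Cod C h = Dom C (diff S 0) \<and>
      (e (Suc 0) \<oplus> Neg C (diff S 0 \<cdot> h)) \<cdot> diff R 0 = Zero C (Dom C (diff R 0)) (Dom C (diff S (Suc 0)))"
      by (intro exI[of _ h]) simp
  next
    fix h n
    assume *: "h \<in> Arr C \<and> Dom C h = Dom C (diff R (Suc n)) \<and> Cod C h = Dom C (diff S n) \<and>
      (e (Suc n) \<oplus> Neg C (diff S n \<cdot> h)) \<cdot> diff R n = Zero C (Dom C (diff R n)) (Dom C (diff S (Suc n)))"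
    obtain h' where h': "h' \<in> Arr C" "Dom C h' = Cod C (diff R (Suc n))" "Cod C h' = Dom C (diff S (Suc n))"
      "h' \<cdot> diff R (Suc n) = e (Suc n) \<oplus> Neg C (diff S n \<cdot> h)"
      by (rule injective_extend[OF resolution_simps(7)[OF R, of "Suc n"] inj[of "Suc n"],
            of "e (Suc n) \<oplus> Neg C (diff S n \<cdot> h)"])
        (use * in \<open>auto simp: aug_incoming_def\<close>)
    then show "\<exists>y. (y \<in> Arr C \<and> Dom C y = Dom C (diff R (Suc (Suc n))) \<and> Cod C y = Dom C (diff S (Suc n)) \<and>
        (e (Suc (Suc n)) \<oplus> Neg C (diff S (Suc n) \<cdot> y)) \<cdot> diff R (Suc n) =
          Zero C (Dom C (diff R (Suc n))) (Dom C (diff S (Suc (Suc n))))) \<and>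
        e (Suc n) \<oplus> Neg C (diff S n \<cdot> h) = y \<cdot> diff R (Suc n)"
      using * by (intro exI[of _ h']) simp
  qed
  then obtain h where h [simp]: "h n \<in> Arr C" "Dom C (h n) = Dom C (diff R (Suc n))" "Cod C (h n) = Dom C (diff S n)"
    and eh: "e (Suc n) \<oplus> Neg C (diff S n \<cdot> h n) = h (Suc n) \<cdot> diff R (Suc n)" for n
    by blast
  have "f (Suc n) = g (Suc n) \<oplus> (diff S n \<cdot> h n \<oplus> h (Suc n) \<cdot> diff R (Suc n))" for n
    unfolding eh[symmetric] e_def by (simp add: Add_ac)
  then show thesis using that h by blast
qed

end

section \<open>The horseshoe lemma\<close>

context abelian_category
begin

text \<open>The middle resolution is \<open>X\<^sup>n \<oplus> Z\<^sup>n\<close> with differential \<open>(x, z) \<mapsto> (d x + \<theta> z, d z)\<close>, which squares to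
  zero if \<open>\<theta> d = - d \<theta>\<close>; it is augmented by \<open>c \<mapsto> (\<epsilon> c, aug (b c))\<close> with \<open>\<epsilon>\<close> extending the
  augmentation of \<open>X\<close> along \<open>a\<close>. Exactness is tested by arrows into injective objects.\<close>

lemma horseshoe_twist:
  assumes ab: "short_exact C a b"
    and X: "injective_resolution C (Dom C a) X" and Z: "injective_resolution C (Cod C b) Z"
  obtains \<epsilon> \<theta> where "\<epsilon> \<in> Arr C" "Dom C \<epsilon> = Cod C a" "Cod C \<epsilon> = Dom C (diff X 0)" "\<epsilon> \<cdot> a = aug X"
    "\<And>n. \<theta> n \<in> Arr C" "\<And>n. Dom C (\<theta> n) = Dom C (diff Z n)" "\<And>n. Cod C (\<theta> n) = Dom C (diff X (Suc n))"
    "\<theta> 0 \<cdot> (aug Z \<cdot> b) = Neg C (diff X 0 \<cdot> \<epsilon>)"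
    "\<And>n. \<theta> (Suc n) \<cdot> diff Z n = Neg C (diff X (Suc n) \<cdot> \<theta> n)"
proof -
  have X': "resolution C (Dom C a) X" and Xinj: "injective_object C (Dom C (diff X n))" for n
    using X by (auto simp: injective_resolution_def)
  have Z': "resolution C (Cod C b) Z"
    using Z by (simp add: injective_resolution_def)
  have a: "is_mono C a" and b: "is_epi C b" and bk: "is_cokernel C b a"
    using ab short_exact_cokernel by (auto simp: short_exact_def)
  note [simp] = resolution_simps(2-4,6,8)[OF X'] resolution_simps(2-4,6,8)[OF Z']
    cochain_complex_simps[OF resolution_simps(1)[OF X']] cochain_complex_simps[OF resolution_simps(1)[OF Z']]
    mono_Arr[OF a] epi_Arr[OF b]
  have [simp]: "Cod C a = Dom C b" using cokernel_simps(3)[OF bk] by simp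
  obtain \<epsilon> where \<epsilon> [simp]: "\<epsilon> \<in> Arr C" "Dom C \<epsilon> = Cod C a" "Cod C \<epsilon> = Dom C (diff X 0)" "\<epsilon> \<cdot> a = aug X"
    by (rule injective_extend_mono[OF Xinj[of 0] a, of "aug X"]) auto
  \<comment> \<open>\<open>diff X 0 \<cdot> \<epsilon>\<close> kills \<open>a\<close> because
    \<open>diff X 0\<close> kills the augmentation, so it descends along \<open>b\<close>. Extending
    its negative along \<open>aug Z\<close> gives the first \<open>\<theta>\<close>, chosen so that
    the differential kills the augmentation of the middle complex.\<close>
  obtain \<phi> where \<phi> [simp]: "\<phi> \<in> Arr C" "Dom C \<phi> = Cod C b" "Cod C \<phi> = Dom C (diff X (Suc 0))"
    and \<phi>b: "\<phi> \<cdot> b = diff X 0 \<cdot> \<epsilon>"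
    by (rule cokernel_factor[OF bk, of "diff X 0 \<cdot> \<epsilon>"]) auto
  obtain \<theta>0 where \<theta>0 [simp]: "\<theta>0 \<in> Arr C" "Dom C \<theta>0 = Dom C (diff Z 0)" "Cod C \<theta>0 = Dom C (diff X (Suc 0))"
    "\<theta>0 \<cdot> aug Z = Neg C \<phi>"
    by (rule injective_extend_mono[OF Xinj[of "Suc 0"] resolution_simps(5)[OF Z'], of "Neg C \<phi>"]) auto
  have \<theta>0b: "\<theta>0 \<cdot> (aug Z \<cdot> b) = Neg C (diff X 0 \<cdot> \<epsilon>)"
    using Comp_extend[OF \<theta>0(4), of b] by (simp add: \<phi>b)
  have dd: "diff X (Suc 0) \<cdot> \<phi> = Zero C (Cod C b) (Dom C (diff X (Suc (Suc 0))))"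
    using epi_cancel_Zero[OF b, of "diff X (Suc 0) \<cdot> \<phi>"] \<phi>b by simp
  have [simp]: "aug_incoming Z n \<in> Arr C" "Cod C (aug_incoming Z n) = Dom C (diff Z n)" for n
    by (auto simp: aug_incoming_def split: nat.split)
  \<comment> \<open>The vanishing clause allows the negative of
    \<open>diff X (Suc n) \<cdot> \<theta> n\<close> to extend along \<open>diff Z n\<close>. For
    \<open>\<theta>0\<close> it is \<open>dd\<close>, obtained by cancelling the epimorphism
    \<open>b\<close>.\<close>
  have "\<exists>\<theta>. \<forall>n. (\<theta> n \<in> Arr C \<and> Dom C (\<theta> n) = Dom C (diff Z n) \<and> Cod C (\<theta> n) = Dom C (diff X (Suc n)) \<and>
      (n = 0 \<longrightarrow> \<theta> n = \<theta>0) \<and>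
      diff X (Suc n) \<cdot> (\<theta> n \<cdot> aug_incoming Z n) =
        Zero C (Dom C (aug_incoming Z n)) (Dom C (diff X (Suc (Suc n))))) \<and>
      \<theta> (Suc n) \<cdot> diff Z n = Neg C (diff X (Suc n) \<cdot> \<theta> n)"
  proof (rule dependent_nat_choice)
    show "\<exists>\<theta>. \<theta> \<in> Arr C \<and> Dom C \<theta> = Dom C (diff Z 0) \<and> Cod C \<theta> = Dom C (diff X (Suc 0)) \<and>
        ((0::nat) = 0 \<longrightarrow> \<theta> = \<theta>0) \<and>
        diff X (Suc 0) \<cdot> (\<theta> \<cdot> aug_incoming Z 0) =
          Zero C (Dom C (aug_incoming Z 0)) (Dom C (diff X (Suc (Suc 0))))"
      by (intro exI[of _ \<theta>0]) (simp add: aug_incoming_def dd)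
  next
    fix \<theta> n
    assume *: "\<theta> \<in> Arr C \<and> Dom C \<theta> = Dom C (diff Z n) \<and> Cod C \<theta> = Dom C (diff X (Suc n)) \<and>
        (n = 0 \<longrightarrow> \<theta> = \<theta>0) \<and>
        diff X (Suc n) \<cdot> (\<theta> \<cdot> aug_incoming Z n) =
          Zero C (Dom C (aug_incoming Z n)) (Dom C (diff X (Suc (Suc n))))"
    obtain \<theta>' where \<theta>': "\<theta>' \<in> Arr C" "Dom C \<theta>' = Cod C (diff Z n)" "Cod C \<theta>' = Dom C (diff X (Suc (Suc n)))"
      "\<theta>' \<cdot> diff Z n = Neg C (diff X (Suc n) \<cdot> \<theta>)"
      by (rule injective_extend[OF resolution_simps(7)[OF Z', of n] Xinj[of "Suc (Suc n)"],
            of "Neg C (diff X (Suc n) \<cdot> \<theta>)"]) (use * in auto)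
    then show "\<exists>y. (y \<in> Arr C \<and> Dom C y = Dom C (diff Z (Suc n)) \<and> Cod C y = Dom C (diff X (Suc (Suc n))) \<and>
        (Suc n = 0 \<longrightarrow> y = \<theta>0) \<and>
        diff X (Suc (Suc n)) \<cdot> (y \<cdot> aug_incoming Z (Suc n)) =
          Zero C (Dom C (aug_incoming Z (Suc n))) (Dom C (diff X (Suc (Suc (Suc n)))))) \<and>
        y \<cdot> diff Z n = Neg C (diff X (Suc n) \<cdot> \<theta>)"
      using * by (intro exI[of _ \<theta>']) (simp add: aug_incoming_def)
  qed
  then obtain \<theta> where "\<theta> n \<in> Arr C" "Dom C (\<theta> n) = Dom C (diff Z n)" "Cod C (\<theta> n) = Dom C (diff X (Suc n))"
    "\<theta> 0 = \<theta>0" "\<theta> (Suc n) \<cdot> diff Z n = Neg C (diff X (Suc n) \<cdot> \<theta> n)" for n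
    by blast
  then show thesis using that[of \<epsilon> \<theta>] \<epsilon> \<theta>0b by simp
qed

lemma horseshoe:
  assumes enough: "enough_injectives C" and ab: "short_exact C a b"
    and X: "injective_resolution C (Dom C a) X" and Z: "injective_resolution C (Cod C b) Z"
  obtains K u v where "injective_resolution C (Cod C a) K"
    "short_exact_complexes C (diff X) (diff K) (diff Z) u v"
    "u 0 \<cdot> aug X = aug K \<cdot> a" "v 0 \<cdot> aug K = aug Z \<cdot> b"
proof -
  have X': "resolution C (Dom C a) X" and Xinj: "injective_object C (Dom C (diff X n))" for n
    using X by (auto simp: injective_resolution_def)
  have Z': "resolution C (Cod C b) Z" and Zinj: "injective_object C (Dom C (diff Z n))" for n
    using Z by (auto simp: injective_resolution_def)
  have a: "is_mono C a" and b: "is_epi C b" and bk: "is_cokernel C b a" and ba: "is_kernel C a b"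
    using ab short_exact_cokernel short_exact_kernel by (auto simp: short_exact_def)
  note [simp] = resolution_simps(2-4,6,8)[OF X'] resolution_simps(2-4,6,8)[OF Z']
    cochain_complex_simps[OF resolution_simps(1)[OF X']] cochain_complex_simps[OF resolution_simps(1)[OF Z']]
    mono_Arr[OF a] epi_Arr[OF b] kernel_simps(4)[OF ba]
  have [simp]: "Cod C a = Dom C b" using cokernel_simps(3)[OF bk] by simp
  obtain \<epsilon> \<theta> where \<epsilon> [simp]: "\<epsilon> \<in> Arr C" "Dom C \<epsilon> = Cod C a" "Cod C \<epsilon> = Dom C (diff X 0)" "\<epsilon> \<cdot> a = aug X"
    and \<theta> [simp]: "\<And>n. \<theta> n \<in> Arr C" "\<And>n. Dom C (\<theta> n) = Dom C (diff Z n)"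
      "\<And>n. Cod C (\<theta> n) = Dom C (diff X (Suc n))"
      "\<theta> 0 \<cdot> (aug Z \<cdot> b) = Neg C (diff X 0 \<cdot> \<epsilon>)"
      "\<And>n. \<theta> (Suc n) \<cdot> diff Z n = Neg C (diff X (Suc n) \<cdot> \<theta> n)"
    by (rule horseshoe_twist[OF ab X Z]) (rule that)
  have \<theta>_extend [simp]: "\<theta> (Suc n) \<cdot> (diff Z n \<cdot> x) = Neg C (diff X (Suc n) \<cdot> (\<theta> n \<cdot> x))"
    if "x \<in> Arr C" "Cod C x = Dom C (diff Z n)" for n x
    using Comp_extend[OF \<theta>(5), where x=x] that by simp
  have "\<exists>t. is_biproduct C (Dom C (diff X n)) (Dom C (diff Z n))
      (fst t) (fst (snd t)) (fst (snd (snd t))) (fst (snd (snd (snd t)))) (snd (snd (snd (snd t))))" for n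
    using ex_biproduct[of "Dom C (diff X n)" "Dom C (diff Z n)"] by simp
  then obtain t where t: "is_biproduct C (Dom C (diff X n)) (Dom C (diff Z n))
      (fst (t n)) (fst (snd (t n))) (fst (snd (snd (t n)))) (fst (snd (snd (snd (t n))))) (snd (snd (snd (snd (t n)))))" for n
    by metis
  define S i1 i2 p1 p2 where "S n = fst (t n)" and "i1 n = fst (snd (t n))" and "i2 n = fst (snd (snd (t n)))"
    and "p1 n = fst (snd (snd (snd (t n))))" and "p2 n = snd (snd (snd (snd (t n))))" for n
  have s: "is_biproduct C (Dom C (diff X n)) (Dom C (diff Z n)) (S n) (i1 n) (i2 n) (p1 n) (p2 n)" for n
    using t[of n] by (simp add: S_def i1_def i2_def p1_def p2_def)
  note [simp] = s[unfolded is_biproduct_def Hom_iff, THEN conjunct1]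
    s[unfolded is_biproduct_def Hom_iff, THEN conjunct2, simplified]
  have split: "h = (h \<cdot> i1 n) \<cdot> p1 n \<oplus> (h \<cdot> i2 n) \<cdot> p2 n" if "h \<in> Arr C" "Dom C h = S n" for h n
  proof -
    have "h \<cdot> (i1 n \<cdot> p1 n \<oplus> i2 n \<cdot> p2 n) = h \<cdot> (i1 n \<cdot> p1 n) \<oplus> h \<cdot> (i2 n \<cdot> p2 n)"
      using that by (intro Comp_distrib) simp_all
    then show ?thesis using that by simp
  qed
  have [simp]: "p1 n \<cdot> (i1 n \<cdot> x) = x" "p2 n \<cdot> (i1 n \<cdot> x) = Zero C (Dom C x) (Dom C (diff Z n))"
    if "x \<in> Arr C" "Cod C x = Dom C (diff X n)" for n x
    using that Comp_extend[of "p1 n" "i1 n" _ x] Comp_extend[of "p2 n" "i1 n" _ x] by simp_all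
  have [simp]: "p2 n \<cdot> (i2 n \<cdot> x) = x" "p1 n \<cdot> (i2 n \<cdot> x) = Zero C (Dom C x) (Dom C (diff X n))"
    if "x \<in> Arr C" "Cod C x = Dom C (diff Z n)" for n x
    using that Comp_extend[of "p1 n" "i2 n" _ x] Comp_extend[of "p2 n" "i2 n" _ x] by simp_all
  define d where "d n = i1 (Suc n) \<cdot> (diff X n \<cdot> p1 n \<oplus> \<theta> n \<cdot> p2 n) \<oplus> i2 (Suc n) \<cdot> (diff Z n \<cdot> p2 n)" for n
  define \<eta> where "\<eta> = i1 0 \<cdot> \<epsilon> \<oplus> i2 0 \<cdot> (aug Z \<cdot> b)"
  have d [simp]: "d n \<in> Arr C" "Dom C (d n) = S n" "Cod C (d n) = S (Suc n)"
    "d n \<cdot> i1 n = i1 (Suc n) \<cdot> diff X n"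
    "d n \<cdot> i2 n = i1 (Suc n) \<cdot> \<theta> n \<oplus> i2 (Suc n) \<cdot> diff Z n" for n
    by (simp_all add: d_def)
  have \<eta> [simp]: "\<eta> \<in> Arr C" "Dom C \<eta> = Dom C b" "Cod C \<eta> = S 0" by (simp_all add: \<eta>_def)
  have dd: "d (Suc n) \<cdot> d n = Zero C (S n) (S (Suc (Suc n)))" for n
    by (simp add: d_def)
  have d\<eta>: "d 0 \<cdot> \<eta> = Zero C (Dom C b) (S (Suc 0))"
    by (simp add: d_def \<eta>_def)
  have \<eta>_mono: "is_mono C \<eta>"
  proof (rule is_monoI_injective[OF enough])
    fix h assume h [simp]: "h \<in> Arr C" "Dom C h = Dom C \<eta>" and inj: "injective_object C (Cod C h)"
    \<comment> \<open>The extension is sought as \<open>\<alpha> p1 + \<beta> p2\<close>.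
      Restriction along \<open>a\<close> dictates \<open>\<alpha>\<close>; the remainder
      \<open>h - \<alpha> \<epsilon>\<close> then kills \<open>a\<close>, so it descends along
      \<open>b\<close> and extends along \<open>aug Z\<close> to \<open>\<beta>\<close>.\<close>
    obtain \<alpha> where \<alpha> [simp]: "\<alpha> \<in> Arr C" "Dom C \<alpha> = Cod C (aug X)" "Cod C \<alpha> = Cod C h" "\<alpha> \<cdot> aug X = h \<cdot> a"
      by (rule injective_extend_mono[OF inj resolution_simps(5)[OF X'], of "h \<cdot> a"]) auto
    obtain \<gamma> where \<gamma> [simp]: "\<gamma> \<in> Arr C" "Dom C \<gamma> = Cod C b" "Cod C \<gamma> = Cod C h" "\<gamma> \<cdot> b = h \<oplus> Neg C (\<alpha> \<cdot> \<epsilon>)"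
      by (rule cokernel_factor[OF bk, of "h \<oplus> Neg C (\<alpha> \<cdot> \<epsilon>)"]) auto
    obtain \<beta> where \<beta> [simp]: "\<beta> \<in> Arr C" "Dom C \<beta> = Cod C (aug Z)" "Cod C \<beta> = Cod C h" "\<beta> \<cdot> aug Z = \<gamma>"
      by (rule injective_extend_mono[OF inj resolution_simps(5)[OF Z'], of "\<gamma>"]) auto
    have "\<beta> \<cdot> (aug Z \<cdot> b) = h \<oplus> Neg C (\<alpha> \<cdot> \<epsilon>)" using Comp_extend[OF \<beta>(4), of b] by simp
    then have "(\<alpha> \<cdot> p1 0 \<oplus> \<beta> \<cdot> p2 0) \<cdot> \<eta> = h"
      by (simp add: \<eta>_def Add_ac)
    then show "\<exists>h'\<in>Arr C. Dom C h' = Cod C \<eta> \<and> h' \<cdot> \<eta> = h"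
      by (intro bexI[of _ "\<alpha> \<cdot> p1 0 \<oplus> \<beta> \<cdot> p2 0"]) simp_all
  qed simp
  have exact0: "exact_at C \<eta> (d 0)"
  proof (rule exact_atI_injective[OF enough])
    fix h assume h [simp]: "h \<in> Arr C" "Dom C h = Dom C (d 0)" and inj: "injective_object C (Cod C h)"
      and h0: "h \<cdot> \<eta> = Zero C (Dom C \<eta>) (Cod C h)"
    have 1: "(h \<cdot> i1 0) \<cdot> \<epsilon> \<oplus> (h \<cdot> i2 0) \<cdot> (aug Z \<cdot> b) = Zero C (Dom C b) (Cod C h)"
      using h0 by (simp add: \<eta>_def)
    have "\<eta> \<cdot> a = i1 0 \<cdot> aug X" by (simp add: \<eta>_def)
    then have 2: "h \<cdot> i1 0 \<cdot> aug X = Zero C (Dom C a) (Cod C h)"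
      using Comp_extend[OF h0, of a] by simp
    obtain \<alpha> where \<alpha> [simp]: "\<alpha> \<in> Arr C" "Dom C \<alpha> = Cod C (diff X 0)" "Cod C \<alpha> = Cod C h" "\<alpha> \<cdot> diff X 0 = h \<cdot> i1 0"
      by (rule injective_extend[OF resolution_simps(7)[OF X', of 0] inj, of "h \<cdot> i1 0"])
        (use 2 in \<open>auto simp: aug_incoming_def\<close>)
    \<comment> \<open>\<open>\<alpha>\<close> settles the \<open>X\<close>-summand. What is left on
      the \<open>Z\<close>-summand is \<open>h\<close> minus the contribution of the off-diagonal
      entry \<open>\<theta>\<close> of the differential.\<close>
    define \<gamma> where "\<gamma> = h \<cdot> i2 0 \<oplus> Neg C (\<alpha> \<cdot> \<theta> 0)"
    have [simp]: "\<gamma> \<in> Arr C" "Dom C \<gamma> = Dom C (diff Z 0)" "Cod C \<gamma> = Cod C h" by (simp_all add: \<gamma>_def)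
    have "(\<gamma> \<cdot> aug Z) \<cdot> b = Zero C (Dom C b) (Cod C h)"
      using 1 Comp_extend[OF \<alpha>(4), of \<epsilon>] by (simp add: \<gamma>_def Add_ac)
    then have \<gamma>: "\<gamma> \<cdot> aug Z = Zero C (Cod C b) (Cod C h)"
      using epi_cancel_Zero[OF b, of "\<gamma> \<cdot> aug Z"] by simp
    obtain \<beta> where \<beta> [simp]: "\<beta> \<in> Arr C" "Dom C \<beta> = Cod C (diff Z 0)" "Cod C \<beta> = Cod C h" "\<beta> \<cdot> diff Z 0 = \<gamma>"
      by (rule injective_extend[OF resolution_simps(7)[OF Z', of 0] inj, of \<gamma>])
        (use \<gamma> in \<open>auto simp: aug_incoming_def\<close>)
    have "(\<alpha> \<cdot> p1 (Suc 0) \<oplus> \<beta> \<cdot> p2 (Suc 0)) \<cdot> d 0 = h"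
      using Comp_extend[OF \<alpha>(4), of "p1 0"] Comp_extend[OF \<beta>(4), of "p2 0"]
      by (subst split[of h 0]) (simp_all add: d_def \<gamma>_def Add_ac Add_Neg_cancel_far)
    then show "\<exists>h'\<in>Arr C. Dom C h' = Cod C (d 0) \<and> h' \<cdot> d 0 = h"
      by (intro bexI[of _ "\<alpha> \<cdot> p1 (Suc 0) \<oplus> \<beta> \<cdot> p2 (Suc 0)"]) simp_all
  qed (simp_all add: d\<eta>)
  have exact: "exact_at C (d n) (d (Suc n))" for n
  proof (rule exact_atI_injective[OF enough])
    fix h assume h [simp]: "h \<in> Arr C" "Dom C h = Dom C (d (Suc n))" and inj: "injective_object C (Cod C h)"
      and h0: "h \<cdot> d n = Zero C (Dom C (d n)) (Cod C h)"
    have 1: "h \<cdot> i1 (Suc n) \<cdot> diff X n = Zero C (Dom C (diff X n)) (Cod C h)"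
      using Comp_extend[OF h0, of "i1 n"] by simp
    have 2: "(h \<cdot> i1 (Suc n)) \<cdot> \<theta> n \<oplus> (h \<cdot> i2 (Suc n)) \<cdot> diff Z n = Zero C (Dom C (diff Z n)) (Cod C h)"
      using Comp_extend[OF h0, of "i2 n"] by simp
    obtain \<alpha> where \<alpha> [simp]: "\<alpha> \<in> Arr C" "Dom C \<alpha> = Cod C (diff X (Suc n))" "Cod C \<alpha> = Cod C h"
      "\<alpha> \<cdot> diff X (Suc n) = h \<cdot> i1 (Suc n)"
      by (rule injective_extend[OF resolution_simps(7)[OF X', of "Suc n"] inj, of "h \<cdot> i1 (Suc n)"])
        (use 1 in \<open>auto simp: aug_incoming_def\<close>)
    define \<gamma> where "\<gamma> = h \<cdot> i2 (Suc n) \<oplus> Neg C (\<alpha> \<cdot> \<theta> (Suc n))"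
    have [simp]: "\<gamma> \<in> Arr C" "Dom C \<gamma> = Dom C (diff Z (Suc n))" "Cod C \<gamma> = Cod C h" by (simp_all add: \<gamma>_def)
    have \<gamma>: "\<gamma> \<cdot> diff Z n = Zero C (Dom C (diff Z n)) (Cod C h)"
      using 2 Comp_extend[OF \<alpha>(4), of "\<theta> n"] by (simp add: \<gamma>_def Add_ac)
    obtain \<beta> where \<beta> [simp]: "\<beta> \<in> Arr C" "Dom C \<beta> = Cod C (diff Z (Suc n))" "Cod C \<beta> = Cod C h"
      "\<beta> \<cdot> diff Z (Suc n) = \<gamma>"
      by (rule injective_extend[OF resolution_simps(7)[OF Z', of "Suc n"] inj, of \<gamma>])
        (use \<gamma> in \<open>auto simp: aug_incoming_def\<close>)
    have "(\<alpha> \<cdot> p1 (Suc (Suc n)) \<oplus> \<beta> \<cdot> p2 (Suc (Suc n))) \<cdot> d (Suc n) = h"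
      using Comp_extend[OF \<alpha>(4), of "p1 (Suc n)"] Comp_extend[OF \<beta>(4), of "p2 (Suc n)"]
      by (subst split[of h "Suc n"]) (simp_all add: d_def \<gamma>_def Add_ac Add_Neg_cancel_far)
    then show "\<exists>h'\<in>Arr C. Dom C h' = Cod C (d (Suc n)) \<and> h' \<cdot> d (Suc n) = h"
      by (intro bexI[of _ "\<alpha> \<cdot> p1 (Suc (Suc n)) \<oplus> \<beta> \<cdot> p2 (Suc (Suc n))"]) simp_all
  qed (simp_all add: dd)
  define K where "K = \<lparr>aug = \<eta>, diff = d\<rparr>"
  have complex: "cochain_complex C d" by (simp add: cochain_complex_def dd)
  have "injective_object C (S n)" for n by (rule injective_biproduct[OF s Xinj Zinj])
  then have "injective_resolution C (Cod C a) K"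
    unfolding injective_resolution_def resolution_def K_def
    using complex \<eta>_mono exact0 exact by (simp add: Hom_iff)
  moreover have "short_exact_complexes C (diff X) (diff K) (diff Z) i1 p2"
    unfolding short_exact_complexes_def chain_map_def K_def
    using complex resolution_simps(1)[OF X'] resolution_simps(1)[OF Z'] biproduct_short_exact[OF s]
    by (simp add: Hom_iff d_def)
  moreover have "i1 0 \<cdot> aug X = aug K \<cdot> a" "p2 0 \<cdot> aug K = aug Z \<cdot> b"
    by (simp_all add: K_def \<eta>_def)
  ultimately show thesis by (rule that)
qed

end

section \<open>Cohomology classes\<close>

definition cocycle :: "('o, 'm) precategory \<Rightarrow> (nat \<Rightarrow> 'm) \<Rightarrow> nat \<Rightarrow> 'm \<Rightarrow> bool" where
  "cocycle C X n z \<longleftrightarrow> z \<in> Arr C \<and> Cod C z = Dom C (X n) \<and>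
     X n \<cdot>\<^bsub>C\<^esub> z = Zero C (Dom C z) (Dom C (X (Suc n)))"

text \<open>The multiple \<open>(-1)^k f\<close> without mention of a hom group, so that signs can
  move through composites whose endpoints change; \<open>signed_int_pow\<close> returns to group
  powers.\<close>

definition signed :: "('o, 'm) precategory \<Rightarrow> nat \<Rightarrow> 'm \<Rightarrow> 'm" where
  "signed C k f = (if even k then f else Neg C f)"

context preadditive_category
begin

lemma signed_simps [simp]:
  "f \<in> Arr C \<Longrightarrow> signed C k f \<in> Arr C"
  "f \<in> Arr C \<Longrightarrow> Dom C (signed C k f) = Dom C f"
  "f \<in> Arr C \<Longrightarrow> Cod C (signed C k f) = Cod C f"
  "\<lbrakk>f \<in> Arr C; g \<in> Arr C; Cod C f = Dom C g\<rbrakk> \<Longrightarrow> g \<cdot> signed C k f = signed C k (g \<cdot> f)"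
  "\<lbrakk>f \<in> Arr C; g \<in> Arr C; Cod C f = Dom C g\<rbrakk> \<Longrightarrow> signed C k g \<cdot> f = signed C k (g \<cdot> f)"
  "f \<in> Arr C \<Longrightarrow> signed C j (signed C k f) = signed C (j + k) f"
  by (simp_all add: signed_def)

lemma signed_int_pow:
  assumes "f \<in> Hom C a b"
  shows "f [^]\<^bsub>hom_group C a b\<^esub> ((- 1) ^ k :: int) = signed C k f"
proof -
  have ab: "a \<in> Obj C" "b \<in> Obj C" "Dom C f = a" "Cod C f = b" "f \<in> carrier (hom_group C a b)"
    using assms by (auto simp: Hom_iff hom_group_def)
  interpret comm_group "hom_group C a b" by (rule comm_group_Hom[OF ab(1,2)])
  show ?thesis
    using ab int_pow_1[of f] int_pow_neg[of f 1] by (cases "even k") (simp_all add: signed_def Neg_def)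
qed

lemma cocycle_simps:
  assumes "cocycle C X n z"
  shows "z \<in> Arr C" "Cod C z = Dom C (X n)" "X n \<cdot> z = Zero C (Dom C z) (Dom C (X (Suc n)))"
  using assms by (auto simp: cocycle_def)

lemma cocycle_diff:
  assumes X: "cochain_complex C X" and x: "x \<in> Arr C" "Cod C x = Dom C (X n)"
  shows "cocycle C X (Suc n) (X n \<cdot> x)"
  using x cochain_complex_simps[OF X] by (simp add: cocycle_def)

lemma cocycle_chain_map:
  assumes X: "cochain_complex C X" and Y: "cochain_complex C Y" and f: "chain_map C X Y f"
    and z: "cocycle C X n z"
  shows "cocycle C Y n (f n \<cdot> z)"
  using cocycle_simps[OF z] chain_map_simps[OF f] cochain_complex_simps(1,2)[OF X] cochain_complex_simps(1,2)[OF Y]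
    Comp_extend[OF chain_map_simps(4)[OF f, of n], of z]
  by (simp add: cocycle_def)

lemma factor_through_eq:
  assumes "is_mono C k" "h \<in> Arr C" "Cod C h = Dom C k"
  shows "factor_through C k (k \<cdot> h) = h"
  unfolding factor_through_def
proof (rule the_equality)
  fix h' assume "h' \<in> Hom C (Dom C (k \<cdot> h)) (Dom C k) \<and> k \<cdot> h' = k \<cdot> h"
  then show "h' = h" using assms mono_Arr[OF assms(1)] by - (rule mono_cancel[OF assms(1)], auto simp: Hom_iff)
qed (use assms mono_Arr in \<open>simp add: Hom_iff\<close>)

end

section \<open>Classes of cocycles and maps induced on cohomology\<close>

context abelian_category
begin

lemma zero_object_Obj: "zero_object C \<in> Obj C"
  using someI_ex[OF ex_zero_object] by (simp add: zero_object_def is_zero_object_def)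

lemma cocycle_incoming:
  assumes X: "cochain_complex C X"
  shows "cocycle C X n (incoming C X n)"
  using cochain_complex_simps[OF X] zero_object_Obj by (cases n) (simp_all add: cocycle_def)

lemma cocycle_factor:
  assumes X: "cochain_complex C X" and z: "cocycle C X n z"
  shows "factor_through C (ker_arr C (X n)) z \<in> Arr C"
    "Dom C (factor_through C (ker_arr C (X n)) z) = Dom C z"
    "Cod C (factor_through C (ker_arr C (X n)) z) = Dom C (ker_arr C (X n))"
    "ker_arr C (X n) \<cdot> factor_through C (ker_arr C (X n)) z = z"
proof -
  have k: "is_kernel C (ker_arr C (X n)) (X n)" by (rule kernel_ker_arr) (rule cochain_complex_simps[OF X])
  obtain h where "h \<in> Arr C" "Dom C h = Dom C z" "Cod C h = Dom C (ker_arr C (X n))" "ker_arr C (X n) \<cdot> h = z"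
    by (rule kernel_factor[OF k, of z]) (use cocycle_simps[OF z] cochain_complex_simps(2)[OF X] in auto)
  moreover from this have "factor_through C (ker_arr C (X n)) z = h"
    using factor_through_eq[OF kernel_mono[OF k]] by blast
  ultimately show "factor_through C (ker_arr C (X n)) z \<in> Arr C"
    "Dom C (factor_through C (ker_arr C (X n)) z) = Dom C z"
    "Cod C (factor_through C (ker_arr C (X n)) z) = Dom C (ker_arr C (X n))"
    "ker_arr C (X n) \<cdot> factor_through C (ker_arr C (X n)) z = z" by simp_all
qed

lemma coh_proj_cokernel:
  assumes X: "cochain_complex C X"
  shows "is_cokernel C (coh_proj C X n) (factor_through C (ker_arr C (X n)) (incoming C X n))"
  unfolding coh_proj_def by (rule cokernel_coker_arr) (rule cocycle_factor[OF X cocycle_incoming[OF X]])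

lemma coh_proj_simps:
  assumes X: "cochain_complex C X"
  shows "coh_proj C X n \<in> Arr C" "Dom C (coh_proj C X n) = Dom C (ker_arr C (X n))"
    "Cod C (coh_proj C X n) = coh C X n" "is_epi C (coh_proj C X n)" "coh C X n \<in> Obj C"
  using cokernel_simps[OF coh_proj_cokernel[OF X]] cokernel_epi[OF coh_proj_cokernel[OF X]]
    cocycle_factor[OF X cocycle_incoming[OF X]] Cod_in_Obj
  by (auto simp: coh_def)

lemma coh_class_simps:
  assumes X: "cochain_complex C X" and z: "cocycle C X n z"
  shows "coh_class C X n z \<in> Arr C" "Dom C (coh_class C X n z) = Dom C z"
    "Cod C (coh_class C X n z) = coh C X n"
  using coh_proj_simps[OF X] cocycle_factor[OF X z] by (simp_all add: coh_class_def)

lemma ker_arr_simps: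
  assumes X: "cochain_complex C X"
  shows "is_mono C (ker_arr C (X n))" "ker_arr C (X n) \<in> Arr C" "Cod C (ker_arr C (X n)) = Dom C (X n)"
    "cocycle C X n (ker_arr C (X n))"
proof -
  have k: "is_kernel C (ker_arr C (X n)) (X n)" by (rule kernel_ker_arr) (rule cochain_complex_simps[OF X])
  show "is_mono C (ker_arr C (X n))" "ker_arr C (X n) \<in> Arr C" "Cod C (ker_arr C (X n)) = Dom C (X n)"
    "cocycle C X n (ker_arr C (X n))"
    using kernel_mono[OF k] kernel_simps[OF k] cochain_complex_simps(2)[OF X] by (simp_all add: cocycle_def)
qed

lemma coh_class_ker_arr:
  assumes X: "cochain_complex C X"
  shows "coh_class C X n (ker_arr C (X n)) = coh_proj C X n"
  using ker_arr_simps[OF X, of n] coh_proj_simps[OF X, of n]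
    factor_through_eq[of "ker_arr C (X n)" "Id C (Dom C (ker_arr C (X n)))"]
  by (simp add: coh_class_def)

lemma coh_class_Comp:
  assumes X: "cochain_complex C X" and z: "cocycle C X n z" and x: "x \<in> Arr C" "Cod C x = Dom C z"
  shows "coh_class C X n (z \<cdot> x) = coh_class C X n z \<cdot> x"
proof -
  have "z \<cdot> x = ker_arr C (X n) \<cdot> (factor_through C (ker_arr C (X n)) z \<cdot> x)"
    using cocycle_factor[OF X z] x Comp_extend[OF cocycle_factor(4)[OF X z], of x] ker_arr_simps[OF X] by simp
  then have "factor_through C (ker_arr C (X n)) (z \<cdot> x) = factor_through C (ker_arr C (X n)) z \<cdot> x"
    using factor_through_eq[OF ker_arr_simps(1)[OF X]] cocycle_factor[OF X z] x by simp
  then show ?thesis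
    using coh_proj_simps[OF X] cocycle_factor[OF X z] x by (simp add: coh_class_def)
qed

lemma coh_class_Add:
  assumes X: "cochain_complex C X" and z: "cocycle C X n z" and z': "cocycle C X n z'" and "Dom C z = Dom C z'"
  shows "coh_class C X n (z \<oplus> z') = coh_class C X n z \<oplus> coh_class C X n z'"
proof -
  have "z \<oplus> z' = ker_arr C (X n) \<cdot> (factor_through C (ker_arr C (X n)) z \<oplus> factor_through C (ker_arr C (X n)) z')"
    using cocycle_factor[OF X z] cocycle_factor[OF X z'] assms(4) ker_arr_simps[OF X] by simp
  then have "factor_through C (ker_arr C (X n)) (z \<oplus> z') =
      factor_through C (ker_arr C (X n)) z \<oplus> factor_through C (ker_arr C (X n)) z'"
    using factor_through_eq[OF ker_arr_simps(1)[OF X]] cocycle_factor[OF X z] cocycle_factor[OF X z'] assms(4)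
    by simp
  then show ?thesis
    using coh_proj_simps[OF X] cocycle_factor[OF X z] cocycle_factor[OF X z'] assms(4)
    by (simp add: coh_class_def)
qed

lemma coh_class_Neg:
  assumes X: "cochain_complex C X" and z: "cocycle C X n z"
  shows "coh_class C X n (Neg C z) = Neg C (coh_class C X n z)"
proof -
  have "Neg C z = z \<cdot> Neg C (Id C (Dom C z))" using cocycle_simps[OF z] by simp
  then show ?thesis
    using coh_class_Comp[OF X z, of "Neg C (Id C (Dom C z))"] cocycle_simps[OF z] coh_class_simps[OF X z] by simp
qed

lemma coh_class_signed:
  assumes X: "cochain_complex C X" and z: "cocycle C X n z"
  shows "coh_class C X n (signed C k z) = signed C k (coh_class C X n z)"
  by (simp add: signed_def coh_class_Neg[OF X z])

lemma coh_class_incoming: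
  assumes X: "cochain_complex C X" and x: "x \<in> Arr C" "Cod C x = Dom C (incoming C X n)"
  shows "coh_class C X n (incoming C X n \<cdot> x) = Zero C (Dom C x) (coh C X n)"
proof -
  have "coh_class C X n (incoming C X n) = Zero C (Dom C (incoming C X n)) (coh C X n)"
    using cokernel_simps(4)[OF coh_proj_cokernel[OF X]] cocycle_factor[OF X cocycle_incoming[OF X]]
      coh_proj_simps[OF X] by (simp add: coh_class_def)
  then show ?thesis
    using coh_class_Comp[OF X cocycle_incoming[OF X] x] x coh_proj_simps[OF X] by simp
qed

lemma coh_class_diff:
  assumes X: "cochain_complex C X" and x: "x \<in> Arr C" "Cod C x = Dom C (X n)"
  shows "coh_class C X (Suc n) (X n \<cdot> x) = Zero C (Dom C x) (coh C X (Suc n))"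
  using coh_class_incoming[OF X, of x "Suc n"] x by simp

lemma coh_class_add_diff:
  assumes X: "cochain_complex C X" and z: "cocycle C X (Suc n) z"
    and x: "x \<in> Arr C" "Cod C x = Dom C (X n)" "Dom C x = Dom C z"
  shows "coh_class C X (Suc n) (z \<oplus> X n \<cdot> x) = coh_class C X (Suc n) z"
  using coh_class_Add[OF X z cocycle_diff[OF X x(1,2)]] coh_class_diff[OF X x(1,2)] x
    cochain_complex_simps(1,2)[OF X] coh_class_simps[OF X z] by simp

text \<open>The kernel inclusion is itself a cocycle, and its class is the epimorphism
  \<open>coh_proj\<close>.\<close>

lemma coh_ext:
  assumes X: "cochain_complex C X" and h: "h \<in> Arr C" "Dom C h = coh C X n" "h' \<in> Arr C" "Dom C h' = coh C X n"
    "Cod C h = Cod C h'" and "\<And>z. cocycle C X n z \<Longrightarrow> h \<cdot> coh_class C X n z = h' \<cdot> coh_class C X n z"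
  shows "h = h'"
  using assms(7)[OF ker_arr_simps(4)[OF X]] coh_proj_simps[OF X, of n] h
  by - (rule epi_cancel[OF coh_proj_simps(4)[OF X, of n]], simp_all add: coh_class_ker_arr[OF X])

text \<open>The kernel picked by \<open>ker_arr\<close> factors through \<open>k\<close>, so
  \<open>coh_proj\<close> factors through the class of \<open>k\<close>. The intended
  \<open>k\<close> is the kernel \<open>F Z^n\<close> in \<open>F J^n\<close> that left exactness
  provides.\<close>

lemma coh_class_kernel_epi:
  assumes X: "cochain_complex C X" and k: "is_kernel C k (X n)"
  shows "is_epi C (coh_class C X n k)"
proof -
  have z: "cocycle C X n k" using kernel_simps[OF k] cochain_complex_simps(2)[OF X] by (simp add: cocycle_def)
  note [simp] = coh_class_simps[OF X z] kernel_simps(1,2)[OF k]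
  show ?thesis
  proof (rule is_epiI)
    fix h assume [simp]: "h \<in> Arr C" "Dom C h = Cod C (coh_class C X n k)"
      and h: "h \<cdot> coh_class C X n k = Zero C (Dom C (coh_class C X n k)) (Cod C h)"
    obtain j where j: "j \<in> Arr C" "Dom C j = Dom C (ker_arr C (X n))" "Cod C j = Dom C k" "k \<cdot> j = ker_arr C (X n)"
      by (rule kernel_factor[OF k, of "ker_arr C (X n)"])
        (use cocycle_simps[OF ker_arr_simps(4)[OF X]] cochain_complex_simps(2)[OF X] in auto)
    have "h \<cdot> coh_proj C X n = h \<cdot> (coh_class C X n k \<cdot> j)"
      using coh_class_Comp[OF X z, of j] j by (simp add: coh_class_ker_arr[OF X])
    also have "\<dots> = Zero C (Dom C (coh_proj C X n)) (Cod C h)"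
      using Comp_extend[OF h, of j] j coh_proj_simps[OF X, of n] by simp
    finally show "h = Zero C (Cod C (coh_class C X n k)) (Cod C h)"
      using epi_cancel_Zero[OF coh_proj_simps(4)[OF X, of n], of h] coh_proj_simps[OF X, of n] by simp
  qed simp
qed

lemma coh_induced:
  assumes X: "cochain_complex C X" and Y: "cochain_complex C Y"
    and t: "t \<in> Arr C" "Dom C t = Dom C (X m)" "Cod C t = Dom C (Y n)"
    and cocycle: "\<And>z. cocycle C X m z \<Longrightarrow> cocycle C Y n (t \<cdot> z)"
    and zero: "coh_class C Y n (t \<cdot> incoming C X m) = Zero C (Dom C (incoming C X m)) (coh C Y n)"
  obtains h where "h \<in> Arr C" "Dom C h = coh C X m" "Cod C h = coh C Y n"
    "\<And>z. cocycle C X m z \<Longrightarrow> h \<cdot> coh_class C X m z = coh_class C Y n (t \<cdot> z)"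
proof -
  let ?k = "ker_arr C (X m)"
  have key: "coh_class C Y n (t \<cdot> ?k) \<cdot> factor_through C ?k z = coh_class C Y n (t \<cdot> z)" if "cocycle C X m z" for z
    using coh_class_Comp[OF Y cocycle[OF ker_arr_simps(4)[OF X]], of "factor_through C ?k z"]
      cocycle_factor[OF X that] ker_arr_simps[OF X] t by simp
  note [simp] = coh_class_simps[OF Y cocycle[OF ker_arr_simps(4)[OF X]]] ker_arr_simps(2,3)[OF X] t
    cocycle_factor(1-3)[OF X cocycle_incoming[OF X]]
  obtain h where h: "h \<in> Arr C" "Dom C h = Cod C (coh_proj C X m)" "Cod C h = coh C Y n"
    "h \<cdot> coh_proj C X m = coh_class C Y n (t \<cdot> ?k)"
    by (rule cokernel_factor[OF coh_proj_cokernel[OF X], of "coh_class C Y n (t \<cdot> ?k)"])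
      (use key[OF cocycle_incoming[OF X]] zero in auto)
  have "h \<cdot> coh_class C X m z = coh_class C Y n (t \<cdot> z)" if "cocycle C X m z" for z
    using key[OF that] Comp_extend[OF h(4), of "factor_through C ?k z"] h(1-3) coh_proj_simps[OF X, of m]
      cocycle_factor[OF X that] by (simp add: coh_class_def[of C X])
  then show thesis using that h coh_proj_simps[OF X] by simp
qed

lemma coh_map_class:
  assumes X: "cochain_complex C X" and Y: "cochain_complex C Y" and f: "chain_map C X Y f"
  shows "coh_map C X Y f n \<in> Arr C" "Dom C (coh_map C X Y f n) = coh C X n"
    "Cod C (coh_map C X Y f n) = coh C Y n"
    "cocycle C X n z \<Longrightarrow> coh_map C X Y f n \<cdot> coh_class C X n z = coh_class C Y n (f n \<cdot> z)"
proof -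
  note [simp] = chain_map_simps[OF f] cochain_complex_simps(1,2)[OF X] cochain_complex_simps(1,2)[OF Y]
    coh_proj_simps[OF X] coh_proj_simps[OF Y]
  have zero: "coh_class C Y n (f n \<cdot> incoming C X n) = Zero C (Dom C (incoming C X n)) (coh C Y n)"
  proof (cases n)
    case 0
    \<comment> \<open>In degree 0 both incoming arrows are zero arrows out of the zero object, and
      \<open>f 0\<close> carries one to the other.\<close>
    then show ?thesis using coh_class_incoming[OF Y, of "Id C (zero_object C)" 0] zero_object_Obj by simp
  next
    case (Suc m)
    then show ?thesis using coh_class_diff[OF Y, of "f m" m] by simp
  qed
  obtain h where h: "h \<in> Arr C" "Dom C h = coh C X n" "Cod C h = coh C Y n"
    "\<And>z. cocycle C X n z \<Longrightarrow> h \<cdot> coh_class C X n z = coh_class C Y n (f n \<cdot> z)"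
    by (rule coh_induced[OF X Y _ _ _ cocycle_chain_map[OF X Y f] zero]) auto
  have "coh_map C X Y f n = h"
    unfolding coh_map_def
  proof (rule the_equality)
    show "h \<in> Hom C (coh C X n) (coh C Y n) \<and> h \<cdot> coh_proj C X n = coh_class C Y n (f n \<cdot> ker_arr C (X n))"
      using h(1-3) h(4)[OF ker_arr_simps(4)[OF X]] by (simp add: coh_class_ker_arr[OF X] Hom_iff)
    then show "h' = h" if "h' \<in> Hom C (coh C X n) (coh C Y n) \<and>
        h' \<cdot> coh_proj C X n = coh_class C Y n (f n \<cdot> ker_arr C (X n))" for h'
      using that by - (rule epi_cancel[OF coh_proj_simps(4)[OF X, of n]], auto simp: Hom_iff)
  qed
  then show "coh_map C X Y f n \<in> Arr C" "Dom C (coh_map C X Y f n) = coh C X n"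
    "Cod C (coh_map C X Y f n) = coh C Y n"
    "cocycle C X n z \<Longrightarrow> coh_map C X Y f n \<cdot> coh_class C X n z = coh_class C Y n (f n \<cdot> z)"
    using h by simp_all
qed

end

section \<open>Degreewise split sequences of complexes\<close>

definition degreewise_split ::
    "('o, 'm) precategory \<Rightarrow> (nat \<Rightarrow> 'm) \<Rightarrow> (nat \<Rightarrow> 'm) \<Rightarrow> (nat \<Rightarrow> 'm) \<Rightarrow> (nat \<Rightarrow> 'm) \<Rightarrow> (nat \<Rightarrow> 'm) \<Rightarrow>
     (nat \<Rightarrow> 'm) \<Rightarrow> (nat \<Rightarrow> 'm) \<Rightarrow> bool"
  where
  "degreewise_split C X Y Z u v r s \<longleftrightarrow>
     cochain_complex C X \<and> cochain_complex C Y \<and> cochain_complex C Z \<and>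
     chain_map C X Y u \<and> chain_map C Y Z v \<and>
     (\<forall>n. is_biproduct C (Dom C (X n)) (Dom C (Z n)) (Dom C (Y n)) (u n) (s n) (r n) (v n))"

text \<open>The component \<open>Z\<^sup>n \<rightarrow> X\<^sup>n\<^sup>+\<^sup>1\<close> of the differential of \<open>Y\<close> with respect to the splittings; it
  represents the connecting homomorphism.\<close>

definition twist :: "('o, 'm) precategory \<Rightarrow> (nat \<Rightarrow> 'm) \<Rightarrow> (nat \<Rightarrow> 'm) \<Rightarrow> (nat \<Rightarrow> 'm) \<Rightarrow> nat \<Rightarrow> 'm" where
  "twist C Y r s n = r (Suc n) \<cdot>\<^bsub>C\<^esub> (Y n \<cdot>\<^bsub>C\<^esub> s n)"

context preadditive_category
begin

lemma degreewise_split_simps: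
  assumes "degreewise_split C X Y Z u v r s"
  shows "cochain_complex C X" "cochain_complex C Y" "cochain_complex C Z" "chain_map C X Y u" "chain_map C Y Z v"
    "r n \<in> Arr C" "Dom C (r n) = Dom C (Y n)" "Cod C (r n) = Dom C (X n)"
    "s n \<in> Arr C" "Dom C (s n) = Dom C (Z n)" "Cod C (s n) = Dom C (Y n)"
    "r n \<cdot> u n = Id C (Dom C (X n))" "v n \<cdot> s n = Id C (Dom C (Z n))"
    "r n \<cdot> s n = Zero C (Dom C (Z n)) (Dom C (X n))" "v n \<cdot> u n = Zero C (Dom C (X n)) (Dom C (Z n))"
    "u n \<cdot> r n \<oplus> s n \<cdot> v n = Id C (Dom C (Y n))"
  using assms by (auto simp: degreewise_split_def is_biproduct_def Hom_iff)

text \<open>The differential of \<open>Y\<close> is expanded with \<open>u r + s v = Id\<close>.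
  Anticommutation is the \<open>u\<close>-component of \<open>d d s = 0\<close>, isolated by
  cancelling the split monomorphism \<open>u\<close>.\<close>

lemma twist_simps:
  assumes S: "degreewise_split C X Y Z u v r s"
  shows "twist C Y r s n \<in> Arr C" "Dom C (twist C Y r s n) = Dom C (Z n)"
    "Cod C (twist C Y r s n) = Dom C (X (Suc n))"
    "Y n \<cdot> s n = u (Suc n) \<cdot> twist C Y r s n \<oplus> s (Suc n) \<cdot> Z n"
    "r (Suc n) \<cdot> Y n = X n \<cdot> r n \<oplus> twist C Y r s n \<cdot> v n"
    "twist C Y r s (Suc n) \<cdot> Z n = Neg C (X (Suc n) \<cdot> twist C Y r s n)"
proof -
  note D = degreewise_split_simps[OF S]
  note [simp] = D(6-15) cochain_complex_simps[OF D(1)] cochain_complex_simps[OF D(2)]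
    cochain_complex_simps[OF D(3)]
  note u = chain_map_simps[OF D(4)] and v = chain_map_simps[OF D(5)]
  note [simp] = u(1-3) v(1-3)
  let ?t = "twist C Y r s"
  show t [simp]: "?t n \<in> Arr C" "Dom C (?t n) = Dom C (Z n)" "Cod C (?t n) = Dom C (X (Suc n))" for n
    by (simp_all add: twist_def)
  show ds: "Y n \<cdot> s n = u (Suc n) \<cdot> ?t n \<oplus> s (Suc n) \<cdot> Z n" for n
  proof -
    have "Y n \<cdot> s n = (u (Suc n) \<cdot> r (Suc n) \<oplus> s (Suc n) \<cdot> v (Suc n)) \<cdot> (Y n \<cdot> s n)"
      unfolding D(16) by simp
    also have "\<dots> = u (Suc n) \<cdot> ?t n \<oplus> s (Suc n) \<cdot> (v (Suc n) \<cdot> Y n \<cdot> s n)"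
      by (simp add: twist_def)
    also have "v (Suc n) \<cdot> Y n \<cdot> s n = Z n"
      unfolding v(4) by simp
    finally show ?thesis .
  qed
  show "r (Suc n) \<cdot> Y n = X n \<cdot> r n \<oplus> ?t n \<cdot> v n"
  proof -
    have "r (Suc n) \<cdot> Y n = (r (Suc n) \<cdot> Y n) \<cdot> (u n \<cdot> r n \<oplus> s n \<cdot> v n)"
      unfolding D(16) by simp
    also have "\<dots> = r (Suc n) \<cdot> ((Y n \<cdot> u n) \<cdot> r n) \<oplus> ?t n \<cdot> v n"
      by (simp add: twist_def)
    also have "r (Suc n) \<cdot> ((Y n \<cdot> u n) \<cdot> r n) = X n \<cdot> r n"
      unfolding u(4)[symmetric] using Comp_extend[OF D(12)[of "Suc n"], of "X n \<cdot> r n"] by simp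
    finally show ?thesis .
  qed
  have "u (Suc (Suc n)) \<cdot> (X (Suc n) \<cdot> ?t n \<oplus> ?t (Suc n) \<cdot> Z n) =
      (Y (Suc n) \<cdot> u (Suc n)) \<cdot> ?t n \<oplus> (u (Suc (Suc n)) \<cdot> ?t (Suc n) \<oplus> s (Suc (Suc n)) \<cdot> Z (Suc n)) \<cdot> Z n"
    unfolding u(4)[symmetric] by simp
  also have "\<dots> = Y (Suc n) \<cdot> (u (Suc n) \<cdot> ?t n \<oplus> s (Suc n) \<cdot> Z n)"
    unfolding ds[of "Suc n", symmetric] by simp
  also have "\<dots> = Zero C (Dom C (Z n)) (Dom C (Y (Suc (Suc n))))"
    unfolding ds[symmetric] by simp
  finally have "X (Suc n) \<cdot> ?t n \<oplus> ?t (Suc n) \<cdot> Z n = Zero C (Dom C (Z n)) (Dom C (X (Suc (Suc n))))"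
    using mono_cancel_Zero[OF split_mono[of "u (Suc (Suc n))" "r (Suc (Suc n))"], of "X (Suc n) \<cdot> ?t n \<oplus> ?t (Suc n) \<cdot> Z n"]
    by simp
  then show "?t (Suc n) \<cdot> Z n = Neg C (X (Suc n) \<cdot> ?t n)"
    by (intro Neg_unique) simp_all
qed

lemma cocycle_twist:
  assumes S: "degreewise_split C X Y Z u v r s" and z: "cocycle C Z n z"
  shows "cocycle C X (Suc n) (twist C Y r s n \<cdot> z)"
proof -
  note D = degreewise_split_simps[OF S]
  note [simp] = twist_simps(1-3)[OF S] cocycle_simps[OF z] cochain_complex_simps[OF D(1)]
    cochain_complex_simps[OF D(3)]
  have "Neg C (X (Suc n) \<cdot> twist C Y r s n) \<cdot> z = Zero C (Dom C z) (Dom C (X (Suc (Suc n))))"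
    using Comp_extend[OF twist_simps(6)[OF S, of n], of z] by simp
  then have "Neg C (Neg C (X (Suc n) \<cdot> twist C Y r s n) \<cdot> z) = Zero C (Dom C z) (Dom C (X (Suc (Suc n))))"
    by simp
  then show ?thesis by (simp add: cocycle_def)
qed

text \<open>\<open>R\<close> and \<open>R'\<close> stand for consecutive truncations, and
  \<open>b\<close> goes from degree 0 of \<open>R\<close> to the object resolved by
  \<open>R'\<close>. The augmentation of \<open>K\<close> starts at that same object of degree 0,
  which is why \<open>r 0 \<cdot> aug K\<close> can begin a comparison map.\<close>

lemma comparison_shift:
  assumes S: "degreewise_split C (diff X) (diff K) (diff Z) u v r s"
    and X: "aug X \<in> Arr C" "Cod C (aug X) = Dom C (diff X 0)"
    and K: "aug K \<in> Arr C" "Dom C (aug K) = Dom C (diff R 0)" "Cod C (aug K) = Dom C (diff K 0)"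
      "diff K 0 \<cdot> aug K = Zero C (Dom C (aug K)) (Dom C (diff K (Suc 0)))"
    and R: "cochain_complex C (diff R)" "aug R \<in> Arr C" "Cod C (aug R) = Dom C (diff R 0)" "Dom C (aug X) = Dom C (aug R)"
    and R': "aug R' \<in> Arr C" "Cod C (aug R') = Dom C (diff R (Suc 0))" "\<And>n. diff R' n = diff R (Suc n)"
    and b: "b \<in> Arr C" "Dom C b = Dom C (diff R 0)" "Cod C b = Dom C (aug R')" "aug R' \<cdot> b = diff R 0"
    and ua: "u 0 \<cdot> aug X = aug K \<cdot> aug R" and vb: "v 0 \<cdot> aug K = aug Z \<cdot> b"
    and g: "comparison C R' Z g"
  shows "comparison C R X (\<lambda>n. case n of 0 \<Rightarrow> r 0 \<cdot> aug K | Suc p \<Rightarrow> signed C (Suc p) (twist C (diff K) r s p \<cdot> g p))"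
proof -
  have g': "chain_map C (diff R') (diff Z) g" "g 0 \<cdot> aug R' = aug Z" using g by (auto simp: comparison_def)
  note D = degreewise_split_simps[OF S]
  note [simp] = D(6-15) cochain_complex_simps[OF D(1)] cochain_complex_simps[OF D(2)]
    cochain_complex_simps[OF D(3)] cochain_complex_simps[OF R(1)] twist_simps(1-3)[OF S]
    X K R(2-4) R'(1,2) b(1-3) chain_map_simps(1-3)[OF g'(1), unfolded R'(3)]
    chain_map_simps(1-3)[OF D(4)] chain_map_simps(1-3)[OF D(5)]
  let ?t = "twist C (diff K) r s"
  have "(r 0 \<cdot> aug K) \<cdot> aug R = r 0 \<cdot> (u 0 \<cdot> aug X)" by (simp add: ua)
  then have aug: "(r 0 \<cdot> aug K) \<cdot> aug R = aug X"
    using Comp_extend[OF D(12)[of 0], of "aug X"] by simp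
  \<comment> \<open>Applying \<open>r\<close> to \<open>d (aug K) = 0\<close> ties degree 0 to
    degree 1 and produces the first minus sign.\<close>
  have "Zero C (Dom C (diff R 0)) (Dom C (diff X (Suc 0))) = (r (Suc 0) \<cdot> diff K 0) \<cdot> aug K" by simp
  also have "\<dots> = (diff X 0 \<cdot> r 0 \<oplus> ?t 0 \<cdot> v 0) \<cdot> aug K" unfolding twist_simps(5)[OF S] ..
  also have "\<dots> = diff X 0 \<cdot> (r 0 \<cdot> aug K) \<oplus> ?t 0 \<cdot> (aug Z \<cdot> b)" by (simp add: vb)
  also have "aug Z \<cdot> b = g 0 \<cdot> diff R 0" unfolding g'(2)[symmetric] b(4)[symmetric] by simp
  finally have "?t 0 \<cdot> (g 0 \<cdot> diff R 0) = Neg C (diff X 0 \<cdot> (r 0 \<cdot> aug K))"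
    by (intro Neg_unique) simp_all
  then have 0: "diff X 0 \<cdot> (r 0 \<cdot> aug K) = signed C (Suc 0) (?t 0 \<cdot> g 0) \<cdot> diff R 0"
    by (simp add: signed_def)
  have Suc: "diff X (Suc p) \<cdot> signed C (Suc p) (?t p \<cdot> g p) = signed C (Suc (Suc p)) (?t (Suc p) \<cdot> g (Suc p)) \<cdot> diff R (Suc p)" for p
  proof -
    have "?t (Suc p) \<cdot> (g (Suc p) \<cdot> diff R (Suc p)) = Neg C (diff X (Suc p) \<cdot> (?t p \<cdot> g p))"
      using chain_map_simps(4)[OF g'(1), of p, unfolded R'(3)] Comp_extend[OF twist_simps(6)[OF S, of p], of "g p"]
      by simp
    then show ?thesis by (simp add: signed_def)
  qed
  show ?thesis
    unfolding comparison_def chain_map_def Hom_iff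
    using aug 0 Suc by (auto split: nat.split)
qed

end

section \<open>The snake map of a degreewise split sequence\<close>

context abelian_category
begin

text \<open>No lifting along the epimorphism \<open>v\<close> is needed: with \<open>y = u r y + s v y\<close>, the equation
  \<open>u x = d y\<close> gives \<open>x = r d y = d (r y) + twist (v y)\<close>.\<close>

lemma snake_class:
  assumes S: "degreewise_split C X Y Z u v r s"
  shows "snake C X Y Z u v p \<in> Arr C" "Dom C (snake C X Y Z u v p) = coh C Z p"
    "Cod C (snake C X Y Z u v p) = coh C X (Suc p)"
    "cocycle C Z p z \<Longrightarrow>
      snake C X Y Z u v p \<cdot> coh_class C Z p z = coh_class C X (Suc p) (twist C Y r s p \<cdot> z)"
proof -
  note D = degreewise_split_simps[OF S]
  note [simp] = D(6-15) cochain_complex_simps[OF D(1)] cochain_complex_simps[OF D(2)]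
    cochain_complex_simps[OF D(3)] twist_simps(1-3)[OF S]
    chain_map_simps(1-3)[OF D(4)] chain_map_simps(1-3)[OF D(5)] coh_proj_simps[OF D(1)] coh_proj_simps[OF D(3)]
  let ?t = "twist C Y r s"
  have zero: "coh_class C X (Suc p) (?t p \<cdot> incoming C Z p) = Zero C (Dom C (incoming C Z p)) (coh C X (Suc p))"
  proof (cases p)
    case 0
    then show ?thesis using coh_class_diff[OF D(1), of "Zero C (zero_object C) (Dom C (X 0))" 0] zero_object_Obj by simp
  next
    case (Suc m)
    \<comment> \<open>By anticommutation, \<open>twist\<close> after an incoming differential is the
      boundary of the negative of \<open>twist\<close> one degree lower.\<close>
    then show ?thesis
      using coh_class_diff[OF D(1), of "Neg C (?t m)" "Suc m"] twist_simps(6)[OF S, of m] by simp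
  qed
  obtain h where h: "h \<in> Arr C" "Dom C h = coh C Z p" "Cod C h = coh C X (Suc p)"
    "\<And>z. cocycle C Z p z \<Longrightarrow> h \<cdot> coh_class C Z p z = coh_class C X (Suc p) (?t p \<cdot> z)"
    by (rule coh_induced[OF D(3) D(1) _ _ _ cocycle_twist[OF S] zero]) auto
  have "snake C X Y Z u v p = h"
    unfolding snake_def
  proof (rule the_equality, intro conjI allI ballI impI)
    show "h \<in> Hom C (coh C Z p) (coh C X (Suc p))" using h by (simp add: Hom_iff)
    fix T y x
    assume "y \<in> Hom C T (Dom C (Y p))" "x \<in> Hom C T (Dom C (X (Suc p)))" and ux: "u (Suc p) \<cdot> x = Y p \<cdot> y"
    then have [simp]: "y \<in> Arr C" "Dom C y = T" "Cod C y = Dom C (Y p)"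
      "x \<in> Arr C" "Dom C x = T" "Cod C x = Dom C (X (Suc p))" by (auto simp: Hom_iff)
    have [simp]: "T \<in> Obj C" using Dom_in_Obj[of y] by simp
    have "Z p \<cdot> (v p \<cdot> y) = v (Suc p) \<cdot> (u (Suc p) \<cdot> x)"
      using Comp_extend[OF chain_map_simps(4)[OF D(5), of p], of y] ux by simp
    also have "\<dots> = Zero C T (Dom C (Z (Suc p)))"
      using Comp_extend[OF D(15)[of "Suc p"], of x] by simp
    finally have vy: "cocycle C Z p (v p \<cdot> y)" by (simp add: cocycle_def)
    have "x = r (Suc p) \<cdot> (u (Suc p) \<cdot> x)" using Comp_extend[OF D(12)[of "Suc p"], of x] by simp
    also have "\<dots> = (r (Suc p) \<cdot> Y p) \<cdot> y" unfolding ux by simp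
    also have "\<dots> = ?t p \<cdot> (v p \<cdot> y) \<oplus> X p \<cdot> (r p \<cdot> y)" unfolding twist_simps(5)[OF S] by (simp add: Add_commute)
    finally show "h \<cdot> coh_class C Z p (v p \<cdot> y) = coh_class C X (Suc p) x"
      using h(4)[OF vy] coh_class_add_diff[OF D(1) cocycle_twist[OF S vy], of "r p \<cdot> y"] by simp
  next
    fix h'
    assume h': "h' \<in> Hom C (coh C Z p) (coh C X (Suc p)) \<and>
      (\<forall>T. \<forall>y\<in>Hom C T (Dom C (Y p)). \<forall>x\<in>Hom C T (Dom C (X (Suc p))).
        u (Suc p) \<cdot> x = Y p \<cdot> y \<longrightarrow> h' \<cdot> coh_class C Z p (v p \<cdot> y) = coh_class C X (Suc p) x)"
    show "h' = h"
    proof (rule coh_ext[OF D(3)])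
      fix z assume z: "cocycle C Z p z"
      note [simp] = cocycle_simps[OF z]
      \<comment> \<open>For uniqueness, \<open>z\<close> is written as \<open>v y\<close> with
        \<open>y = s z\<close>. The choice \<open>x = ?t p \<cdot> z\<close> solves
        \<open>u x = d y\<close>, because the other component \<open>s d z\<close> vanishes on a
        cocycle.\<close>
      have "u (Suc p) \<cdot> (?t p \<cdot> z) = (u (Suc p) \<cdot> ?t p \<oplus> s (Suc p) \<cdot> Z p) \<cdot> z" by simp
      also have "\<dots> = Y p \<cdot> (s p \<cdot> z)" unfolding twist_simps(4)[OF S, symmetric] by simp
      finally have "h' \<cdot> coh_class C Z p (v p \<cdot> (s p \<cdot> z)) = coh_class C X (Suc p) (?t p \<cdot> z)"
        using h' by (auto simp: Hom_iff)
      moreover have "v p \<cdot> (s p \<cdot> z) = z" using Comp_extend[OF D(13)[of p], of z] by simp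
      ultimately show "h' \<cdot> coh_class C Z p z = h \<cdot> coh_class C Z p z" using h(4)[OF z] by simp
    qed (use h h' in \<open>auto simp: Hom_iff\<close>)
  qed
  then show "snake C X Y Z u v p \<in> Arr C" "Dom C (snake C X Y Z u v p) = coh C Z p"
    "Cod C (snake C X Y Z u v p) = coh C X (Suc p)"
    "cocycle C Z p z \<Longrightarrow>
      snake C X Y Z u v p \<cdot> coh_class C Z p z = coh_class C X (Suc p) (twist C Y r s p \<cdot> z)"
    using h by simp_all
qed

text \<open>Injectivity extends the identity along \<open>u\<close> to a retraction
  \<open>r\<close>; the complement \<open>Id - u r\<close> kills \<open>u\<close> and descends along
  \<open>v\<close> to the section \<open>s\<close>.\<close>

lemma short_exact_split:
  assumes S: "short_exact C u v" and I: "injective_object C (Dom C u)"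
  shows "\<exists>r s. is_biproduct C (Dom C u) (Cod C v) (Dom C v) u s r v"
proof -
  note u = short_exact_kernel[OF S] and v = short_exact_cokernel[OF S]
  note [simp] = kernel_simps(1,2,4)[OF u] cokernel_simps(3)[OF v, symmetric]
  obtain r where r [simp]: "r \<in> Arr C" "Dom C r = Cod C u" "Cod C r = Dom C u" "r \<cdot> u = Id C (Dom C u)"
    by (rule injective_extend_mono[OF I kernel_mono[OF u], of "Id C (Dom C u)"]) auto
  define e where "e = Id C (Dom C v) \<oplus> Neg C (u \<cdot> r)"
  have [simp]: "e \<in> Arr C" "Dom C e = Dom C v" "Cod C e = Dom C v" by (simp_all add: e_def)
  obtain s where s [simp]: "s \<in> Arr C" "Dom C s = Cod C v" "Cod C s = Dom C v" and sv: "s \<cdot> v = e"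
    by (rule cokernel_factor[OF v, of e]) (simp_all add: e_def)
  have sum: "u \<cdot> r \<oplus> s \<cdot> v = Id C (Dom C v)"
    unfolding sv e_def by (subst Add_left_commute) simp_all
  have "(v \<cdot> s) \<cdot> v = Id C (Cod C v) \<cdot> v"
    using Comp_extend[OF kernel_simps(4)[OF u], of r] by (simp add: sv e_def)
  then have vs: "v \<cdot> s = Id C (Cod C v)"
    by - (rule epi_cancel[OF cokernel_epi[OF v]], simp_all)
  have "(r \<cdot> s) \<cdot> v = Zero C (Dom C v) (Dom C u)"
    using Comp_extend[OF r(4), of r] by (simp add: sv e_def)
  then have "r \<cdot> s = Zero C (Cod C v) (Dom C u)"
    using epi_cancel_Zero[OF cokernel_epi[OF v], of "r \<cdot> s"] by simp
  then have "is_biproduct C (Dom C u) (Cod C v) (Dom C v) u s r v"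
    using vs sum by (simp add: is_biproduct_def Hom_iff)
  then show ?thesis by blast
qed

lemma degreewise_split_injective:
  assumes S: "short_exact_complexes C X Y Z u v" and I: "\<And>n. injective_object C (Dom C (X n))"
  obtains r s where "degreewise_split C X Y Z u v r s"
proof -
  have uv: "chain_map C X Y u" "chain_map C Y Z v" and "\<And>n. short_exact C (u n) (v n)"
    using S by (auto simp: short_exact_complexes_def)
  then have "\<exists>r s. is_biproduct C (Dom C (X n)) (Dom C (Z n)) (Dom C (Y n)) (u n) s r (v n)" for n
    using short_exact_split[of "u n" "v n"] I[of n] chain_map_simps[OF uv(1)] chain_map_simps[OF uv(2)] by simp
  then obtain r s where "\<And>n. is_biproduct C (Dom C (X n)) (Dom C (Z n)) (Dom C (Y n)) (u n) (s n) (r n) (v n)"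
    by metis
  then have "degreewise_split C X Y Z u v r s"
    using S by (simp add: degreewise_split_def short_exact_complexes_def)
  then show thesis by (rule that)
qed

end

section \<open>Syzygies and truncated resolutions\<close>

definition truncate :: "('o, 'm) precategory \<Rightarrow> 'm augmented \<Rightarrow> nat \<Rightarrow> 'm augmented" where
  "truncate C J q = \<lparr>aug = syzygy_inc C J q, diff = (\<lambda>n. diff J (n + q))\<rparr>"

lemma truncate_simps [simp]:
  "aug (truncate C J q) = syzygy_inc C J q" "diff (truncate C J q) = (\<lambda>n. diff J (n + q))"
  by (simp_all add: truncate_def)

text \<open>Cohomology is compared in positive degree because the truncated complex has a zero
  incoming arrow in degree 0, so that no boundaries are divided out there. Cocycles agree in every
  degree.\<close>

lemma coh_shift:
  "coh C (\<lambda>n. X (n + q)) (Suc k) = coh C X (Suc (k + q))"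
  "coh_class C (\<lambda>n. X (n + q)) (Suc k) z = coh_class C X (Suc (k + q)) z"
  "cocycle C (\<lambda>n. X (n + q)) k z = cocycle C X (k + q) z"
  by (simp_all add: coh_def coh_class_def coh_proj_def cocycle_def)

context abelian_category
begin

lemma syzygy_inc_kernel:
  assumes J: "resolution C M J"
  shows "is_kernel C (syzygy_inc C J q) (diff J q)"
proof (cases q)
  case 0
  then show ?thesis
    using kernel_if_exact_mono[OF resolution_simps(7)[OF J, of 0] ] resolution_simps(5)[OF J]
    by (simp add: aug_incoming_def)
next
  case (Suc p)
  then show ?thesis
    using kernel_ker_arr cochain_complex_simps(1)[OF resolution_simps(1)[OF J]] by simp
qed

lemma resolution_truncate:
  assumes J: "resolution C M J"
  shows "resolution C (syzygy C J q) (truncate C J q)"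
proof -
  note k = syzygy_inc_kernel[OF J, of q]
  have "exact_at C (diff J (n + q)) (diff J (Suc (n + q)))" for n
    using J by (simp add: resolution_def)
  moreover have "cochain_complex C (\<lambda>n. diff J (n + q))"
    using resolution_simps(1)[OF J] by (simp add: cochain_complex_def)
  ultimately show ?thesis
    using kernel_simps[OF k] kernel_mono[OF k] exact_at_if_kernel[OF k]
    by (simp add: resolution_def Hom_iff syzygy_def)
qed

text \<open>Exactness of \<open>J\<close> makes the corestriction of the differential epi. Composing
  it with the monomorphism \<open>syzygy_inc C J (Suc q)\<close> leaves its kernel unchanged, so
  this kernel is the previous syzygy.\<close>

lemma syzygy_proj_simps:
  assumes J: "resolution C M J"
  shows "syzygy_proj C J (Suc q) \<in> Arr C" "Dom C (syzygy_proj C J (Suc q)) = Dom C (diff J q)"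
    "Cod C (syzygy_proj C J (Suc q)) = syzygy C J (Suc q)"
    "syzygy_inc C J (Suc q) \<cdot> syzygy_proj C J (Suc q) = diff J q"
    "short_exact C (syzygy_inc C J q) (syzygy_proj C J (Suc q))"
proof -
  note X = resolution_simps(1)[OF J]
  note [simp] = cochain_complex_simps[OF X]
  note k = syzygy_inc_kernel[OF J, of "Suc q"] and k0 = syzygy_inc_kernel[OF J, of q]
  obtain h where h: "h \<in> Arr C" "Dom C h = Dom C (diff J q)" "Cod C h = Dom C (syzygy_inc C J (Suc q))"
    "syzygy_inc C J (Suc q) \<cdot> h = diff J q"
    by (rule kernel_factor[OF k, of "diff J q"]) simp_all
  have eq: "syzygy_proj C J (Suc q) = h"
    using factor_through_eq[OF kernel_mono[OF k] h(1,3)] h(4) by (simp add: syzygy_proj_def)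
  have epi: "is_epi C h"
    by (rule exact_at_factor_epi[OF _ k h(1,3,4)]) (use J in \<open>simp add: resolution_def\<close>)
  have "is_kernel C (syzygy_inc C J q) h"
    by (rule kernel_of_comp_mono[OF _ kernel_mono[OF k]]) (use h k0 in simp_all)
  then have "short_exact C (syzygy_inc C J q) h"
    by (intro short_exactI epi_cokernel_of_kernel[OF epi])
  then show "syzygy_proj C J (Suc q) \<in> Arr C" "Dom C (syzygy_proj C J (Suc q)) = Dom C (diff J q)"
    "Cod C (syzygy_proj C J (Suc q)) = syzygy C J (Suc q)"
    "syzygy_inc C J (Suc q) \<cdot> syzygy_proj C J (Suc q) = diff J q"
    "short_exact C (syzygy_inc C J q) (syzygy_proj C J (Suc q))"
    using h by (simp_all add: eq syzygy_def)
qed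

end

section \<open>Left exact functors and their derived functors\<close>

locale left_exact_functor = A: abelian_category A + B: abelian_category B
  for A :: "('o, 'm) precategory" and B :: "('p, 'n) precategory" +
  fixes F :: "('o, 'm, 'p, 'n) cat_functor"
  assumes additive: "additive_functor A B F"
    and left_exact: "left_exact A B F"
begin

lemma F_Arr [simp]:
  "f \<in> Arr A \<Longrightarrow> FArr F f \<in> Arr B"
  "f \<in> Arr A \<Longrightarrow> Dom B (FArr F f) = FObj F (Dom A f)"
  "f \<in> Arr A \<Longrightarrow> Cod B (FArr F f) = FObj F (Cod A f)"
  using additive unfolding additive_functor_def Hom_def by auto

lemma F_Obj [simp]: "a \<in> Obj A \<Longrightarrow> FObj F a \<in> Obj B"
  and F_Id [simp]: "a \<in> Obj A \<Longrightarrow> FArr F (Id A a) = Id B (FObj F a)"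
  using additive unfolding additive_functor_def by auto

lemma F_Comp [simp]:
  "\<lbrakk>f \<in> Arr A; g \<in> Arr A; Cod A f = Dom A g\<rbrakk> \<Longrightarrow> FArr F (g \<cdot>\<^bsub>A\<^esub> f) = FArr F g \<cdot>\<^bsub>B\<^esub> FArr F f"
  using additive unfolding additive_functor_def Hom_def by auto

lemma F_Add [simp]:
  "\<lbrakk>f \<in> Arr A; g \<in> Arr A; Dom A f = Dom A g; Cod A f = Cod A g\<rbrakk>
    \<Longrightarrow> FArr F (Add A f g) = Add B (FArr F f) (FArr F g)"
  using additive unfolding additive_functor_def Hom_def by auto

lemma F_Zero [simp]:
  assumes "a \<in> Obj A" "b \<in> Obj A"
  shows "FArr F (Zero A a b) = Zero B (FObj F a) (FObj F b)"
proof -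
  have "Add B (FArr F (Zero A a b)) (FArr F (Zero A a b)) = FArr F (Add A (Zero A a b) (Zero A a b))"
    using assms by (intro F_Add[symmetric]) simp_all
  then show ?thesis using B.Add_idem_Zero[of "FArr F (Zero A a b)"] assms by simp
qed

lemma F_Neg [simp]:
  assumes "f \<in> Arr A"
  shows "FArr F (Neg A f) = Neg B (FArr F f)"
proof -
  have "Add B (FArr F f) (FArr F (Neg A f)) = FArr F (Add A f (Neg A f))"
    using assms by (intro F_Add[symmetric]) simp_all
  then show ?thesis using B.Neg_unique[of "FArr F f" "FArr F (Neg A f)"] assms by simp
qed

lemma F_signed [simp]: "f \<in> Arr A \<Longrightarrow> FArr F (signed A k f) = signed B k (FArr F f)"
  by (simp add: signed_def)

lemma cochain_complex_F:
  assumes "cochain_complex A X"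
  shows "cochain_complex B (fmap F X)"
  using A.cochain_complex_simps[OF assms] F_Comp[of "X _" "X (Suc _)"]
  by (simp add: cochain_complex_def flip: F_Comp)

lemma chain_map_F:
  assumes "chain_map A X Y f" "cochain_complex A X" "cochain_complex A Y"
  shows "chain_map B (fmap F X) (fmap F Y) (fmap F f)"
  using A.cochain_complex_simps(1-3)[OF assms(2)] A.cochain_complex_simps(1-3)[OF assms(3)]
    A.chain_map_simps[OF assms(1)]
  by (simp add: chain_map_def Hom_iff flip: F_Comp)

lemma biproduct_F:
  assumes "is_biproduct A a b s i1 i2 p1 p2"
  shows "is_biproduct B (FObj F a) (FObj F b) (FObj F s) (FArr F i1) (FArr F i2) (FArr F p1) (FArr F p2)"
proof -
  note s = assms[unfolded is_biproduct_def Hom_iff]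
  have "a \<in> Obj A" "b \<in> Obj A" using A.Dom_in_Obj[of i1] A.Dom_in_Obj[of i2] s by auto
  then show ?thesis
    using s by (simp add: is_biproduct_def Hom_iff flip: F_Comp F_Add)
qed

lemma degreewise_split_F:
  assumes S: "degreewise_split A X Y Z u v r s"
  shows "degreewise_split B (fmap F X) (fmap F Y) (fmap F Z) (fmap F u) (fmap F v) (fmap F r) (fmap F s)"
    "twist B (fmap F Y) (fmap F r) (fmap F s) n = FArr F (twist A Y r s n)"
proof -
  note D = A.degreewise_split_simps[OF S]
  note [simp] = A.cochain_complex_simps(1,2)[OF D(1)] A.cochain_complex_simps(1,2)[OF D(2)]
    A.cochain_complex_simps(1,2)[OF D(3)] D(6-11)
  show "degreewise_split B (fmap F X) (fmap F Y) (fmap F Z) (fmap F u) (fmap F v) (fmap F r) (fmap F s)"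
    using cochain_complex_F[OF D(1)] cochain_complex_F[OF D(2)] cochain_complex_F[OF D(3)]
      chain_map_F[OF D(4,1,2)] chain_map_F[OF D(5,2,3)] S
    by (simp add: degreewise_split_def biproduct_F)
  show "twist B (fmap F Y) (fmap F r) (fmap F s) n = FArr F (twist A Y r s n)"
    by (simp add: twist_def)
qed

text \<open>\<open>left_exact\<close> speaks of short exact sequences, so the monomorphism is first
  completed by its cokernel.\<close>

lemma mono_F:
  assumes m: "is_mono A m"
  shows "is_mono B (FArr F m)"
proof -
  have q: "is_cokernel A (coker_arr A m) m" by (rule A.cokernel_coker_arr) (rule A.mono_Arr[OF m])
  then have "short_exact A m (coker_arr A m)"
    by (intro A.short_exactI A.mono_kernel_of_cokernel[OF m])
  then show ?thesis using left_exact by (auto simp: left_exact_def)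
qed

text \<open>Write \<open>f = m q\<close> with \<open>q\<close> a cokernel of \<open>k\<close> and
  \<open>m\<close> mono. Left exactness applies to the short exact pair \<open>k\<close>,
  \<open>q\<close>, and composing with the monomorphism \<open>F m\<close> leaves the kernel
  unchanged.\<close>

lemma kernel_F:
  assumes k: "is_kernel A k f"
  shows "is_kernel B (FArr F k) (FArr F f)"
proof -
  obtain q m where q: "is_cokernel A q k" and m: "is_mono A m" "Dom A m = Cod A q" "m \<cdot>\<^bsub>A\<^esub> q = f"
    using A.exact_at_if_kernel[OF k] by (rule A.exact_at_factor)
  have "short_exact A k q" by (intro A.short_exactI q A.kernel_of_cokernel[OF k])
  then have "is_kernel B (FArr F k) (FArr F q)"
    using left_exact B.kernel_if_exact_mono unfolding left_exact_def by blast
  then have "is_kernel B (FArr F k) (FArr F m \<cdot>\<^bsub>B\<^esub> FArr F q)"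
    using A.cokernel_simps[OF q] A.mono_Arr[OF m(1)] m by (intro B.kernel_comp_mono mono_F) simp_all
  then show ?thesis using A.cokernel_simps[OF q] A.mono_Arr[OF m(1)] m by (simp flip: F_Comp)
qed

end

section \<open>Derived functors and their connecting homomorphisms\<close>

locale derived_functors = left_exact_functor +
  fixes res :: "'a \<Rightarrow> 'b augmented"
  assumes enough: "enough_injectives A"
    and res: "\<And>X. X \<in> Obj A \<Longrightarrow> injective_resolution A X (res X)"
begin

abbreviation FR where "FR X \<equiv> fmap F (diff (res X))"

lemma res_simps:
  assumes "X \<in> Obj A"
  shows "resolution A X (res X)" "injective_object A (Dom A (diff (res X) n))" "cochain_complex B (FR X)"
  using res[OF assms] cochain_complex_F[OF A.resolution_simps(1)] by (auto simp: injective_resolution_def)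

text \<open>Under \<open>F\<close>, one term of the homotopy dies on a cocycle and the other is a
  boundary. A comparison map given by choice may thus be exchanged for an explicit one.\<close>

lemma comparison_coh_class:
  assumes M: "M \<in> Obj A" and R: "resolution A M R"
    and f: "comparison A R (res M) f" and g: "comparison A R (res M) g"
    and z: "cocycle B (fmap F (diff R)) (Suc n) z"
  shows "coh_class B (FR M) (Suc n) (FArr F (f (Suc n)) \<cdot>\<^bsub>B\<^esub> z) =
    coh_class B (FR M) (Suc n) (FArr F (g (Suc n)) \<cdot>\<^bsub>B\<^esub> z)"
proof -
  note S = res_simps[OF M]
  have g': "chain_map A (diff R) (diff (res M)) g" using g by (simp add: comparison_def)
  note RX = A.resolution_simps(1)[OF R] and SX = A.resolution_simps(1)[OF S(1)]
  obtain h where h [simp]: "\<And>n. h n \<in> Arr A" "\<And>n. Dom A (h n) = Dom A (diff R (Suc n))"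
      "\<And>n. Cod A (h n) = Dom A (diff (res M) n)"
    and fg: "\<And>n. f (Suc n) = Add A (g (Suc n))
      (Add A (diff (res M) n \<cdot>\<^bsub>A\<^esub> h n) (h (Suc n) \<cdot>\<^bsub>A\<^esub> diff R (Suc n)))"
    using A.comparison_homotopy[OF R res[OF M] f g] by blast
  note [simp] = A.cochain_complex_simps[OF RX] A.cochain_complex_simps[OF SX] A.chain_map_simps[OF g']
    B.cocycle_simps[OF z]
  have "FArr F (f (Suc n)) \<cdot>\<^bsub>B\<^esub> z =
      Add B (FArr F (g (Suc n)) \<cdot>\<^bsub>B\<^esub> z) (FArr F (diff (res M) n) \<cdot>\<^bsub>B\<^esub> (FArr F (h n) \<cdot>\<^bsub>B\<^esub> z))"
    unfolding fg by simp
  then show ?thesis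
    using B.coh_class_add_diff[OF S(3)
        B.cocycle_chain_map[OF cochain_complex_F[OF RX] S(3) chain_map_F[OF g' RX SX] z],
        of "FArr F (h n) \<cdot>\<^bsub>B\<^esub> z"]
    by simp
qed

text \<open>\<open>horseshoe\<close> guarantees that the \<open>SOME\<close> in
  \<open>connecting\<close> picks a genuine sequence of resolutions, and the formula is proved for
  whichever it picks. The splittings come from injectivity of the resolution of
  \<open>Dom A a\<close> and are pushed to \<open>B\<close> by \<open>F\<close>.\<close>

lemma connecting_twist:
  assumes ab: "short_exact A a b"
  obtains K u v r s where "resolution_sequence A res a b (K, u, v)"
    "degreewise_split A (diff (res (Dom A a))) (diff K) (diff (res (Cod A b))) u v r s"
    "\<And>p. connecting A B F res a b p \<in> Arr B"
    "\<And>p. Dom B (connecting A B F res a b p) = coh B (FR (Cod A b)) p"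
    "\<And>p. Cod B (connecting A B F res a b p) = coh B (FR (Dom A a)) (Suc p)"
    "\<And>p z. cocycle B (FR (Cod A b)) p z \<Longrightarrow>
      connecting A B F res a b p \<cdot>\<^bsub>B\<^esub> coh_class B (FR (Cod A b)) p z =
      coh_class B (FR (Dom A a)) (Suc p) (FArr F (twist A (diff K) r s p) \<cdot>\<^bsub>B\<^esub> z)"
proof -
  have Obj: "Dom A a \<in> Obj A" "Cod A b \<in> Obj A"
    using A.exact_at_Arr[of a b] ab by (simp_all add: short_exact_def)
  have "\<exists>S. resolution_sequence A res a b S"
  proof (rule A.horseshoe[OF enough ab res[OF Obj(1)] res[OF Obj(2)]])
    fix K u v
    assume "injective_resolution A (Cod A a) K"
      "short_exact_complexes A (diff (res (Dom A a))) (diff K) (diff (res (Cod A b))) u v"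
      "u 0 \<cdot>\<^bsub>A\<^esub> aug (res (Dom A a)) = aug K \<cdot>\<^bsub>A\<^esub> a"
      "v 0 \<cdot>\<^bsub>A\<^esub> aug K = aug (res (Cod A b)) \<cdot>\<^bsub>A\<^esub> b"
    then show ?thesis by (intro exI[of _ "(K, u, v)"]) (simp add: resolution_sequence_def)
  qed
  then have "resolution_sequence A res a b (SOME S. resolution_sequence A res a b S)" by (rule someI_ex)
  then obtain K u v where S: "(SOME S. resolution_sequence A res a b S) = (K, u, v)"
    and KS: "resolution_sequence A res a b (K, u, v)"
    by (metis prod_cases3)
  then have "short_exact_complexes A (diff (res (Dom A a))) (diff K) (diff (res (Cod A b))) u v"
    by (simp add: resolution_sequence_def)
  then obtain r s where D: "degreewise_split A (diff (res (Dom A a))) (diff K) (diff (res (Cod A b))) u v r s"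
    by (rule A.degreewise_split_injective) (rule res_simps[OF Obj(1)])
  have eq: "connecting A B F res a b p = snake B (FR (Dom A a)) (fmap F (diff K)) (FR (Cod A b)) (fmap F u) (fmap F v) p" for p
    by (simp add: connecting_def S)
  show thesis
    using that[OF KS D] B.snake_class[OF degreewise_split_F(1)[OF D]]
    unfolding eq[symmetric] degreewise_split_F(2)[OF D] by blast
qed

section \<open>Connecting steps along the syzygies and their composite\<close>

lemma syzygy_Obj: "resolution A M J \<Longrightarrow> syzygy A J q \<in> Obj A"
  using A.kernel_simps(2)[OF A.syzygy_inc_kernel] by (simp add: syzygy_def)

lemma syzygy_connecting_simps:
  assumes J: "resolution A M J"
  shows "syzygy_connecting A B F res J (Suc q) p \<in> Arr B"
    "Dom B (syzygy_connecting A B F res J (Suc q) p) = coh B (FR (syzygy A J (Suc q))) p"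
    "Cod B (syzygy_connecting A B F res J (Suc q) p) = coh B (FR (syzygy A J q)) (Suc p)"
  using connecting_twist[OF A.syzygy_proj_simps(5)[OF J, of q]] A.syzygy_proj_simps(3)[OF J, of q]
  by (simp_all add: syzygy_connecting_def syzygy_def) metis+

text \<open>The one cocycle \<open>w\<close> of \<open>FJ\<close> has degree \<open>p\<close> in the
  truncation at \<open>q + 1\<close> and degree \<open>p + 1\<close> in the truncation at
  \<open>q\<close>. The connecting map relates its images under the two comparison maps.\<close>

lemma syzygy_connecting_class:
  assumes J: "resolution A M J"
    and g: "comparison A (truncate A J (Suc q)) (res (syzygy A J (Suc q))) g"
    and f: "comparison A (truncate A J q) (res (syzygy A J q)) f"
    and w: "cocycle B (fmap F (diff J)) (Suc (p + q)) w"
  shows "syzygy_connecting A B F res J (Suc q) p \<cdot>\<^bsub>B\<^esub>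
      coh_class B (FR (syzygy A J (Suc q))) p (FArr F (g p) \<cdot>\<^bsub>B\<^esub> w) =
    signed B (Suc p) (coh_class B (FR (syzygy A J q)) (Suc p) (FArr F (f (Suc p)) \<cdot>\<^bsub>B\<^esub> w))"
proof -
  let ?a = "syzygy_inc A J q" and ?b = "syzygy_proj A J (Suc q)"
  let ?P = "syzygy A J q" and ?Q = "syzygy A J (Suc q)"
  note P = res_simps[OF syzygy_Obj[OF J, of q]] and Q = res_simps[OF syzygy_Obj[OF J, of "Suc q"]]
  note T = A.resolution_truncate[OF J, of q] and T' = A.resolution_truncate[OF J, of "Suc q"]
  note b = A.syzygy_proj_simps[OF J, of q]
  have a: "Dom A ?a = ?P" by (simp add: syzygy_def)
  obtain K u v r s where K: "resolution_sequence A res ?a ?b (K, u, v)"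
    and S: "degreewise_split A (diff (res ?P)) (diff K) (diff (res ?Q)) u v r s"
    and "\<And>p. connecting A B F res ?a ?b p \<in> Arr B"
    and "\<And>p. Dom B (connecting A B F res ?a ?b p) = coh B (FR ?Q) p"
    and "\<And>p. Cod B (connecting A B F res ?a ?b p) = coh B (FR ?P) (Suc p)"
    and conn: "\<And>p z. cocycle B (FR ?Q) p z \<Longrightarrow>
      connecting A B F res ?a ?b p \<cdot>\<^bsub>B\<^esub> coh_class B (FR ?Q) p z =
      coh_class B (FR ?P) (Suc p) (FArr F (twist A (diff K) r s p) \<cdot>\<^bsub>B\<^esub> z)"
    by (rule connecting_twist[OF b(5), unfolded a b(3)]) (rule that)
  have K': "resolution A (Cod A ?a) K" "u 0 \<cdot>\<^bsub>A\<^esub> aug (res ?P) = aug K \<cdot>\<^bsub>A\<^esub> ?a"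
    "v 0 \<cdot>\<^bsub>A\<^esub> aug K = aug (res ?Q) \<cdot>\<^bsub>A\<^esub> ?b"
    using K by (auto simp: resolution_sequence_def injective_resolution_def a b(3))
  note Ts = A.resolution_simps[OF T, simplified] and Ts' = A.resolution_simps[OF T', simplified]
    and Ks = A.resolution_simps[OF K'(1)]
  \<comment> \<open>A comparison map built from the very splitting that computes the connecting map;
    \<open>f\<close> is exchanged for it below.\<close>
  define f' where "f' = (\<lambda>n. case n of 0 \<Rightarrow> r 0 \<cdot>\<^bsub>A\<^esub> aug K |
    Suc p \<Rightarrow> signed A (Suc p) (twist A (diff K) r s p \<cdot>\<^bsub>A\<^esub> g p))"
  have f': "comparison A (truncate A J q) (res ?P) f'"
    unfolding f'_def
    by (rule A.comparison_shift[OF S, where R' = "truncate A J (Suc q)" and b = ?b])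
      (use A.resolution_simps(2-4)[OF P(1)] Ts(1-4) Ts'(2-4) Ks(2-4,6) K'(2,3) b(1-4) g
        A.cochain_complex_simps(2)[OF A.resolution_simps(1)[OF J], of q] in simp_all)
  have g': "chain_map A (diff (truncate A J (Suc q))) (diff (res ?Q)) g" using g by (simp add: comparison_def)
  have w': "cocycle B (fmap F (diff (truncate A J (Suc q)))) p w"
    using w coh_shift(3)[of B "fmap F (diff J)" "Suc q" p w] by simp
  have gw: "cocycle B (FR ?Q) p (FArr F (g p) \<cdot>\<^bsub>B\<^esub> w)"
    using B.cocycle_chain_map[OF cochain_complex_F[OF A.resolution_simps(1)[OF T']] Q(3)
        chain_map_F[OF g' A.resolution_simps(1)[OF T'] A.resolution_simps(1)[OF Q(1)]] w'] .
  note [simp] = A.twist_simps(1-3)[OF S] A.chain_map_simps(1-3)[OF g'] B.cocycle_simps[OF w']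
    A.cochain_complex_simps(1)[OF A.resolution_simps(1)[OF J]]
  have tw: "cocycle B (FR ?P) (Suc p) (FArr F (twist A (diff K) r s p) \<cdot>\<^bsub>B\<^esub> (FArr F (g p) \<cdot>\<^bsub>B\<^esub> w))"
    using B.cocycle_twist[OF degreewise_split_F(1)[OF S] gw] unfolding degreewise_split_F(2)[OF S] .
  have w'': "cocycle B (fmap F (diff (truncate A J q))) (Suc p) w"
    using w coh_shift(3)[of B "fmap F (diff J)" q "Suc p" w] by simp
  have "coh_class B (FR ?P) (Suc p) (FArr F (f (Suc p)) \<cdot>\<^bsub>B\<^esub> w) =
      coh_class B (FR ?P) (Suc p) (FArr F (f' (Suc p)) \<cdot>\<^bsub>B\<^esub> w)"
    by (rule comparison_coh_class[OF syzygy_Obj[OF J] T f f' w''])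
  also have "\<dots> = signed B (Suc p) (coh_class B (FR ?P) (Suc p)
      (FArr F (twist A (diff K) r s p) \<cdot>\<^bsub>B\<^esub> (FArr F (g p) \<cdot>\<^bsub>B\<^esub> w)))"
    using B.coh_class_signed[OF P(3) tw, of "Suc p"] by (simp add: f'_def)
  finally show ?thesis
    using conn[OF gw] B.coh_class_simps(1)[OF P(3) tw] by (simp add: syzygy_connecting_def signed_def)
qed

text \<open>The negative of the map induced by \<open>f\<close> in degree 1 satisfies the equation
  that describes \<open>connecting0_bar\<close>. It is the only such arrow because \<open>F\<close>
  of the syzygy inclusion is a kernel, so that its class is epi.\<close>

lemma connecting0_bar_class:
  assumes J: "resolution A M J" and f: "comparison A (truncate A J q) (res (syzygy A J q)) f"
  shows "connecting0_bar A B F res J (Suc q) \<in> Arr B"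
    "Dom B (connecting0_bar A B F res J (Suc q)) = coh B (fmap F (diff J)) (Suc q)"
    "Cod B (connecting0_bar A B F res J (Suc q)) = coh B (FR (syzygy A J q)) (Suc 0)"
    "cocycle B (fmap F (diff J)) (Suc q) z \<Longrightarrow>
      connecting0_bar A B F res J (Suc q) \<cdot>\<^bsub>B\<^esub> coh_class B (fmap F (diff J)) (Suc q) z =
      Neg B (coh_class B (FR (syzygy A J q)) (Suc 0) (FArr F (f (Suc 0)) \<cdot>\<^bsub>B\<^esub> z))"
proof -
  let ?P = "syzygy A J q" and ?Q = "syzygy A J (Suc q)" and ?i = "FArr F (syzygy_inc A J (Suc q))"
  note P = res_simps[OF syzygy_Obj[OF J, of q]] and Q = res_simps[OF syzygy_Obj[OF J, of "Suc q"]]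
  note T = A.resolution_truncate[OF J, of q] and T' = A.resolution_truncate[OF J, of "Suc q"]
  note FJ = cochain_complex_F[OF A.resolution_simps(1)[OF J]]
  have f': "chain_map A (diff (truncate A J q)) (diff (res ?P)) f" using f by (simp add: comparison_def)
  define \<beta> where "\<beta> = Neg B (coh_map B (fmap F (diff (truncate A J q))) (FR ?P) (fmap F f) (Suc 0))"
  note c = B.coh_map_class[OF cochain_complex_F[OF A.resolution_simps(1)[OF T]] P(3)
    chain_map_F[OF f' A.resolution_simps(1)[OF T] A.resolution_simps(1)[OF P(1)]], of "Suc 0"]
  have \<beta>: "\<beta> \<in> Arr B" "Dom B \<beta> = coh B (fmap F (diff J)) (Suc q)" "Cod B \<beta> = coh B (FR ?P) (Suc 0)"
    using c(1-3) coh_shift(1)[of B "fmap F (diff J)" q 0] by (simp_all add: \<beta>_def)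
  have \<beta>_class: "\<beta> \<cdot>\<^bsub>B\<^esub> coh_class B (fmap F (diff J)) (Suc q) z =
      Neg B (coh_class B (FR ?P) (Suc 0) (FArr F (f (Suc 0)) \<cdot>\<^bsub>B\<^esub> z))"
    if z: "cocycle B (fmap F (diff J)) (Suc q) z" for z
    using c(1,2) c(4)[of z] z B.coh_class_simps[OF FJ z] coh_shift(1,2)[of B "fmap F (diff J)" q 0]
      coh_shift(3)[of B "fmap F (diff J)" q "Suc 0" z]
    by (simp add: \<beta>_def)
  obtain g where g: "comparison A (truncate A J (Suc q)) (res ?Q) g"
    using A.comparison_exists[OF T' res[OF syzygy_Obj[OF J]]] by blast
  have g': "chain_map A (diff (truncate A J (Suc q))) (diff (res ?Q)) g"
      "g 0 \<cdot>\<^bsub>A\<^esub> syzygy_inc A J (Suc q) = aug (res ?Q)"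
    using g by (auto simp: comparison_def)
  note k = kernel_F[OF A.syzygy_inc_kernel[OF J, of "Suc q"]]
  have i: "cocycle B (fmap F (diff J)) (Suc q) ?i"
    using B.kernel_simps[OF k] B.cochain_complex_simps(2)[OF FJ, of "Suc q"] by (simp add: cocycle_def)
  \<comment> \<open>\<open>g 0\<close> carries the syzygy inclusion to the augmentation of the
    chosen resolution. The right-hand side of the describing equation is therefore the connecting
    formula for \<open>p = 0\<close> and \<open>w = ?i\<close>.\<close>
  have "derived0_iso B F res ?Q = coh_class B (FR ?Q) 0 (FArr F (g 0) \<cdot>\<^bsub>B\<^esub> ?i)"
    using A.chain_map_simps(1-3)[OF g'(1), of 0] A.kernel_simps[OF A.syzygy_inc_kernel[OF J, of "Suc q"]]
    unfolding derived0_iso_def g'(2)[symmetric] by (subst F_Comp) simp_all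
  then have \<beta>_i: "\<beta> \<cdot>\<^bsub>B\<^esub> coh_class B (fmap F (diff J)) (Suc q) ?i =
      syzygy_connecting A B F res J (Suc q) 0 \<cdot>\<^bsub>B\<^esub> derived0_iso B F res ?Q"
    using \<beta>_class[OF i] syzygy_connecting_class[OF J g f, of 0 ?i] i by (simp add: signed_def)
  have "connecting0_bar A B F res J (Suc q) = \<beta>"
    unfolding connecting0_bar_def
  proof (rule the_equality)
    show "\<beta> \<in> Hom B (coh B (fmap F (diff J)) (Suc q)) (right_derived B F res 1 (syzygy A J (Suc q - 1))) \<and>
      \<beta> \<cdot>\<^bsub>B\<^esub> coh_class B (fmap F (diff J)) (Suc q) ?i =
      syzygy_connecting A B F res J (Suc q) 0 \<cdot>\<^bsub>B\<^esub> derived0_iso B F res ?Q"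
      using \<beta> \<beta>_i by (simp add: Hom_iff right_derived_def)
    then show "\<gamma> = \<beta>" if "\<gamma> \<in> Hom B (coh B (fmap F (diff J)) (Suc q)) (right_derived B F res 1 (syzygy A J (Suc q - 1))) \<and>
      \<gamma> \<cdot>\<^bsub>B\<^esub> coh_class B (fmap F (diff J)) (Suc q) ?i =
      syzygy_connecting A B F res J (Suc q) 0 \<cdot>\<^bsub>B\<^esub> derived0_iso B F res ?Q" for \<gamma>
      using that B.coh_class_simps[OF FJ i]
      by - (rule B.epi_cancel[OF B.coh_class_kernel_epi[OF FJ k]], auto simp: Hom_iff)
  qed
  then show "connecting0_bar A B F res J (Suc q) \<in> Arr B"
    "Dom B (connecting0_bar A B F res J (Suc q)) = coh B (fmap F (diff J)) (Suc q)"
    "Cod B (connecting0_bar A B F res J (Suc q)) = coh B (FR (syzygy A J q)) (Suc 0)"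
    "cocycle B (fmap F (diff J)) (Suc q) z \<Longrightarrow>
      connecting0_bar A B F res J (Suc q) \<cdot>\<^bsub>B\<^esub> coh_class B (fmap F (diff J)) (Suc q) z =
      Neg B (coh_class B (FR (syzygy A J q)) (Suc 0) (FArr F (f (Suc 0)) \<cdot>\<^bsub>B\<^esub> z))"
    using \<beta> \<beta>_class by simp_all
qed

text \<open>The exponent stays a sum, so that each connecting step just adds a summand; its closed
  form is inserted in the final theorem.\<close>

lemma shift_partial_class:
  assumes J: "resolution A M J" and f: "comparison A (truncate A J q) (res (syzygy A J q)) f"
  shows "shift_partial A B F res J (Suc (k + q)) k \<in> Arr B"
    "Dom B (shift_partial A B F res J (Suc (k + q)) k) = coh B (fmap F (diff J)) (Suc (k + q))"
    "Cod B (shift_partial A B F res J (Suc (k + q)) k) = coh B (FR (syzygy A J q)) (Suc k)"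
    "cocycle B (fmap F (diff J)) (Suc (k + q)) z \<Longrightarrow>
      shift_partial A B F res J (Suc (k + q)) k \<cdot>\<^bsub>B\<^esub> coh_class B (fmap F (diff J)) (Suc (k + q)) z =
      signed B (\<Sum>i\<le>Suc k. i) (coh_class B (FR (syzygy A J q)) (Suc k) (FArr F (f (Suc k)) \<cdot>\<^bsub>B\<^esub> z))"
\<comment> \<open>One more step invokes the hypothesis at \<open>Suc q\<close>, which leaves the
  degree \<open>Suc (k + q)\<close> in \<open>FJ\<close> consistent. Since \<open>f\<close> belongs
  to the truncation at \<open>q\<close>, it has to vary along with \<open>q\<close>.\<close>
proof (atomize (full), insert f, induction k arbitrary: q f z)
  case 0
  then show ?case using connecting0_bar_class[OF J, of q f] by (simp add: signed_def)
next
  case (Suc k)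
  let ?P = "syzygy A J q" and ?Q = "syzygy A J (Suc q)"
  note P = res_simps[OF syzygy_Obj[OF J, of q]] and Q = res_simps[OF syzygy_Obj[OF J, of "Suc q"]]
  note T' = A.resolution_truncate[OF J, of "Suc q"]
  note FJ = cochain_complex_F[OF A.resolution_simps(1)[OF J]]
  obtain g where g: "comparison A (truncate A J (Suc q)) (res ?Q) g"
    using A.comparison_exists[OF T' res[OF syzygy_Obj[OF J]]] by blast
  have g': "chain_map A (diff (truncate A J (Suc q))) (diff (res ?Q)) g" using g by (simp add: comparison_def)
  let ?n = "Suc (Suc (k + q))"
  note IH = Suc.IH[OF g, simplified]
  note C = syzygy_connecting_simps[OF J, of q "Suc k"]
  \<comment> \<open>Here \<open>?n - Suc k\<close> is \<open>Suc q\<close>, so the new factor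
    belongs to the sequence with ends \<open>?P\<close> and \<open>?Q\<close>.\<close>
  have eq: "shift_partial A B F res J ?n (Suc k) =
      syzygy_connecting A B F res J (Suc q) (Suc k) \<cdot>\<^bsub>B\<^esub> shift_partial A B F res J ?n k"
    by (simp add: Suc_diff_le)
  have "shift_partial A B F res J ?n (Suc k) \<cdot>\<^bsub>B\<^esub> coh_class B (fmap F (diff J)) ?n z =
      signed B (\<Sum>i\<le>Suc (Suc k). i) (coh_class B (FR ?P) (Suc (Suc k)) (FArr F (f (Suc (Suc k))) \<cdot>\<^bsub>B\<^esub> z))"
    if z: "cocycle B (fmap F (diff J)) ?n z"
  proof -
    have z': "cocycle B (fmap F (diff (truncate A J (Suc q)))) (Suc k) z"
      using z coh_shift(3)[of B "fmap F (diff J)" "Suc q" "Suc k" z] by simp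
    have gz: "cocycle B (FR ?Q) (Suc k) (FArr F (g (Suc k)) \<cdot>\<^bsub>B\<^esub> z)"
      using B.cocycle_chain_map[OF cochain_complex_F[OF A.resolution_simps(1)[OF T']] Q(3)
        chain_map_F[OF g' A.resolution_simps(1)[OF T'] A.resolution_simps(1)[OF Q(1)]] z'] .
    have f': "chain_map A (diff (truncate A J q)) (diff (res ?P)) f" using Suc.prems by (simp add: comparison_def)
    note T = A.resolution_truncate[OF J, of q]
    have z'': "cocycle B (fmap F (diff (truncate A J q))) (Suc (Suc k)) z"
      using z coh_shift(3)[of B "fmap F (diff J)" q "Suc (Suc k)" z] by simp
    have fz: "cocycle B (FR ?P) (Suc (Suc k)) (FArr F (f (Suc (Suc k))) \<cdot>\<^bsub>B\<^esub> z)"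
      using B.cocycle_chain_map[OF cochain_complex_F[OF A.resolution_simps(1)[OF T]] P(3)
        chain_map_F[OF f' A.resolution_simps(1)[OF T] A.resolution_simps(1)[OF P(1)]] z''] .
    have "shift_partial A B F res J ?n (Suc k) \<cdot>\<^bsub>B\<^esub> coh_class B (fmap F (diff J)) ?n z =
        syzygy_connecting A B F res J (Suc q) (Suc k) \<cdot>\<^bsub>B\<^esub>
          signed B (\<Sum>i\<le>Suc k. i) (coh_class B (FR ?Q) (Suc k) (FArr F (g (Suc k)) \<cdot>\<^bsub>B\<^esub> z))"
      unfolding eq using IH C B.coh_class_simps[OF FJ z] z by simp
    also have "\<dots> = signed B (\<Sum>i\<le>Suc k. i) (signed B (Suc (Suc k))
        (coh_class B (FR ?P) (Suc (Suc k)) (FArr F (f (Suc (Suc k))) \<cdot>\<^bsub>B\<^esub> z)))"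
      using syzygy_connecting_class[OF J g Suc.prems, of "Suc k" z] z C B.coh_class_simps[OF Q(3) gz] by simp
    also have "\<dots> = signed B (\<Sum>i\<le>Suc (Suc k). i)
        (coh_class B (FR ?P) (Suc (Suc k)) (FArr F (f (Suc (Suc k))) \<cdot>\<^bsub>B\<^esub> z))"
      using B.coh_class_simps[OF P(3) fz] by (simp add: add.commute)
    finally show ?thesis .
  qed
  then show ?case using IH C by (simp add: eq)
qed

text \<open>This is the composite with \<open>q = 0\<close>: truncation at 0 has the augmentation
  and the differentials of \<open>J\<close>, and the comparison chosen in
  \<open>canonical_iso\<close> is taken for \<open>f\<close>. Both sides then agree on all
  classes.\<close>

lemma dimension_shift_iso_eq:
  assumes M: "M \<in> Obj A" and J: "resolution A M J" and n: "n \<ge> 1"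
  shows "dimension_shift_iso A B F res J n = signed B (\<Sum>i\<le>n. i) (canonical_iso A B F res M J n)"
    "canonical_iso A B F res M J n \<in> Hom B (coh B (fmap F (diff J)) n) (right_derived B F res n M)"
proof -
  obtain k where k: "n = Suc k" using n by (cases n) auto
  note R = res_simps[OF M]
  define f where "f = (SOME f. chain_map A (diff J) (diff (res M)) f \<and> f 0 \<cdot>\<^bsub>A\<^esub> aug J = aug (res M))"
  have f: "comparison A J (res M) f"
    using someI_ex[OF A.comparison_exists[OF J res[OF M], unfolded comparison_def]]
    by (simp add: comparison_def f_def)
  then have f': "chain_map A (diff J) (diff (res M)) f" by (simp add: comparison_def)
  have "syzygy A J 0 = M" using A.resolution_simps(3)[OF J] by (simp add: syzygy_def)
  moreover have "comparison A (truncate A J 0) (res M) f" using f by (simp add: comparison_def)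
  ultimately have S: "dimension_shift_iso A B F res J n \<in> Arr B"
    "Dom B (dimension_shift_iso A B F res J n) = coh B (fmap F (diff J)) n"
    "Cod B (dimension_shift_iso A B F res J n) = coh B (FR M) n"
    "\<And>z. cocycle B (fmap F (diff J)) n z \<Longrightarrow>
      dimension_shift_iso A B F res J n \<cdot>\<^bsub>B\<^esub> coh_class B (fmap F (diff J)) n z =
      signed B (\<Sum>i\<le>n. i) (coh_class B (FR M) n (FArr F (f n) \<cdot>\<^bsub>B\<^esub> z))"
    using shift_partial_class[OF J, of 0 f k] by (simp_all add: dimension_shift_iso_def k)
  note FJ = cochain_complex_F[OF A.resolution_simps(1)[OF J]]
  have eq: "canonical_iso A B F res M J n = coh_map B (fmap F (diff J)) (FR M) (fmap F f) n"
    by (simp add: canonical_iso_def f_def)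
  note c = B.coh_map_class[OF FJ R(3) chain_map_F[OF f' A.resolution_simps(1)[OF J] A.resolution_simps(1)[OF R(1)]],
      of n, folded eq]
  show "canonical_iso A B F res M J n \<in> Hom B (coh B (fmap F (diff J)) n) (right_derived B F res n M)"
    using c by (simp add: Hom_iff right_derived_def)
  show "dimension_shift_iso A B F res J n = signed B (\<Sum>i\<le>n. i) (canonical_iso A B F res M J n)"
  proof (rule B.coh_ext[OF FJ])
    fix z assume z: "cocycle B (fmap F (diff J)) n z"
    then show "dimension_shift_iso A B F res J n \<cdot>\<^bsub>B\<^esub> coh_class B (fmap F (diff J)) n z =
      signed B (\<Sum>i\<le>n. i) (canonical_iso A B F res M J n) \<cdot>\<^bsub>B\<^esub> coh_class B (fmap F (diff J)) n z"
      using S(4)[OF z] c B.coh_class_simps[OF FJ z] by simp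
  qed (use S c in simp_all)
qed

end

theorem mainTheorem1:
  fixes A :: "('o, 'm) precategory" and B :: "('p, 'n) precategory"
    and F :: "('o, 'm, 'p, 'n) cat_functor"
    and res :: "'o \<Rightarrow> 'm augmented"
    and M :: 'o and J :: "'m augmented" and n :: nat
  assumes "abelian_category A" and "enough_injectives A"
    and "abelian_category B"
    and "additive_functor A B F" and "left_exact A B F"
    and "\<And>X. X \<in> Obj A \<Longrightarrow> injective_resolution A X (res X)"
    and "M \<in> Obj A"
    and "acyclic_resolution A B F res M J"
    and "n \<ge> 1"
  shows "dimension_shift_iso A B F res J n =
         canonical_iso A B F res M J n
           [^]\<^bsub>hom_group B (coh B (fmap F (diff J)) n) (right_derived B F res n M)\<^esub>
           ((- 1) ^ ((n\<^sup>2 + n) div 2) :: int)"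
proof -
  interpret A: abelian_category A by fact
  interpret B: abelian_category B by fact
  interpret derived_functors A B F res
    by unfold_locales (use assms in auto)
  have J: "resolution A M J" using assms(8) by (simp add: acyclic_resolution_def)
  have "(\<Sum>i\<le>n. i) = (n\<^sup>2 + n) div 2"
    using gauss_sum_nat[of n] by (simp add: atLeast0AtMost power2_eq_square algebra_simps)
  then show ?thesis
    using dimension_shift_iso_eq[OF assms(7) J assms(9)]
    by (simp add: B.signed_int_pow)
qed

end
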